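(* Let $l\ge1$, $0\le q<1$, and $a=(a_1,\dots,a_l)\in\mathbb{R}_{\ge0}^l$ with $\sum_ia_i=1$. Let $w_1,w_2,\dots$ be i.i.d. random letters in $[l]$ with $\mathbb{P}(w_m=k)=a_k$. Let $\mathcal{P}(0)=\emptyset$, and for $m\ge1$ let $\mathcal{P}(m)$ be obtained by $q$-inserting $w_m$ into $\mathcal{P}(m-1)$; that is, conditionally on the past, $\mathcal{P}(m)=\tilde P$ with probability $I_{w_m}(\mathcal{P}(m-1),\tilde P)$. Let $\mathcal{L}(m)=\mathrm{sh}\,\mathcal{P}(m)$. Then the following hold. 1. $(\mathcal{P}(n))_{n\ge0}$ is a Markov chain on $\mathcal{T}_l$ with transition probabilities $M(P,\tilde P)=\sum_{k=1}^{l}a_kI_k(P,\tilde P)$. 2. $(\mathcal{L}(n))_{n\ge0}$ is a Markov chain on $\Omega^l$ with transition probabilities $$p(\mu,\lambda)=\frac{\Psi_a(\lambda)}{\Psi_a(\mu)}L(\mu,\lambda)\mathbb{1}_{\mu\nearrow\lambda}.$$ 3. For each $n$ and $\lambda$, $$\mathbb{P}\big(\mathcal{P}(n)=P\mid\mathcal{L}(1),\dots,\mathcal{L}(n);\mathcal{L}(n)=\lambda\big)=\frac{K(\lambda,P)}{\Psi_a(\lambda)}.$$ 4. For each $n$ and $\lambda$, $$\mathbb{P}\big(\mathrm{ty}\,\mathcal{P}(n)=\mu\mid\mathcal{L}(1),\dots,\mathcal{L}(n);\mathcal{L}(n)=\lambda\big)=\frac{a^\mu k_{\lambda\mu}(q)}{\Delta_l(\lambda)\Psi_a(\lambda)}.$$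 5. For $\lambda\vdash n$, $$\mathbb{P}(\mathcal{L}(n)=\lambda)=(\lambda_l)_q^{-1}\Psi_a(\lambda)f^\lambda(q).$$
   Context: Notation. $[l]=\{1,\dots,l\}$. $(m)_q=(1-q)\cdots(1-q^m)$, with $(0)_q=1$. $e_i$ is the $i$-th standard basis vector. $\Omega^l$ is the set of partitions with at most $l$ parts. $\mu\nearrow\lambda$ means $\lambda$ is obtained from $\mu$ by adding one box. For a composition $\mu$, $a^\mu=\prod_ia_i^{\mu_i}$. Tableaux. $\mathcal{T}_l$ is the set of (semistandard) tableaux with entries in $[l]$: rows weakly increasing, columns strictly increasing, empty tableau included. $\mathcal{S}_n$ is the set of standard tableaux of size $n$. $\mathrm{sh}\,P$ is the shape of $P$. $\mathrm{ty}\,P=(\mu_1,\dots,\mu_l)$, where $\mu_i$ is the number of entries equal to $i$, and $a^P=a^{\mathrm{ty}P}$. For $P\in\mathcal{T}_l$, $P^i$ is the subtableau of entries $\le i$, and $\lambda^i=\mathrm{sh}\,P^i$. Parts are $\lambda^i_j$, with $\lambda^i_j=0$ for $j>i$, for $j=0$, or beyond the length. Kernel $I_k(P,\tilde P)$ for $k\in[l]$. Write $\lambda^i=\mathrm{sh}\,P^i$ and $\tilde\lambda^i=\mathrm{sh}\,\tilde P^i$. It is $0$ unless $\mathrm{ty}\,\tilde P=\mathrm{ty}\,P+e_k$ and there is a weakly decreasing sequence $k=j_{k-1}\ge j_k\ge\dots\ge j_l\ge1$ with $\tilde\lambda^i=\lambda^i$ for $i<k$ and $\tilde\lambda^i=\lambda^i+e_{j_i}$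 for $k\le i\le l$. In that case, define for $j>1$ $$f_0(i,j)=1-q^{\lambda^{i-1}_{j-1}-\lambda^i_j},\qquad f_1(i,j)=\frac{1-q^{\lambda^{i-1}_{j-1}-\lambda^i_j}}{1-q^{\lambda^{i-1}_{j-1}-\lambda^{i-1}_j}},$$ and $f_0(i,1)=f_1(i,1)=1$. Set $f(i,j)=f_1(i,j)$ if $j=j_{i-1}$ and $i\ne k$, and $f(i,j)=f_0(i,j)$ otherwise. Then $$I_k(P,\tilde P)=\prod_{i=k}^l\Big(f(i,j_i)\prod_{j=j_i+1}^{j_{i-1}}(1-f(i,j))\Big).$$ The function $\kappa$. For $P\in\mathcal{T}_l$, $$\kappa(P)=\frac{\prod_{j=2}^{l-1}\prod_{i=1}^{j-1}(\lambda^j_i-\lambda^j_{i+1})_q}{\prod_{j=1}^{l-1}\prod_{i=1}^{j}(\lambda^j_i-\lambda^{j+1}_{i+1})_q(\lambda^{j+1}_i-\lambda^j_i)_q}.$$ Derived quantities. - $K(\lambda,P)=a^P\kappa(P)\mathbb{1}_{\mathrm{sh}P=\lambda}$. - $\Psi_a(\lambda)=\sum_{P\in\mathcal{T}_l:\mathrm{sh}P=\lambda}a^P\kappa(P)$. - $\Delta_l(\lambda)=\prod_{i=1}^{l-1}(\lambda_i-\lambda_{i+1})_q$. - $k_{\lambda\mu}(q)=\Delta_l(\lambda)\sum_{P:\mathrm{sh}P=\lambda,\mathrm{ty}P=\mu}\kappa(P)$. - $L(\lambda,\lambda+e_i)=1-q^{\lambda_i-\lambda_{i+1}+1}$ for $1\le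 i<l$, $L(\lambda,\lambda+e_l)=1$, and $L(\lambda,\nu)=0$ for all other $\nu$. The function $\rho$. For $Q\in\mathcal{S}_n$ with $\mu^i=\mathrm{sh}\,Q^i$ and $\mu^0=\emptyset$, $\rho(Q)=\prod(1-q^{\mu^i_j-\mu^i_{j+1}})$, where the product is over pairs $(i,j)$ with $1\le i\le n$ and $\mu^i_j-\mu^{i-1}_j=1$. Finally $f^\lambda(q)=\sum_{Q\in\mathcal{S}_n:\mathrm{sh}Q=\lambda}\rho(Q)$. *)

theory Defs
  imports "HOL-Probability.Probability"
begin

definition qpoch :: "real \<Rightarrow> nat \<Rightarrow> real" where
  "qpoch q m = (\<Prod>i=1..m. 1 - q ^ i)"


section \<open>Partitions\<close>

text \<open>A partition is the weakly decreasing list of its positive parts; parts are indexed from 1.\<close>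

definition is_partition :: "nat list \<Rightarrow> bool" where
  "is_partition lam \<longleftrightarrow> sorted_wrt (\<ge>) lam \<and> 0 \<notin> set lam"

definition Omega :: "nat \<Rightarrow> nat list set" where
  "Omega l = {lam. is_partition lam \<and> length lam \<le> l}"

definition nth_part :: "nat list \<Rightarrow> nat \<Rightarrow> nat" where
  "nth_part lam j = (if 1 \<le> j \<and> j \<le> length lam then lam ! (j - 1) else 0)"

text \<open>\<open>plus_e lam i nu\<close> says that \<open>nu = lam + e\<^sub>i\<close>.\<close>

definition plus_e :: "nat list \<Rightarrow> nat \<Rightarrow> nat list \<Rightarrow> bool" where
  "plus_e lam i nu \<longleftrightarrow> (\<forall>r\<ge>1. nth_part nu r = nth_part lam r + (if r = i then 1 else 0))"

definition adds_box :: "nat list \<Rightarrow> nat list \<Rightarrow> bool" where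
  "adds_box mu lam \<longleftrightarrow> (\<exists>i\<ge>1. plus_e mu i lam)"


section \<open>Tableaux\<close>

text \<open>A tableau is the list of its nonempty rows, from the longest (first) row on.\<close>

type_synonym tableau = "nat list list"

definition semistandard :: "tableau \<Rightarrow> bool" where
  "semistandard P \<longleftrightarrow>
     is_partition (map length P) \<and>
     (\<forall>r\<in>set P. sorted r) \<and>
     (\<forall>i j. Suc i < length P \<longrightarrow> j < length (P ! Suc i) \<longrightarrow> P ! i ! j < P ! Suc i ! j)"

definition tableaux :: "nat \<Rightarrow> tableau set" where
  "tableaux l = {P. semistandard P \<and> (\<forall>r\<in>set P. set r \<subseteq> {1..l})}"

definition standard_tableaux :: "nat \<Rightarrow> tableau set" where
  "standard_tableaux n = {Q. semistandard Q \<and> mset (concat Q) = mset_set {1..n}}"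

definition sh :: "tableau \<Rightarrow> nat list" where
  "sh P = map length P"

text \<open>Compositions are functions on the letters; the type of a tableau in \<open>tableaux l\<close>
  vanishes outside \<open>{1..l}\<close>.\<close>

definition ty :: "tableau \<Rightarrow> nat \<Rightarrow> nat" where
  "ty P = (\<lambda>i. count_list (concat P) i)"

definition weight :: "nat \<Rightarrow> (nat \<Rightarrow> real) \<Rightarrow> (nat \<Rightarrow> nat) \<Rightarrow> real" where
  "weight l a mu = (\<Prod>i=1..l. a i ^ mu i)"

definition subtab :: "tableau \<Rightarrow> nat \<Rightarrow> tableau" where
  "subtab P i = filter (\<lambda>r. r \<noteq> []) (map (filter (\<lambda>x. x \<le> i)) P)"

text \<open>\<open>lev P i j\<close> is the \<open>j\<close>-th part of the shape of the subtableau of entries at most \<open>i\<close>.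
  The differences of parts below are nonnegative on the tableaux in question, by interlacing,
  so truncated subtraction is harmless.\<close>

definition lev :: "tableau \<Rightarrow> nat \<Rightarrow> nat \<Rightarrow> nat" where
  "lev P i j = nth_part (sh (subtab P i)) j"


section \<open>The q-insertion kernel\<close>

definition f0 :: "real \<Rightarrow> tableau \<Rightarrow> nat \<Rightarrow> nat \<Rightarrow> real" where
  "f0 q P i j = (if j = 1 then 1 else 1 - q ^ (lev P (i - 1) (j - 1) - lev P i j))"

definition f1 :: "real \<Rightarrow> tableau \<Rightarrow> nat \<Rightarrow> nat \<Rightarrow> real" where
  "f1 q P i j = (if j = 1 then 1 else
     (1 - q ^ (lev P (i - 1) (j - 1) - lev P i j)) /
     (1 - q ^ (lev P (i - 1) (j - 1) - lev P (i - 1) j)))"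

definition insertion_path :: "nat \<Rightarrow> nat \<Rightarrow> tableau \<Rightarrow> tableau \<Rightarrow> (nat \<Rightarrow> nat) \<Rightarrow> bool" where
  "insertion_path l k P P' j \<longleftrightarrow>
     j (k - 1) = k \<and> (\<forall>i\<in>{k..l}. j i \<le> j (i - 1)) \<and> 1 \<le> j l \<and>
     (\<forall>i<k. sh (subtab P' i) = sh (subtab P i)) \<and>
     (\<forall>i\<in>{k..l}. plus_e (sh (subtab P i)) (j i) (sh (subtab P' i)))"

definition path_weight :: "real \<Rightarrow> nat \<Rightarrow> nat \<Rightarrow> tableau \<Rightarrow> (nat \<Rightarrow> nat) \<Rightarrow> real" where
  "path_weight q l k P j =
     (let f = (\<lambda>i r. if r = j (i - 1) \<and> i \<noteq> k then f1 q P i r else f0 q P i r)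
      in \<Prod>i=k..l. f i (j i) * (\<Prod>r = j i + 1..j (i - 1). 1 - f i r))"

text \<open>The values of an insertion path on \<open>{k - 1..l}\<close>, the only ones that enter
  \<open>path_weight\<close>, are determined by the two tableaux, so the choice is immaterial.\<close>

definition q_insert :: "real \<Rightarrow> nat \<Rightarrow> nat \<Rightarrow> tableau \<Rightarrow> tableau \<Rightarrow> real" where
  "q_insert q l k P P' =
     (if ty P' = (ty P)(k := ty P k + 1) \<and> (\<exists>j. insertion_path l k P P' j)
      then path_weight q l k P (SOME j. insertion_path l k P P' j)
      else 0)"

definition trans_M :: "real \<Rightarrow> nat \<Rightarrow> (nat \<Rightarrow> real) \<Rightarrow> tableau \<Rightarrow> tableau \<Rightarrow> real" where
  "trans_M q l a P P' = (\<Sum>k=1..l. a k * q_insert q l k P P')"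


section \<open>Weights of tableaux and derived quantities\<close>

definition kappa :: "real \<Rightarrow> nat \<Rightarrow> tableau \<Rightarrow> real" where
  "kappa q l P =
     (\<Prod>j=2..<l. \<Prod>i=1..<j. qpoch q (lev P j i - lev P j (i + 1))) /
     (\<Prod>j=1..<l. \<Prod>i=1..j.
        qpoch q (lev P j i - lev P (j + 1) (i + 1)) * qpoch q (lev P (j + 1) i - lev P j i))"

definition K_weight :: "real \<Rightarrow> nat \<Rightarrow> (nat \<Rightarrow> real) \<Rightarrow> nat list \<Rightarrow> tableau \<Rightarrow> real" where
  "K_weight q l a lam P = weight l a (ty P) * kappa q l P * of_bool (sh P = lam)"

definition Psi :: "real \<Rightarrow> nat \<Rightarrow> (nat \<Rightarrow> real) \<Rightarrow> nat list \<Rightarrow> real" where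
  "Psi q l a lam = (\<Sum>P | P \<in> tableaux l \<and> sh P = lam. weight l a (ty P) * kappa q l P)"

definition Delta :: "real \<Rightarrow> nat \<Rightarrow> nat list \<Rightarrow> real" where
  "Delta q l lam = (\<Prod>i=1..<l. qpoch q (nth_part lam i - nth_part lam (i + 1)))"

definition k_coeff :: "real \<Rightarrow> nat \<Rightarrow> nat list \<Rightarrow> (nat \<Rightarrow> nat) \<Rightarrow> real" where
  "k_coeff q l lam mu =
     Delta q l lam * (\<Sum>P | P \<in> tableaux l \<and> sh P = lam \<and> ty P = mu. kappa q l P)"

text \<open>At most one summand is nonzero, since \<open>i\<close> is determined by \<open>lam\<close> and \<open>nu\<close>.\<close>

definition L_ker :: "real \<Rightarrow> nat \<Rightarrow> nat list \<Rightarrow> nat list \<Rightarrow> real" where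
  "L_ker q l lam nu =
     (\<Sum>i=1..l. if plus_e lam i nu
        then (if i < l then 1 - q ^ (nth_part lam i - nth_part lam (i + 1) + 1) else 1) else 0)"

definition trans_p :: "real \<Rightarrow> nat \<Rightarrow> (nat \<Rightarrow> real) \<Rightarrow> nat list \<Rightarrow> nat list \<Rightarrow> real" where
  "trans_p q l a mu lam =
     Psi q l a lam / Psi q l a mu * L_ker q l mu lam * of_bool (adds_box mu lam)"

definition rho :: "real \<Rightarrow> nat \<Rightarrow> tableau \<Rightarrow> real" where
  "rho q n Q =
     (\<Prod>(i, j) | 1 \<le> i \<and> i \<le> n \<and> 1 \<le> j \<and> lev Q i j = lev Q (i - 1) j + 1.
        1 - q ^ (lev Q i j - lev Q i (j + 1)))"

definition f_lambda :: "real \<Rightarrow> nat list \<Rightarrow> real" where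
  "f_lambda q lam =
     (\<Sum>Q | Q \<in> standard_tableaux (sum_list lam) \<and> sh Q = lam. rho q (sum_list lam) Q)"


section \<open>Markov chains with discrete state space\<close>

definition stochastic_on :: "'s set \<Rightarrow> ('s \<Rightarrow> 's \<Rightarrow> real) \<Rightarrow> bool" where
  "stochastic_on S p \<longleftrightarrow> (\<forall>x\<in>S. (\<forall>y\<in>S. 0 \<le> p x y) \<and> (p x has_sum 1) S)"

definition markov_chain ::
  "'w measure \<Rightarrow> 's set \<Rightarrow> (nat \<Rightarrow> 'w \<Rightarrow> 's) \<Rightarrow> ('s \<Rightarrow> 's \<Rightarrow> real) \<Rightarrow> bool" where
  "markov_chain M S X p \<longleftrightarrow>
     (\<forall>n. X n \<in> M \<rightarrow>\<^sub>M count_space UNIV) \<and>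
     (\<forall>n. AE \<omega> in M. X n \<omega> \<in> S) \<and>
     (\<forall>n h y. y \<in> S \<longrightarrow>
        \<P>(\<omega> in M. \<forall>i\<le>n. X i \<omega> = h i) > 0 \<longrightarrow>
        \<P>(\<omega> in M. X (Suc n) \<omega> = y \<bar> \<forall>i\<le>n. X i \<omega> = h i) = p (h n) y)"


section \<open>The q-insertion process\<close>

text \<open>\<open>w m\<close> is the \<open>m\<close>-th letter and \<open>PP m\<close> the tableau after \<open>m\<close> insertions. The past of step
  \<open>m\<close> consists of the letters and tableaux with index below \<open>m\<close>. The second clause says that the
  letters are fresh: the next one is independent of the past, including the randomness already used
  in the insertions; as the past takes countably many values, independence of
  elementary events is enough. The last clause gives the conditional law of \<open>PP m\<close> given the past and
  \<open>w m\<close>.\<close>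

definition q_insertion_process ::
  "'w measure \<Rightarrow> real \<Rightarrow> nat \<Rightarrow> (nat \<Rightarrow> 'w \<Rightarrow> nat) \<Rightarrow> (nat \<Rightarrow> 'w \<Rightarrow> tableau) \<Rightarrow> bool" where
  "q_insertion_process M q l w PP \<longleftrightarrow>
     (\<forall>m. PP m \<in> M \<rightarrow>\<^sub>M count_space UNIV) \<and>
     (\<forall>m\<ge>1. \<forall>k u h. prob_space.indep_event M {\<omega> \<in> space M. w m \<omega> = k}
        {\<omega> \<in> space M. (\<forall>i\<in>{1..<m}. w i \<omega> = u i) \<and> (\<forall>i<m. PP i \<omega> = h i)}) \<and>
     (\<forall>\<omega>\<in>space M. PP 0 \<omega> = []) \<and>
     (\<forall>m\<ge>1. \<forall>u h. \<forall>P'\<in>tableaux l.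
        \<P>(\<omega> in M. (\<forall>i\<in>{1..m}. w i \<omega> = u i) \<and> (\<forall>i<m. PP i \<omega> = h i)) > 0 \<longrightarrow>
        \<P>(\<omega> in M. PP m \<omega> = P' \<bar> (\<forall>i\<in>{1..m}. w i \<omega> = u i) \<and> (\<forall>i<m. PP i \<omega> = h i))
          = q_insert q l (u m) (h (m - 1)) P')"

end

theory Submission
  imports Defs
begin

text \<open>
  A tableau with entries at most \<open>l + 1\<close> is the same as its subtableau of entries at most \<open>l\<close>
  together with a shape obtained from that of the subtableau by adding a horizontal strip. Along this
  bijection both the insertion kernel and \<open>kappa\<close> acquire one factor per level, so everything goes
  by induction on \<open>l\<close>. At one level the insertion tries the rows \<open>s, s - 1, \<dots>\<close> in turn and stops
  in row \<open>r\<close> with probability \<open>f r\<close>; as \<open>f 1 = 1\<close>, the kernel is stochastic. For the sum of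
  \<open>kappa P * q_insert k P P'\<close> over all letters \<open>k\<close> and all \<open>P\<close> of a given shape, the contributions of
  the rows \<open>s\<close> of the previous level telescope as well, and the result is
  \<open>L_ker * kappa P'\<close>. This intertwining of \<open>trans_M\<close> with \<open>L_ker\<close> through \<open>K_weight\<close> shows, by
  induction on time, that the joint law of the current tableau and the past shapes is \<open>K_weight\<close> times the
  product of \<open>L_ker\<close> along the shapes, which contains the claims about the shape process. Finally
  \<open>f_lambda\<close> satisfies the recursion of the sum of these products over all growth sequences, up to
  the factor \<open>qpoch q (nth_part lam l)\<close>, as \<open>L_ker\<close> is \<open>1\<close> in row \<open>l\<close>.
\<close>


subsection \<open>Partitions and horizontal strips\<close>

text \<open>The levels form a Gelfand-Tsetlin pattern, and \<open>Delta * Psi\<close> is a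
  q-Whittaker polynomial. What needs an explanation is the telescoping. Fix the target
  \<open>P'\<close> with its two top shapes \<open>x\<close> and \<open>lam\<close>, and the row
  \<open>r <= l\<close> of \<open>lam\<close> that gained a box. Put
  \<open>A t = q ^ (x (t - 1) - lam t)\<close> and \<open>B = q ^ (lam r - x r)\<close>. Relative to
  \<open>kappa P'\<close>, a box gained by \<open>x\<close> in row \<open>s = r\<close> contributes
  \<open>1 - A (r + 1)\<close>, in row \<open>s > r\<close> it contributes
  \<open>(1 - B) * A (r + 1) * ... * A s * (1 - A (s + 1))\<close>, and the largest letter
  contributes \<open>(1 - B) * A (r + 1) * ... * A (l + 1)\<close>. The total is
  \<open>1 - A (r + 1) * B\<close>, from which \<open>x\<close> has disappeared, since the exponents
  add up to \<open>lam r - lam (r + 1)\<close>. The denominator of \<open>f1\<close> and the factor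
  \<open>L_ker\<close> from the level below are exactly what the numerator of \<open>kappa\<close>
  requires when \<open>x\<close> loses a box. Removals that interlacing forbids carry a factor
  \<open>1 - q ^ 0\<close>, so the sums may run over all rows.\<close>

definition hstrip :: "nat list \<Rightarrow> nat list \<Rightarrow> bool" where
  "hstrip x y \<longleftrightarrow> (\<forall>j\<ge>1. nth_part y (Suc j) \<le> nth_part x j \<and> nth_part x j \<le> nth_part y j)"

lemma nth_part_Suc: "nth_part lam (Suc j) = (if j < length lam then lam ! j else 0)"
  by (simp add: nth_part_def)

lemma nth_part_eq_0: "length lam < j \<Longrightarrow> nth_part lam j = 0"
  by (simp add: nth_part_def)

lemma is_partition_nth:
  "is_partition lam \<Longrightarrow> i \<le> j \<Longrightarrow> j < length lam \<Longrightarrow> lam ! j \<le> lam ! i"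
  unfolding is_partition_def by (metis le_neq_implies_less order_refl sorted_wrt_nth_less)

lemma is_partition_antimono:
  assumes "is_partition lam" "1 \<le> i" "i \<le> j"
  shows "nth_part lam j \<le> nth_part lam i"
  using assms is_partition_nth[of lam "i - 1" "j - 1"] by (auto simp: nth_part_def)

lemma is_partition_nth_part_pos:
  assumes "is_partition lam" "1 \<le> j" shows "0 < nth_part lam j \<longleftrightarrow> j \<le> length lam"
  using assms by (auto simp: nth_part_def is_partition_def) (metis Suc_le_eq Suc_pred gr0I nth_mem)

lemma partition_eqI:
  assumes "is_partition lam" "is_partition mu"
    and eq: "\<And>j. 1 \<le> j \<Longrightarrow> nth_part lam j = nth_part mu j"
  shows "lam = mu"
proof (rule nth_equalityI)
  have *: "j \<le> length lam \<longleftrightarrow> j \<le> length mu" for j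
  proof (cases j)
    case (Suc i)
    then show ?thesis
      using is_partition_nth_part_pos[of lam j] is_partition_nth_part_pos[of mu j] assms by simp
  qed simp
  from *[of "length lam"] *[of "length mu"] show len: "length lam = length mu" by simp
  show "lam ! i = mu ! i" if "i < length lam" for i
    using eq[of "Suc i"] that len by (simp add: nth_part_Suc)
qed

text \<open>The shapes that the proof has to exhibit arise by changing a single part; here the
  changed part function becomes a list again, cut off at its first zero.\<close>

lemma ex_partition:
  assumes anti: "\<And>j. 1 \<le> j \<Longrightarrow> f (Suc j) \<le> f j" and zero: "f (Suc l) = (0::nat)"
  obtains lam where "is_partition lam" "length lam \<le> l" "\<And>j. 1 \<le> j \<Longrightarrow> nth_part lam j = f j"
proof -
  have mono: "f j \<le> f i" if "1 \<le> i" "i \<le> j" for i j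
    using that(2) by (induction rule: dec_induct) (use that(1) anti in \<open>auto intro: order_trans\<close>)
  define n where "n = (LEAST n. f (Suc n) = 0)"
  have n0: "f (Suc n) = 0" and nl: "n \<le> l" unfolding n_def using zero by (auto intro: LeastI Least_le)
  have npos: "f (Suc i) \<noteq> 0" if "i < n" for i using that not_less_Least unfolding n_def by blast
  have z: "f j = 0" if "n < j" for j using mono[of "Suc n" j] n0 that by auto
  define lam where "lam = map (\<lambda>i. f (Suc i)) [0..<n]"
  have "is_partition lam"
    unfolding is_partition_def lam_def using mono
    by (auto simp: sorted_wrt_iff_nth_less dest!: sym[of 0] npos)
  moreover have "nth_part lam j = f j" if "1 \<le> j" for j
    using that z[of j] by (auto simp: nth_part_def lam_def)
  moreover have "length lam \<le> l" using nl by (simp add: lam_def)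
  ultimately show thesis using that by blast
qed

lemma sum_list_nth_part:
  assumes "length lam \<le> N" shows "sum_list lam = (\<Sum>j=1..N. nth_part lam j)"
proof -
  have "(\<Sum>j=1..N. nth_part lam j) = (\<Sum>j=1..length lam. nth_part lam j)"
    by (rule sum.mono_neutral_right) (use assms in \<open>auto simp: nth_part_def\<close>)
  also have "\<dots> = (\<Sum>i<length lam. lam ! i)"
    by (rule sum.reindex_bij_witness[of _ Suc "\<lambda>i. i - 1"]) (auto simp: nth_part_def)
  finally show ?thesis by (simp add: sum_list_sum_nth atLeast0LessThan)
qed

lemma plus_e_sum_list:
  assumes "plus_e mu i nu" "1 \<le> i" shows "sum_list nu = Suc (sum_list mu)"
proof -
  define N where "N = Max {i, length mu, length nu}"
  have N: "i \<le> N" "length mu \<le> N" "length nu \<le> N" by (auto simp: N_def)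
  have "sum_list nu = (\<Sum>j=1..N. nth_part mu j + (if j = i then 1 else 0))"
    unfolding sum_list_nth_part[OF N(3)] by (rule sum.cong) (use assms(1) in \<open>auto simp: plus_e_def\<close>)
  also have "\<dots> = Suc (sum_list mu)"
    using N(1) assms(2) by (simp add: sum.distrib sum_list_nth_part[OF N(2)])
  finally show ?thesis .
qed

lemma plus_e_unique: "plus_e mu i nu \<Longrightarrow> plus_e mu j nu \<Longrightarrow> 1 \<le> i \<Longrightarrow> i = j"
  unfolding plus_e_def by (metis add_cancel_left_right zero_neq_one)

lemma plus_e_unique_left:
  "plus_e mu i nu \<Longrightarrow> plus_e mu' i nu \<Longrightarrow> is_partition mu \<Longrightarrow> is_partition mu' \<Longrightarrow> mu = mu'"
  by (rule partition_eqI) (auto simp: plus_e_def)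

lemma plus_e_unique_right:
  "plus_e mu i nu \<Longrightarrow> plus_e mu i nu' \<Longrightarrow> is_partition nu \<Longrightarrow> is_partition nu' \<Longrightarrow> nu = nu'"
  by (rule partition_eqI) (auto simp: plus_e_def)

lemma plus_e_hstrip:
  assumes "plus_e mu i nu" "is_partition mu" "is_partition nu" shows "hstrip mu nu"
  unfolding hstrip_def
proof (intro allI impI conjI)
  fix j :: nat assume j: "1 \<le> j"
  show "nth_part mu j \<le> nth_part nu j" using assms(1) j by (simp add: plus_e_def)
  have "nth_part mu (Suc j) \<le> nth_part mu j" "nth_part nu (Suc j) \<le> nth_part nu j"
    using is_partition_antimono assms(2,3) j by auto
  then show "nth_part nu (Suc j) \<le> nth_part mu j"
    using assms(1)[unfolded plus_e_def, rule_format, of j] assms(1)[unfolded plus_e_def, rule_format, of "Suc j"] j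
    by (auto split: if_splits)
qed

lemma finite_partitions: "finite {lam. is_partition lam \<and> sum_list lam = n}"
proof (rule finite_subset)
  show "finite {xs. set xs \<subseteq> {..n} \<and> length xs \<le> n}" by (rule finite_lists_length_le) simp
  show "{lam. is_partition lam \<and> sum_list lam = n} \<subseteq> {xs. set xs \<subseteq> {..n} \<and> length xs \<le> n}"
  proof safe
    fix lam x assume *: "is_partition lam" "n = sum_list lam"
    show "x \<in> set lam \<Longrightarrow> x \<le> sum_list lam" by (simp add: member_le_sum_list)
    have "0 \<notin> set lam" using * by (simp add: is_partition_def)
    then show "length lam \<le> sum_list lam" by (induction lam) auto
  qed
qed

subsection \<open>Tableaux\<close>

lemma tableaux_0: "tableaux 0 = {[]}"
proof -
  have "P = []" if "P \<in> tableaux 0" for P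
    using that by (cases P) (auto simp: tableaux_def semistandard_def is_partition_def)
  then show ?thesis by (auto simp: tableaux_def semistandard_def is_partition_def)
qed

lemma sh_partition: "P \<in> tableaux l \<Longrightarrow> is_partition (sh P)"
  by (simp add: tableaux_def semistandard_def sh_def)

text \<open>The letters \<open>Suc l\<close> are the tail of a sorted row, so its smaller entries
  and its length determine it. This makes \<open>ext\<close> an inverse of
  \<open>subtab\<close>.\<close>

lemma row_append_replicate:
  assumes "sorted r" "set r \<subseteq> {..Suc l}"
  shows "r = filter (\<lambda>x. x \<le> l) r @ replicate (length r - length (filter (\<lambda>x. x \<le> l) r)) (Suc l)"
  using assms
proof (induction r)
  case (Cons a r)
  show ?case
  proof (cases "a \<le> l")
    case True with Cons show ?thesis by auto
  next
    case False
    with Cons.prems have "\<forall>x\<in>set (a # r). x = Suc l" by auto (metis atMost_iff le_antisym le_SucE subsetD)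
    then have "a # r = replicate (length (a # r)) (Suc l)" by (metis replicate_length_same)
    moreover have "filter (\<lambda>x. x \<le> l) (a # r) = []"
      using \<open>\<forall>x\<in>set (a # r). x = Suc l\<close> by (auto simp: filter_empty_conv)
    ultimately show ?thesis by (metis append_Nil diff_zero list.size(3))
  qed
qed simp

text \<open>Total in the index: missing rows are empty, so tableaux with different numbers of rows
  can be compared without length cases.\<close>

definition row :: "tableau \<Rightarrow> nat \<Rightarrow> nat list" where
  "row P i = (if i < length P then P ! i else [])"

text \<open>When the empty rows form a tail, discarding them shifts no index; \<open>subtab\<close>
  can then be computed row by row.\<close>

lemma filter_nonempty_rows:
  assumes "\<And>i. Suc i < length Q \<Longrightarrow> Q ! i = [] \<Longrightarrow> Q ! Suc i = []"
  shows "row (filter (\<lambda>r. r \<noteq> []) Q) i = row Q i"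
  using assms
proof (induction Q arbitrary: i)
  case (Cons r Q)
  have *: "Suc i < length Q \<Longrightarrow> Q ! i = [] \<Longrightarrow> Q ! Suc i = []" for i
    using Cons.prems[of "Suc i"] by simp
  show ?case
  proof (cases "r = []")
    case True
    have "i < length Q \<Longrightarrow> Q ! i = []" for i
    proof (induction i)
      case 0 then show ?case using Cons.prems[of 0] True by simp
    next
      case (Suc i) then show ?case using * by simp
    qed
    then have "filter (\<lambda>r. r \<noteq> []) (r # Q) = []" "i < length (r # Q) \<Longrightarrow> (r # Q) ! i = []"
      using True by (auto simp: in_set_conv_nth filter_empty_conv nth_Cons')
    then show ?thesis by (auto simp: row_def)
  next
    case False
    then show ?thesis using Cons.IH[OF *, of "i - 1"] by (cases i) (auto simp: row_def)
  qed
qed (simp add: row_def)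

lemma row_subtab:
  assumes "semistandard P"
  shows "row (subtab P l) i = filter (\<lambda>x. x \<le> l) (row P i)"
proof -
  have "row (subtab P l) i = row (map (filter (\<lambda>x. x \<le> l)) P) i"
    unfolding subtab_def
  proof (rule filter_nonempty_rows)
    fix i assume i: "Suc i < length (map (filter (\<lambda>x. x \<le> l)) P)"
      and e: "map (filter (\<lambda>x. x \<le> l)) P ! i = []"
    have "length (P ! Suc i) \<le> length (P ! i)"
      using assms i is_partition_nth[of "map length P" i "Suc i"] by (auto simp: semistandard_def)
    moreover have "P ! i ! j < P ! Suc i ! j" if "j < length (P ! Suc i)" for j
      using assms that i by (auto simp: semistandard_def)
    moreover have "l < P ! i ! j" if "j < length (P ! i)" for j
      using e i that by (auto simp: filter_empty_conv not_le dest: nth_mem)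
    \<comment> \<open>A row without entries up to \<open>l\<close> consists of larger entries, and
      strict columns pass this on to the row below.\<close>
    ultimately have "l < P ! Suc i ! j" if "j < length (P ! Suc i)" for j
      using that by (meson less_le_trans less_trans)
    then show "map (filter (\<lambda>x. x \<le> l)) P ! Suc i = []"
      using i by (auto simp: filter_empty_conv in_set_conv_nth not_le)
  qed
  then show ?thesis by (simp add: row_def)
qed

lemma length_row: "length (row P i) = nth_part (sh P) (Suc i)"
  by (auto simp: row_def nth_part_Suc sh_def)

lemma tableau_eqI:
  assumes "sh P = sh Q" "\<And>i. row P i = row Q i" shows "P = Q"
proof -
  have "length P = length Q" using assms(1) by (metis length_map sh_def)
  then show ?thesis using assms(2) by (metis nth_equalityI row_def)
qed

lemma semistandard_row:
  "semistandard P \<longleftrightarrow> is_partition (sh P) \<and> (\<forall>i. sorted (row P i)) \<and>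
     (\<forall>i j. j < length (row P (Suc i)) \<longrightarrow> row P i ! j < row P (Suc i) ! j)"
  unfolding semistandard_def sh_def
  by (auto simp: row_def Ball_def in_set_conv_nth)

lemma tableaux_row:
  "P \<in> tableaux l \<longleftrightarrow> semistandard P \<and> (\<forall>i. set (row P i) \<subseteq> {1..l})"
proof -
  have "(\<forall>r\<in>set P. set r \<subseteq> {1..l}) \<longleftrightarrow> (\<forall>i. set (row P i) \<subseteq> {1..l})"
    by (auto simp: row_def all_set_conv_all_nth)
  then show ?thesis by (simp add: tableaux_def)
qed

lemma sh_subtab_nth_part:
  "semistandard P \<Longrightarrow> nth_part (sh (subtab P l)) (Suc i) = length (filter (\<lambda>x. x \<le> l) (row P i))"
  by (simp add: length_row[symmetric] row_subtab)

lemma is_partition_I: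
  "0 \<notin> set lam \<Longrightarrow> (\<And>j. nth_part lam (Suc (Suc j)) \<le> nth_part lam (Suc j)) \<Longrightarrow> is_partition lam"
proof -
  assume 0: "0 \<notin> set lam" and le: "\<And>j. nth_part lam (Suc (Suc j)) \<le> nth_part lam (Suc j)"
  have "lam ! Suc j \<le> lam ! j" if "Suc j < length lam" for j
    using le[of j] that by (simp add: nth_part_Suc)
  then show ?thesis
    using 0 by (simp add: is_partition_def sorted_wrt_iff_nth_Suc_transp transp_def)
qed

lemma subtab_tableaux:
  assumes "P \<in> tableaux m" shows "subtab P l \<in> tableaux l"
proof -
  have ss: "semistandard P" using assms by (simp add: tableaux_row)
  note rs = row_subtab[OF ss, of l]
  have srt: "sorted (row P i)" and col: "j < length (row P (Suc i)) \<Longrightarrow> row P i ! j < row P (Suc i) ! j"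
    for i j using ss by (auto simp: semistandard_row)
  have app: "filter (\<lambda>x. x \<le> l) (row P i) = takeWhile (\<lambda>x. x \<le> l) (row P i)" for i
  proof -
    have "sorted r \<Longrightarrow> filter (\<lambda>x. x \<le> l) r = takeWhile (\<lambda>x. x \<le> l) r" for r
    proof (induction r)
      case (Cons a r)
      have "filter (\<lambda>x. x \<le> l) r = []" if "\<not> a \<le> l"
        using Cons.prems that by (auto simp: filter_empty_conv)
      then show ?case using Cons by (cases "a \<le> l") auto
    qed simp
    then show ?thesis using srt by blast
  qed
  have len: "length (row P (Suc i)) \<le> length (row P i)" for i
    using ss is_partition_antimono[of "sh P" "Suc i" "Suc (Suc i)"] by (simp add: semistandard_row length_row)
  \<comment> \<open>At the first position where row \<open>i\<close> exceeds \<open>l\<close>, the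
    entry below is larger still, so the small prefix of the next row has already ended.\<close>
  have len': "length (takeWhile (\<lambda>x. x \<le> l) (row P (Suc i))) \<le> length (takeWhile (\<lambda>x. x \<le> l) (row P i))" for i
  proof (rule ccontr)
    assume *: "\<not> ?thesis"
    define n where "n = length (takeWhile (\<lambda>x. x \<le> l) (row P i))"
    have n: "n < length (takeWhile (\<lambda>x. x \<le> l) (row P (Suc i)))" using * by (simp add: n_def)
    then have "n < length (row P (Suc i))" using length_takeWhile_le less_le_trans by blast
    moreover have "row P (Suc i) ! n \<le> l" using n by (metis nth_mem set_takeWhileD takeWhile_nth)
    moreover have "\<not> row P i ! n \<le> l"
      unfolding n_def by (rule nth_length_takeWhile) (use calculation(1) len[of i] in \<open>simp add: n_def\<close>)
    ultimately show False using col[of n i] by auto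
  qed
  have "0 \<notin> set (sh (subtab P l))" by (auto simp: sh_def subtab_def)
  moreover have "nth_part (sh (subtab P l)) (Suc (Suc j)) \<le> nth_part (sh (subtab P l)) (Suc j)" for j
    using len' by (simp only: sh_subtab_nth_part[OF ss] app)
  ultimately have "is_partition (sh (subtab P l))" by (rule is_partition_I)
  moreover have "row (subtab P l) i ! j < row (subtab P l) (Suc i) ! j"
    if "j < length (row (subtab P l) (Suc i))" for i j
  proof -
    have "j < length (takeWhile (\<lambda>x. x \<le> l) (row P (Suc i)))" using that by (simp add: rs app)
    moreover then have "j < length (takeWhile (\<lambda>x. x \<le> l) (row P i))" using len' less_le_trans by blast
    moreover have "j < length (row P (Suc i))" using calculation(1) length_takeWhile_le less_le_trans by blast
    ultimately show ?thesis using col by (simp add: rs app takeWhile_nth)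
  qed
  ultimately have "semistandard (subtab P l)"
    using srt by (simp add: semistandard_row rs sorted_wrt_filter)
  then show ?thesis using assms by (auto simp: tableaux_row rs subset_iff)
qed

lemma subtab_subtab: "i \<le> l \<Longrightarrow> subtab (subtab P l) i = subtab P i"
proof -
  assume "i \<le> l"
  then have "filter (\<lambda>x. x \<le> i) (filter (\<lambda>x. x \<le> l) r) = filter (\<lambda>x. x \<le> i) r" for r :: "nat list"
    by (auto intro: filter_cong)
  then show ?thesis
    unfolding subtab_def by (induction P) (auto simp del: filter_filter, metis filter.simps(1))
qed

lemma subtab_ident:
  assumes "P \<in> tableaux l" "l \<le> i" shows "subtab P i = P"
proof -
  have "filter (\<lambda>x. x \<le> i) r = r" "r \<noteq> []" if "r \<in> set P" for r
  proof -
    have "set r \<subseteq> {1..l}" using assms(1) that by (simp add: tableaux_def)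
    then show "filter (\<lambda>x. x \<le> i) r = r" using assms(2) by (auto simp: filter_id_conv subset_iff)
    show "r \<noteq> []" using assms(1) that by (auto simp: tableaux_def semistandard_def is_partition_def)
  qed
  then have "map (filter (\<lambda>x. x \<le> i)) P = P" "filter (\<lambda>r. r \<noteq> []) P = P"
    by (auto simp: filter_id_conv intro: map_idI)
  then show ?thesis by (simp add: subtab_def)
qed

lemma subtab_hstrip:
  assumes "P \<in> tableaux (Suc l)" shows "hstrip (sh (subtab P l)) (sh P)"
  unfolding hstrip_def
proof (intro allI impI conjI)
  fix j :: nat assume "1 \<le> j" then obtain i where i: "j = Suc i" by (cases j) auto
  have ss: "semistandard P" using assms by (simp add: tableaux_row)
  show "nth_part (sh (subtab P l)) j \<le> nth_part (sh P) j"
    unfolding i sh_subtab_nth_part[OF ss] by (simp add: length_row[symmetric])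
  have srt: "sorted (row P i)" and col: "j < length (row P (Suc i)) \<Longrightarrow> row P i ! j < row P (Suc i) ! j"
    for j using ss by (auto simp: semistandard_row)
  have len: "length (row P (Suc i)) \<le> length (row P i)"
    using ss is_partition_antimono[of "sh P" "Suc i" "Suc (Suc i)"] by (simp add: semistandard_row length_row)
  \<comment> \<open>An entry with a cell below it is smaller than some entry of value at most
    \<open>Suc l\<close>, hence at most \<open>l\<close>. So all of row \<open>Suc i\<close> lies
    under the smaller entries of row \<open>i\<close>.\<close>
  have "take (length (row P (Suc i))) (row P i) = filter (\<lambda>x. x \<le> l) (take (length (row P (Suc i))) (row P i))"
  proof (rule filter_True[symmetric], rule ballI)
    fix x assume "x \<in> set (take (length (row P (Suc i))) (row P i))"
    then obtain n where n: "n < length (row P (Suc i))" "x = row P i ! n" by (auto simp: in_set_conv_nth)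
    then have "row P (Suc i) ! n \<le> Suc l"
      using assms nth_mem[OF n(1)] unfolding tableaux_row by (meson atLeastAtMost_iff subsetD)
    then show "x \<le> l" using col[OF n(1)] n(2) by simp
  qed
  then have "length (row P (Suc i)) \<le> length (filter (\<lambda>x. x \<le> l) (take (length (row P (Suc i))) (row P i)))"
    using len by (metis length_take min.absorb2 order_refl)
  also have "\<dots> \<le> length (filter (\<lambda>x. x \<le> l) (row P i))"
    by (metis append_take_drop_id filter_append length_append le_add1)
  finally show "nth_part (sh P) (Suc j) \<le> nth_part (sh (subtab P l)) j"
    unfolding i sh_subtab_nth_part[OF ss] by (simp add: length_row)
qed

text \<open>The inverse of \<open>subtab\<close> once the new shape is known. Under
  \<open>hstrip (sh P) mu\<close> the subtraction does not truncate and no row of \<open>P\<close>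
  is lost.\<close>

definition ext :: "nat \<Rightarrow> tableau \<Rightarrow> nat list \<Rightarrow> tableau" where
  "ext l P mu = map (\<lambda>i. row P i @ replicate (mu ! i - length (row P i)) (Suc l)) [0..<length mu]"

lemma sh_ext:
  assumes "hstrip (sh P) mu" shows "sh (ext l P mu) = mu"
proof (rule nth_equalityI)
  fix i assume "i < length (sh (ext l P mu))"
  then have i: "i < length mu" by (simp add: sh_def ext_def)
  then have "length (row P i) \<le> mu ! i"
    using assms[unfolded hstrip_def, rule_format, of "Suc i"] by (simp add: length_row nth_part_Suc[of mu])
  then show "sh (ext l P mu) ! i = mu ! i" using i by (simp add: sh_def ext_def)
qed (simp add: sh_def ext_def)

lemma row_ext:
  assumes "hstrip (sh P) mu"
  shows "row (ext l P mu) i = row P i @ replicate (nth_part mu (Suc i) - nth_part (sh P) (Suc i)) (Suc l)"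
proof (cases "i < length mu")
  case True then show ?thesis by (simp add: row_def[of "map _ _"] ext_def length_row nth_part_Suc[of mu])
next
  case False
  then have z: "nth_part mu (Suc i) = 0" by (simp add: nth_part_Suc)
  moreover have "nth_part (sh P) (Suc i) = 0"
    using assms[unfolded hstrip_def, rule_format, of "Suc i"] z by simp
  then have "row P i = []" by (metis length_0_conv length_row)
  ultimately show ?thesis using False by (simp add: row_def[of "map _ _"] ext_def z)
qed

lemma ext_tableaux:
  assumes P: "P \<in> tableaux l" and mu: "is_partition mu" and h: "hstrip (sh P) mu"
  shows "ext l P mu \<in> tableaux (Suc l)" "subtab (ext l P mu) l = P"
proof -
  have h': "nth_part mu (Suc (Suc i)) \<le> nth_part (sh P) (Suc i)"
           "nth_part (sh P) (Suc i) \<le> nth_part mu (Suc i)" for i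
    using h[unfolded hstrip_def, rule_format, of "Suc i"] by auto
  have ss: "semistandard P" and ent: "set (row P i) \<subseteq> {1..l}" for i using P by (auto simp: tableaux_row)
  have srt: "sorted (row P i)" and col: "j < length (row P (Suc i)) \<Longrightarrow> row P i ! j < row P (Suc i) ! j"
    for i j using ss by (auto simp: semistandard_row)
  have "sorted (row (ext l P mu) i)" for i
    using srt ent[of i] by (fastforce simp: row_ext[OF h] sorted_append)
  moreover have "row (ext l P mu) i ! j < row (ext l P mu) (Suc i) ! j"
    if j: "j < length (row (ext l P mu) (Suc i))" for i j
  proof -
    \<comment> \<open>Interlacing puts every cell of row \<open>Suc i\<close> under a cell of
      \<open>P\<close>, so two letters \<open>Suc l\<close> never share a column.\<close>
    have j1: "j < nth_part mu (Suc (Suc i))" using j by (simp add: row_ext[OF h] length_row h')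
    then have j2: "j < length (row P i)" using h'(1)[of i] by (simp add: length_row)
    then have "row P i ! j \<le> l" using ent[of i] nth_mem by fastforce
    then show ?thesis using j1 j2 col[of j i] by (auto simp: row_ext[OF h] nth_append length_row)
  qed
  ultimately have ss': "semistandard (ext l P mu)" by (simp add: semistandard_row sh_ext[OF h] mu)
  then show ext: "ext l P mu \<in> tableaux (Suc l)"
    using ent by (fastforce simp: tableaux_row row_ext[OF h])
  have rows: "row (subtab (ext l P mu) l) i = row P i" for i
    using ent[of i] by (simp add: row_subtab[OF ss'] row_ext[OF h] filter_id_conv subset_iff)
  have "sh (subtab (ext l P mu) l) = sh P"
  proof (rule partition_eqI)
    show "is_partition (sh (subtab (ext l P mu) l))" using sh_partition subtab_tableaux ext by blast
    show "is_partition (sh P)" using sh_partition P by blast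
    show "nth_part (sh (subtab (ext l P mu) l)) j = nth_part (sh P) j" if "1 \<le> j" for j
      using that rows[of "j - 1"] length_row[of _ "j - 1"] by (metis Suc_pred less_eq_Suc_le One_nat_def)
  qed
  then show "subtab (ext l P mu) l = P" using rows by (rule tableau_eqI)
qed

lemma ext_subtab:
  assumes "P \<in> tableaux (Suc l)" shows "ext l (subtab P l) (sh P) = P"
proof (rule tableau_eqI)
  have h: "hstrip (sh (subtab P l)) (sh P)" by (rule subtab_hstrip[OF assms])
  show "sh (ext l (subtab P l) (sh P)) = sh P" by (rule sh_ext[OF h])
  fix i
  have ss: "semistandard P" and "sorted (row P i)" "set (row P i) \<subseteq> {..Suc l}"
    using assms by (auto simp: tableaux_row semistandard_row subset_iff)
  from row_append_replicate[OF this(2,3)] show "row (ext l (subtab P l) (sh P)) i = row P i"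
    by (simp add: row_ext[OF h] row_subtab[OF ss] sh_subtab_nth_part[OF ss] length_row[symmetric])
qed

lemma tableaux_Suc_bij:
  "bij_betw (\<lambda>P. (subtab P l, sh P)) (tableaux (Suc l))
     (SIGMA P:tableaux l. {mu. is_partition mu \<and> hstrip (sh P) mu})"
  by (rule bij_betw_byWitness[where f' = "\<lambda>(P, mu). ext l P mu"])
     (auto simp: ext_subtab ext_tableaux sh_ext intro: subtab_tableaux subtab_hstrip sh_partition)

lemma length_sh:
  assumes "P \<in> tableaux l" shows "length (sh P) \<le> l"
  using assms
proof (induction l arbitrary: P)
  case 0 then show ?case by (simp add: tableaux_0 sh_def)
next
  case (Suc l)
  have "length (sh (subtab P l)) \<le> l" using Suc subtab_tableaux by blast
  then have "nth_part (sh P) (Suc (Suc l)) = 0"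
    using subtab_hstrip[OF Suc.prems, unfolded hstrip_def, rule_format, of "Suc l"] by (simp add: nth_part_eq_0)
  then show ?case using is_partition_nth_part_pos[OF sh_partition[OF Suc.prems], of "Suc (Suc l)"] by simp
qed

lemma sh_Omega: "P \<in> tableaux l \<Longrightarrow> sh P \<in> Omega l"
  by (simp add: Omega_def sh_partition length_sh)

lemma finite_tableaux_shape: "finite {P. P \<in> tableaux l \<and> sh P = lam}"
proof (rule finite_subset)
  let ?R = "{r. set r \<subseteq> {1..l} \<and> length r \<le> sum_list lam}"
  show "finite {P. set P \<subseteq> ?R \<and> length P = length lam}"
    by (intro finite_lists_length_eq finite_lists_length_le) simp
  show "{P. P \<in> tableaux l \<and> sh P = lam} \<subseteq> {P. set P \<subseteq> ?R \<and> length P = length lam}"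
    by (auto simp: tableaux_def sh_def intro: member_le_sum_list)
qed

lemma lev_subtab: "i \<le> l \<Longrightarrow> lev (subtab P l) i = lev P i"
  by (simp add: lev_def subtab_subtab fun_eq_iff)

lemma lev_top: "P \<in> tableaux l \<Longrightarrow> lev P l j = nth_part (sh P) j"
  by (simp add: lev_def subtab_ident)

text \<open>A tableau is its Gelfand-Tsetlin pattern. This turns the clause of
  \<open>insertion_path\<close> about the levels below \<open>k\<close> into an equality of
  subtableaux.\<close>

lemma tableau_eq_levels:
  assumes "P \<in> tableaux l" "Q \<in> tableaux l" "\<And>i. i \<le> l \<Longrightarrow> sh (subtab P i) = sh (subtab Q i)"
  shows "P = Q"
  using assms
proof (induction l arbitrary: P Q)
  case 0 then show ?case by (simp add: tableaux_0)
next
  case (Suc l)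
  have "subtab P l = subtab Q l"
  proof (rule Suc.IH)
    show "subtab P l \<in> tableaux l" "subtab Q l \<in> tableaux l" using Suc.prems subtab_tableaux by auto
    show "sh (subtab (subtab P l) i) = sh (subtab (subtab Q l) i)" if "i \<le> l" for i
      using that Suc.prems(3)[of i] by (simp add: subtab_subtab)
  qed
  moreover have "sh P = sh Q" using Suc.prems(3)[of "Suc l"] Suc.prems(1,2) by (simp add: subtab_ident)
  ultimately show ?case using ext_subtab Suc.prems(1,2) by metis
qed

lemma sum_list_sh_subtab: "sum_list (sh (subtab P i)) = length (filter (\<lambda>x. x \<le> i) (concat P))"
  unfolding sh_def subtab_def by (induction P) auto

lemma ty_Suc: "sum_list (sh (subtab P (Suc i))) = sum_list (sh (subtab P i)) + ty P (Suc i)"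
proof -
  have "length (filter (\<lambda>x. x \<le> Suc i) r) = length (filter (\<lambda>x. x \<le> i) r) + count_list r (Suc i)" for r
    by (induction r) auto
  then show ?thesis by (simp add: sum_list_sh_subtab ty_def)
qed

lemma ty_eq_0: "P \<in> tableaux l \<Longrightarrow> i \<notin> {1..l} \<Longrightarrow> ty P i = 0"
  unfolding ty_def count_list_0_iff by (auto simp: tableaux_def dest!: bspec)



subsection \<open>The insertion kernel, level by level\<close>

text \<open>\<open>x\<close> and \<open>y\<close> are the shapes at levels \<open>i - 1\<close> and \<open>i\<close>, \<open>s = j (i - 1)\<close>, and \<open>b\<close>
  is the test \<open>i \<noteq> k\<close> that decides between \<open>f0\<close> and \<open>f1\<close>.\<close>

definition phi :: "real \<Rightarrow> bool \<Rightarrow> nat \<Rightarrow> (nat \<Rightarrow> nat) \<Rightarrow> (nat \<Rightarrow> nat) \<Rightarrow> nat \<Rightarrow> real" where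
  "phi q b s x y r =
     (if r = 1 then 1
      else if r = s \<and> b then (1 - q ^ (x (r - 1) - y r)) / (1 - q ^ (x (r - 1) - x r))
      else 1 - q ^ (x (r - 1) - y r))"

definition stepw :: "real \<Rightarrow> bool \<Rightarrow> nat \<Rightarrow> nat \<Rightarrow> (nat \<Rightarrow> nat) \<Rightarrow> (nat \<Rightarrow> nat) \<Rightarrow> real" where
  "stepw q b s r x y = phi q b s x y r * (\<Prod>t=r+1..s. 1 - phi q b s x y t)"

lemma path_weight_stepw:
  "path_weight q l k P j =
     (\<Prod>i=k..l. stepw q (i \<noteq> k) (j (i - 1)) (j i) (lev P (i - 1)) (lev P i))"
proof -
  have "(if r = j (i - 1) \<and> i \<noteq> k then f1 q P i r else f0 q P i r)
      = phi q (i \<noteq> k) (j (i - 1)) (lev P (i - 1)) (lev P i) r" for i r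
    by (simp add: phi_def f0_def f1_def)
  then show ?thesis by (simp add: path_weight_def stepw_def Let_def)
qed

lemma insertion_path_antimono:
  assumes "insertion_path l k P P' j" "k \<le> i" "i \<le> i'" "i' \<le> l"
  shows "j i' \<le> j i"
  using assms(3,4)
proof (induction rule: dec_induct)
  case (step n)
  have "\<forall>i\<in>{k..l}. j i \<le> j (i - 1)" using assms(1) by (simp add: insertion_path_def)
  from bspec[OF this, of "Suc n"] show ?case using step assms(2) by simp
qed simp

lemma insertion_path_pos:
  assumes "insertion_path l k P P' j" "k \<le> i" "i \<le> l" shows "1 \<le> j i"
  using insertion_path_antimono[OF assms(1,2,3)] assms(1) by (simp add: insertion_path_def)

lemma insertion_path_plus_e:
  assumes "insertion_path l k P P' j" "k \<le> i" "i \<le> l"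
  shows "plus_e (sh (subtab P i)) (j i) (sh (subtab P' i))"
  using assms by (simp add: insertion_path_def)

text \<open>The count of a letter is the size difference of two consecutive levels, and a path adds
  one box to each level from \<open>k\<close> on and none below. So a path supplies the type that
  \<open>q_insert\<close> asks for.\<close>

lemma insertion_path_ty:
  assumes P: "P \<in> tableaux l" and P': "P' \<in> tableaux l" and k: "1 \<le> k" "k \<le> l"
    and j: "insertion_path l k P P' j"
  shows "ty P' = (ty P)(k := ty P k + 1)"
proof
  fix t
  have sz: "sum_list (sh (subtab P' i)) = sum_list (sh (subtab P i)) + (if k \<le> i then 1 else 0)" for i
  proof (cases "i < k")
    case True then show ?thesis using j by (simp add: insertion_path_def)
  next
    case False
    have le: "sum_list (sh (subtab P' i)) = Suc (sum_list (sh (subtab P i)))" if "k \<le> i" "i \<le> l" for i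
      using plus_e_sum_list[of "sh (subtab P i)" "j i" "sh (subtab P' i)"] insertion_path_plus_e[OF j] insertion_path_pos[OF j] that
      by simp
    show ?thesis
    proof (cases "i \<le> l")
      case True then show ?thesis using le False by auto
    next
      case F: False
      then have "l \<le> i" by simp
      then show ?thesis
        using le[of l] k False by (simp add: subtab_ident[OF P] subtab_ident[OF P'])
    qed
  qed
  show "ty P' t = ((ty P)(k := ty P k + 1)) t"
  proof (cases t)
    case 0
    then show ?thesis using k ty_eq_0[OF P] ty_eq_0[OF P'] by simp
  next
    case (Suc i)
    then show ?thesis using ty_Suc[of P i] ty_Suc[of P' i] sz[of i] sz[of "Suc i"] k by (auto simp: le_Suc_eq split: if_splits)
  qed
qed

lemma insertion_path_unique:
  assumes "insertion_path l k P P' j" "insertion_path l k P P' j'" "k \<le> i" "i \<le> l"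
  shows "j i = j' i"
  using plus_e_unique insertion_path_plus_e insertion_path_pos assms by metis

lemma q_insert_path:
  assumes P: "P \<in> tableaux l" "P' \<in> tableaux l" "1 \<le> k" "k \<le> l" and j: "insertion_path l k P P' j"
  shows "q_insert q l k P P' = path_weight q l k P j"
proof -
  define j' where "j' = (SOME j. insertion_path l k P P' j)"
  have j': "insertion_path l k P P' j'" unfolding j'_def by (rule someI[of "insertion_path l k P P'", OF j])
  have "j' (k - 1) = k" "j (k - 1) = k" using j j' by (auto simp: insertion_path_def)
  then have eq: "j' i = j i" if "k - 1 \<le> i" "i \<le> l" for i
    using insertion_path_unique[OF j' j, of i] that by (cases "i = k - 1") auto
  have "q_insert q l k P P' = path_weight q l k P j'"
    unfolding q_insert_def j'_def using insertion_path_ty[OF assms] j by auto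
  also have "\<dots> = path_weight q l k P j"
    unfolding path_weight_stepw
  proof (rule prod.cong)
    fix i assume "i \<in> {k..l}"
    then have "j' (i - 1) = j (i - 1)" "j' i = j i" using eq[of i] eq[of "i - 1"] by auto
    then show "stepw q (i \<noteq> k) (j' (i - 1)) (j' i) (lev P (i - 1)) (lev P i)
      = stepw q (i \<noteq> k) (j (i - 1)) (j i) (lev P (i - 1)) (lev P i)" by simp
  qed simp
  finally show ?thesis .
qed

lemma q_insert_no_path: "\<nexists>j. insertion_path l k P P' j \<Longrightarrow> q_insert q l k P P' = 0"
  by (auto simp: q_insert_def)

lemma q_insert_plus_e:
  assumes P: "P \<in> tableaux l" "P' \<in> tableaux l" "1 \<le> k" "k \<le> l" and "q_insert q l k P P' \<noteq> 0"
  obtains s where "1 \<le> s" "s \<le> k" "plus_e (sh P) s (sh P')"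
proof -
  obtain j where j: "insertion_path l k P P' j" using assms(5) q_insert_no_path by blast
  have "j k \<le> k"
    using j assms(3,4) unfolding insertion_path_def by (metis atLeastAtMost_iff order_refl)
  then have "j l \<le> k" using insertion_path_antimono[OF j order_refl assms(4) order_refl] by simp
  then show thesis
    using that insertion_path_plus_e[OF j assms(4) order_refl] insertion_path_pos[OF j assms(4) order_refl] P
    by (simp add: subtab_ident)
qed

lemma insertion_path_Suc:
  assumes P: "P \<in> tableaux (Suc l)" "P' \<in> tableaux (Suc l)" "1 \<le> k" "k \<le> l"
  shows "insertion_path (Suc l) k P P' j \<longleftrightarrow>
    insertion_path l k (subtab P l) (subtab P' l) j \<and> 1 \<le> j (Suc l) \<and> j (Suc l) \<le> j l \<and>
    plus_e (sh P) (j (Suc l)) (sh P')"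
proof -
  have "{k..Suc l} = insert (Suc l) {k..l}" using assms by auto
  moreover have "subtab (subtab P l) i = subtab P i" "subtab (subtab P' l) i = subtab P' i" if "i \<le> l" for i
    using that by (simp_all add: subtab_subtab)
  ultimately show ?thesis
    using assms(3,4) P by (auto simp: insertion_path_def subtab_ident)
qed

lemma lev_top_fun: "P \<in> tableaux l \<Longrightarrow> lev P l = nth_part (sh P)"
  by (simp add: fun_eq_iff lev_top)

lemma lev_shape: "lev P l = nth_part (sh (subtab P l))"
  by (simp add: fun_eq_iff lev_def)

lemma q_insert_Suc_eq_0:
  assumes P: "P \<in> tableaux (Suc l)" "P' \<in> tableaux (Suc l)" "1 \<le> k" "k \<le> l"
    and 0: "\<nexists>j. insertion_path l k (subtab P l) (subtab P' l) j"
  shows "q_insert q (Suc l) k P P' = 0"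
  using insertion_path_Suc[OF P] 0 by (intro q_insert_no_path) blast

text \<open>A path up to \<open>Suc l\<close> is a path up to \<open>l\<close> with one more value
  \<open>r\<close>, and only the last factor of its weight is new. At most one summand is nonzero;
  the form of a sum allows an exchange with the summation over the new top shapes.\<close>

lemma q_insert_Suc:
  assumes P: "P \<in> tableaux (Suc l)" "P' \<in> tableaux (Suc l)" "1 \<le> k" "k \<le> l"
    and s: "plus_e (sh (subtab P l)) s (sh (subtab P' l))"
  shows "q_insert q (Suc l) k P P' = q_insert q l k (subtab P l) (subtab P' l) *
     (\<Sum>r=1..s. if plus_e (sh P) r (sh P')
        then stepw q True s r (nth_part (sh (subtab P l))) (nth_part (sh P)) else 0)"
proof (cases "\<exists>j. insertion_path l k (subtab P l) (subtab P' l) j")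
  case False
  then have "q_insert q l k (subtab P l) (subtab P' l) = 0" by (rule q_insert_no_path)
  then show ?thesis using q_insert_Suc_eq_0[OF P False] by simp
next
  case True
  then obtain j where j: "insertion_path l k (subtab P l) (subtab P' l) j" by blast
  have T: "subtab P l \<in> tableaux l" "subtab P' l \<in> tableaux l" using P subtab_tableaux by auto
  have jl: "j l = s"
    using insertion_path_plus_e[OF j] insertion_path_pos[OF j] s P(4) T
    by (metis order_refl plus_e_unique subtab_ident)
  show ?thesis
  proof (cases "\<exists>r\<in>{1..s}. plus_e (sh P) r (sh P')")
    case False
    have "\<nexists>j. insertion_path (Suc l) k P P' j"
    proof
      assume "\<exists>j. insertion_path (Suc l) k P P' j"
      then obtain j' where j': "insertion_path (Suc l) k P P' j'" by blast
      then have "insertion_path l k (subtab P l) (subtab P' l) j'" using insertion_path_Suc[OF P] by blast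
      then have "j' l = s" using jl insertion_path_unique[OF j] P(4) by fastforce
      then show False using j' insertion_path_Suc[OF P] False by auto
    qed
    then have "q_insert q (Suc l) k P P' = 0" by (rule q_insert_no_path)
    then show ?thesis using False by (simp add: sum.neutral)
  next
    case True
    then obtain r where r: "1 \<le> r" "r \<le> s" "plus_e (sh P) r (sh P')" by auto
    have "(\<Sum>r'=1..s. if plus_e (sh P) r' (sh P')
        then stepw q True s r' (nth_part (sh (subtab P l))) (nth_part (sh P)) else 0)
      = (\<Sum>r'\<in>{1..s}. if r' = r then stepw q True s r (nth_part (sh (subtab P l))) (nth_part (sh P)) else 0)"
      using r plus_e_unique by (intro sum.cong) auto
    then have sum: "(\<Sum>r'=1..s. if plus_e (sh P) r' (sh P')
        then stepw q True s r' (nth_part (sh (subtab P l))) (nth_part (sh P)) else 0)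
      = stepw q True s r (nth_part (sh (subtab P l))) (nth_part (sh P))"
      using r by simp
    define j' where "j' = j(Suc l := r)"
    have "insertion_path l k (subtab P l) (subtab P' l) j'"
      using j P(3,4) by (auto simp: insertion_path_def j'_def)
    then have j': "insertion_path (Suc l) k P P' j'"
      using insertion_path_Suc[OF P] r jl by (simp add: j'_def)
    have "q_insert q (Suc l) k P P' = path_weight q (Suc l) k P j'"
      using q_insert_path[OF P(1,2) _ _ j'] P(3,4) by simp
    also have "\<dots> = path_weight q l k (subtab P l) j * stepw q True (j l) r (lev P l) (lev P (Suc l))"
    proof -
      have "(\<Prod>i=k..l. stepw q (i \<noteq> k) (j' (i - 1)) (j' i) (lev P (i - 1)) (lev P i))
          = (\<Prod>i=k..l. stepw q (i \<noteq> k) (j (i - 1)) (j i) (lev (subtab P l) (i - 1)) (lev (subtab P l) i))"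
        by (rule prod.cong) (auto simp: j'_def lev_subtab)
      then show ?thesis using P(4) by (simp add: path_weight_stepw j'_def)
    qed
    finally show ?thesis
      unfolding sum using q_insert_path[OF T P(3,4) j] jl P(1) by (simp add: lev_top_fun lev_shape[of P l])
  qed
qed

lemma q_insert_Suc_zero:
  assumes P: "P \<in> tableaux (Suc l)" "P' \<in> tableaux (Suc l)" "1 \<le> k" "k \<le> l"
    and 0: "q_insert q l k (subtab P l) (subtab P' l) = 0"
  shows "q_insert q (Suc l) k P P' = 0"
proof (cases "\<exists>j. insertion_path l k (subtab P l) (subtab P' l) j")
  case True
  then obtain j where j: "insertion_path l k (subtab P l) (subtab P' l) j" by blast
  have "subtab P l \<in> tableaux l" "subtab P' l \<in> tableaux l" using P subtab_tableaux by auto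
  then have "plus_e (sh (subtab P l)) (j l) (sh (subtab P' l))"
    using insertion_path_plus_e[OF j P(4)] by (simp add: subtab_ident)
  then show ?thesis using q_insert_Suc[OF P] 0 by simp
qed (use q_insert_Suc_eq_0[OF P] in blast)

lemma insertion_path_top:
  assumes P: "P \<in> tableaux (Suc l)" "P' \<in> tableaux (Suc l)"
  shows "insertion_path (Suc l) (Suc l) P P' j \<longleftrightarrow>
    j l = Suc l \<and> subtab P' l = subtab P l \<and> 1 \<le> j (Suc l) \<and> j (Suc l) \<le> Suc l \<and>
    plus_e (sh P) (j (Suc l)) (sh P')"
proof -
  have "(\<forall>i<Suc l. sh (subtab P' i) = sh (subtab P i)) \<longleftrightarrow> subtab P' l = subtab P l"
  proof
    assume eq: "\<forall>i<Suc l. sh (subtab P' i) = sh (subtab P i)"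
    show "subtab P' l = subtab P l"
    proof (rule tableau_eq_levels[of _ l])
      show "subtab P' l \<in> tableaux l" "subtab P l \<in> tableaux l" using P subtab_tableaux by auto
    qed (use eq in \<open>simp add: subtab_subtab\<close>)
  next
    assume "subtab P' l = subtab P l"
    then show "\<forall>i<Suc l. sh (subtab P' i) = sh (subtab P i)"
      using subtab_subtab[of _ l P] subtab_subtab[of _ l P'] by (metis less_Suc_eq_le)
  qed
  then show ?thesis using P by (auto simp: insertion_path_def subtab_ident)
qed

text \<open>The largest letter enters at the top level: nothing below moves, the first row tried is
  \<open>Suc l\<close>, and the flag \<open>False\<close> selects \<open>f0\<close>
  throughout.\<close>

lemma q_insert_top:
  assumes P: "P \<in> tableaux (Suc l)" "P' \<in> tableaux (Suc l)"
  shows "q_insert q (Suc l) (Suc l) P P' = of_bool (subtab P' l = subtab P l) *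
     (\<Sum>r=1..Suc l. if plus_e (sh P) r (sh P')
        then stepw q False (Suc l) r (nth_part (sh (subtab P l))) (nth_part (sh P)) else 0)"
proof (cases "subtab P' l = subtab P l \<and> (\<exists>r\<in>{1..Suc l}. plus_e (sh P) r (sh P'))")
  case False
  have "\<nexists>j. insertion_path (Suc l) (Suc l) P P' j"
    using insertion_path_top[OF P] False by auto
  then have "q_insert q (Suc l) (Suc l) P P' = 0" by (rule q_insert_no_path)
  then show ?thesis using False by (auto intro!: sum.neutral)
next
  case True
  then obtain r where r: "1 \<le> r" "r \<le> Suc l" "plus_e (sh P) r (sh P')" by auto
  have "(\<Sum>r'=1..Suc l. if plus_e (sh P) r' (sh P')
      then stepw q False (Suc l) r' (nth_part (sh (subtab P l))) (nth_part (sh P)) else 0)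
    = (\<Sum>r'\<in>{1..Suc l}. if r' = r then stepw q False (Suc l) r (nth_part (sh (subtab P l))) (nth_part (sh P)) else 0)"
    using r plus_e_unique by (intro sum.cong) auto
  then have sum: "(\<Sum>r'=1..Suc l. if plus_e (sh P) r' (sh P')
      then stepw q False (Suc l) r' (nth_part (sh (subtab P l))) (nth_part (sh P)) else 0)
    = stepw q False (Suc l) r (nth_part (sh (subtab P l))) (nth_part (sh P))"
    using r by simp
  \<comment> \<open>Only the values at \<open>l\<close> and \<open>Suc l\<close> enter; the one at
    \<open>l\<close> has to be the inserted letter.\<close>
  define j where "j = (\<lambda>_. Suc l)(Suc l := r)"
  have j: "insertion_path (Suc l) (Suc l) P P' j"
    using insertion_path_top[OF P] True r by (simp add: j_def)
  have "q_insert q (Suc l) (Suc l) P P' = path_weight q (Suc l) (Suc l) P j"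
    using q_insert_path[OF P _ _ j] by simp
  then show ?thesis
    using True P(1) unfolding sum by (simp add: path_weight_stepw j_def lev_top_fun lev_shape[of P l])
qed

section \<open>Positivity and total mass of the insertion kernel\<close>

lemma has_sum_sum:
  fixes f :: "'i \<Rightarrow> 'a \<Rightarrow> 'b::topological_comm_monoid_add"
  assumes "\<And>i. i \<in> I \<Longrightarrow> (f i has_sum s i) A"
  shows "((\<lambda>x. \<Sum>i\<in>I. f i x) has_sum (\<Sum>i\<in>I. s i)) A"
  using assms by (induction I rule: infinite_finite_induct) (auto intro: has_sum_add)

lemma one_minus_power_pos: "0 \<le> q \<Longrightarrow> q < 1 \<Longrightarrow> 0 < n \<Longrightarrow> 0 < 1 - (q::real) ^ n"
  by (simp add: power_less_one_iff)

context
  fixes q :: real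
  assumes q: "0 \<le> q" "q < 1"
begin

text \<open>So \<open>phi\<close> is a success probability. The quotient is at most 1 by
  interlacing: \<open>x r \<le> y r\<close> makes the exponent in the denominator the larger one. A
  vanishing denominator gives the quotient 0.\<close>

lemma phi_bounds:
  assumes h: "hstrip x y" and r: "1 \<le> r"
  shows "0 \<le> phi q b s (nth_part x) (nth_part y) r" "phi q b s (nth_part x) (nth_part y) r \<le> 1"
proof -
  have le: "nth_part x r \<le> nth_part y r" using h r by (simp add: hstrip_def)
  have 1: "q ^ n \<le> 1" for n using q by (simp add: power_le_one)
  define m where "m = nth_part x (r - 1) - nth_part y r"
  define n where "n = nth_part x (r - 1) - nth_part x r"
  have mn: "q ^ n \<le> q ^ m" using le q by (intro power_decreasing) (auto simp: m_def n_def)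
  have "0 \<le> (1 - q ^ m) / (1 - q ^ n)" using 1 by simp
  moreover have "(1 - q ^ m) / (1 - q ^ n) \<le> 1"
    using mn 1[of n] by (cases "1 - q ^ n = 0") (auto simp: divide_le_eq_1)
  ultimately show "0 \<le> phi q b s (nth_part x) (nth_part y) r" "phi q b s (nth_part x) (nth_part y) r \<le> 1"
    using 1 q by (auto simp: phi_def m_def n_def)
qed

lemma stepw_nonneg:
  assumes "hstrip x y" "1 \<le> r" shows "0 \<le> stepw q b s r (nth_part x) (nth_part y)"
  unfolding stepw_def using phi_bounds[OF assms(1)] assms(2)
  by (intro mult_nonneg_nonneg prod_nonneg) auto

lemma q_insert_nonneg:
  assumes "P \<in> tableaux l" "P' \<in> tableaux l" "1 \<le> k" "k \<le> l"
  shows "0 \<le> q_insert q l k P P'"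
  using assms
proof (induction l arbitrary: P P')
  case (Suc l)
  have h: "hstrip (sh (subtab P l)) (sh P)" using subtab_hstrip Suc.prems by blast
  show ?case
  proof (cases "k \<le> l")
    case True
    have T: "subtab P l \<in> tableaux l" "subtab P' l \<in> tableaux l" using Suc.prems subtab_tableaux by auto
    note IH = Suc.IH[OF T Suc.prems(3) True]
    show ?thesis
    proof (cases "q_insert q l k (subtab P l) (subtab P' l) = 0")
      case False
      then obtain s where "plus_e (sh (subtab P l)) s (sh (subtab P' l))"
        using q_insert_plus_e[OF T Suc.prems(3) True] by blast
      from q_insert_Suc[OF Suc.prems(1-3) True this] show ?thesis
        using IH stepw_nonneg[OF h] by (auto intro!: mult_nonneg_nonneg sum_nonneg)
    qed (use q_insert_Suc_zero[OF Suc.prems(1-3) True] in simp)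
  next
    case False
    then have "k = Suc l" using Suc.prems by simp
    then show ?thesis
      using q_insert_top[OF Suc.prems(1,2)] stepw_nonneg[OF h]
      by (auto simp del: sum.cl_ivl_Suc intro!: mult_nonneg_nonneg sum_nonneg)
  qed
qed simp

text \<open>The summand is the probability that, going down from \<open>s\<close>, the first success
  occurs at \<open>r\<close>; the complement is failure everywhere.\<close>

lemma sum_first_success: "(\<Sum>r=1..s::nat. p r * (\<Prod>t=r+1..s. 1 - p t)) = 1 - (\<Prod>t=1..s. 1 - (p t :: real))"
proof (induction s)
  case (Suc s)
  have "(\<Sum>r=1..Suc s. p r * (\<Prod>t=r+1..Suc s. 1 - p t))
      = (\<Sum>r=1..s. p r * (\<Prod>t=r+1..s. 1 - p t)) * (1 - p (Suc s)) + p (Suc s)"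
    by (simp add: sum_distrib_right mult.assoc)
  then show ?case unfolding Suc by (simp add: algebra_simps)
qed simp

text \<open>Row 1 always succeeds, so failure everywhere has probability 0.\<close>

lemma sum_stepw: "1 \<le> s \<Longrightarrow> (\<Sum>r=1..s. stepw q b s r x y) = 1"
proof -
  assume "1 \<le> s"
  then have "{1..s} = insert 1 {2..s}" by auto
  then show ?thesis unfolding stepw_def sum_first_success by (simp add: phi_def)
qed

text \<open>A step of positive weight leads to an interlacing pair of shapes: the factor for the row
  \<open>r\<close> that gains a box vanishes if the box would violate interlacing from above, and the
  factor for the row \<open>s\<close> of the previous level vanishes if its new box would not be covered.\<close>

lemma stepw_valid:
  assumes x: "is_partition x" and y: "is_partition y" and x': "is_partition x'" and h: "hstrip x y"
    and b: "b \<Longrightarrow> plus_e x s x'" "\<not> b \<Longrightarrow> x' = x"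
    and r: "1 \<le> r" "r \<le> s" and nz: "stepw q b s r (nth_part x) (nth_part y) \<noteq> 0"
  obtains y' where "is_partition y'" "hstrip x' y'" "plus_e y r y'"
proof -
  have phir: "phi q b s (nth_part x) (nth_part y) r \<noteq> 0"
    using nz by (auto simp: stepw_def)
  have phit: "phi q b s (nth_part x) (nth_part y) t \<noteq> 1" if "r < t" "t \<le> s" for t
    using nz that by (auto simp: stepw_def prod_zero_iff)
  have room: "nth_part y r < nth_part x (r - 1)" if "r \<noteq> 1"
  proof (rule ccontr)
    assume "\<not> ?thesis"
    then have "nth_part x (r - 1) - nth_part y r = 0" by simp
    then have "phi q b s (nth_part x) (nth_part y) r = 0" using that unfolding phi_def by auto
    then show False using phir by simp
  qed
  have hx: "nth_part y (Suc j) \<le> nth_part x j" "nth_part x j \<le> nth_part y j" if "1 \<le> j" for j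
    using h that by (auto simp: hstrip_def)
  have xx': "nth_part x j \<le> nth_part x' j" if "1 \<le> j" for j
    using b that by (cases b) (auto simp: plus_e_def)
  have cover: "nth_part x s < nth_part y s" if "b" "r < s"
  proof (rule ccontr)
    assume "\<not> ?thesis"
    then have eq: "nth_part y s = nth_part x s" using hx(2)[of s] r by simp
    have "nth_part x' s \<le> nth_part x' (s - 1)" using is_partition_antimono[OF x', of "s - 1" s] that r by simp
    then have "nth_part x s < nth_part x (s - 1)"
      using b(1)[OF that(1)] that r unfolding plus_e_def by (auto dest!: spec split: if_splits)
    then have "0 < 1 - q ^ (nth_part x (s - 1) - nth_part x s)" by (intro one_minus_power_pos q) simp
    then have "phi q b s (nth_part x) (nth_part y) s = 1" using that r by (simp add: phi_def eq)
    then show False using phit[of s] that by simp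
  qed
  define f where "f j = nth_part y j + (if j = r then 1 else 0)" for j
  have anti: "f (Suc j) \<le> f j" if "1 \<le> j" for j
  proof -
    have "nth_part y (Suc j) \<le> nth_part y j" using is_partition_antimono[OF y that] by simp
    moreover have "nth_part y (Suc j) < nth_part y j" if "r = Suc j"
      using room hx(2)[OF \<open>1 \<le> j\<close>] that \<open>1 \<le> j\<close> by simp
    ultimately show ?thesis by (auto simp: f_def)
  qed
  have zero: "f (Suc (max r (length y))) = 0" by (simp add: f_def nth_part_eq_0)
  obtain y' where y': "is_partition y'" "\<And>j. 1 \<le> j \<Longrightarrow> nth_part y' j = f j"
    using ex_partition[OF anti zero] by blast
  have "hstrip x' y'"
    unfolding hstrip_def
  proof (intro allI impI conjI)
    fix j :: nat assume j: "1 \<le> j"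
    have "f (Suc j) \<le> nth_part x j" using hx(1)[OF j] room j by (auto simp: f_def)
    then show "nth_part y' (Suc j) \<le> nth_part x' j" using xx'[OF j] y'(2)[of "Suc j"] by simp
    show "nth_part x' j \<le> nth_part y' j"
    proof (cases "b \<and> j = s")
      case True
      then have "nth_part x' j = nth_part x s + 1" using b j by (simp add: plus_e_def)
      moreover have "nth_part x s + 1 \<le> f s"
        using cover True r hx(2)[of s] by (cases "r = s") (auto simp: f_def)
      ultimately show ?thesis using True y'(2)[OF j] by simp
    next
      case False
      then have "nth_part x' j = nth_part x j" using b j by (cases b) (auto simp: plus_e_def)
      then show ?thesis using hx(2)[OF j] y'(2)[OF j] by (simp add: f_def)
    qed
  qed
  moreover have "plus_e y r y'" using y'(2) by (simp add: plus_e_def f_def)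
  ultimately show thesis using that y'(1) by blast
qed

text \<open>Each row \<open>r\<close> of nonzero weight leads to exactly one admissible shape, so
  the sum over shapes is the sum over rows.\<close>

lemma stepw_has_sum:
  assumes x: "is_partition x" and y: "is_partition y" and x': "is_partition x'" and h: "hstrip x y"
    and b: "b \<Longrightarrow> plus_e x s x'" "\<not> b \<Longrightarrow> x' = x" and s: "1 \<le> s"
  shows "((\<lambda>y'. \<Sum>r=1..s. if plus_e y r y' then stepw q b s r (nth_part x) (nth_part y) else 0)
           has_sum 1) {y'. is_partition y' \<and> hstrip x' y'}"
proof -
  let ?Y = "{y'. is_partition y' \<and> hstrip x' y'}"
  let ?w = "\<lambda>r. stepw q b s r (nth_part x) (nth_part y)"
  have "((\<lambda>y'. if plus_e y r y' then ?w r else 0) has_sum ?w r) ?Y" if r: "1 \<le> r" "r \<le> s" for r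
  proof (cases "?w r = 0")
    case True
    then show ?thesis by (simp cong: if_cong add: has_sum_0)
  next
    case False
    then obtain y' where y': "is_partition y'" "hstrip x' y'" "plus_e y r y'"
      using stepw_valid[OF x y x' h b r] by blast
    have "((\<lambda>y'. if plus_e y r y' then ?w r else 0) has_sum ?w r) {y'}"
      using has_sum_finite[of "{y'}" "\<lambda>y'. if plus_e y r y' then ?w r else 0"] y'(3) by simp
    also have "?this \<longleftrightarrow> ?thesis"
      using y' plus_e_unique_right by (intro has_sum_cong_neutral) auto
    finally show ?thesis .
  qed
  then have "((\<lambda>y'. \<Sum>r\<in>{1..s}. if plus_e y r y' then ?w r else 0) has_sum (\<Sum>r\<in>{1..s}. ?w r)) ?Y"
    by (intro has_sum_sum) auto
  then show ?thesis using sum_stepw[OF s] by simp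
qed

theorem q_insert_has_sum:
  assumes "P \<in> tableaux l" "1 \<le> k" "k \<le> l"
  shows "(q_insert q l k P has_sum 1) (tableaux l)"
  using assms
proof (induction l arbitrary: P)
  case (Suc l)
  let ?g = "\<lambda>P. (subtab P l, sh P)"
  define B where "B P0 = {mu. is_partition mu \<and> hstrip (sh P0) mu}" for P0
  define F where "F = (\<lambda>(P0, mu). q_insert q (Suc l) k P (ext l P0 mu))"
  let ?P0 = "subtab P l"
  have P0: "?P0 \<in> tableaux l" using Suc.prems subtab_tableaux by blast
  have h: "hstrip (sh ?P0) (sh P)" using subtab_hstrip Suc.prems by blast
  have part: "is_partition (sh P)" "is_partition (sh ?P0)" using sh_partition Suc.prems P0 by blast+
  have ext: "ext l P0' mu \<in> tableaux (Suc l)" "subtab (ext l P0' mu) l = P0'" "sh (ext l P0' mu) = mu"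
    if "P0' \<in> tableaux l" "mu \<in> B P0'" for P0' mu
    using that ext_tableaux sh_ext by (auto simp: B_def)
  \<comment> \<open>The marginal of the kernel on the lower levels; the largest letter leaves them
    fixed.\<close>
  define G where "G = (if k \<le> l then q_insert q l k ?P0 else (\<lambda>P0'. of_bool (P0' = ?P0)))"
  have G: "(G has_sum 1) (tableaux l)"
  proof (cases "k \<le> l")
    case True then show ?thesis using Suc.IH[OF P0] Suc.prems by (simp add: G_def)
  next
    case False
    have "((\<lambda>P0'. of_bool (P0' = ?P0) :: real) has_sum 1) {?P0}"
      using has_sum_finite[of "{?P0}" "\<lambda>P0'. of_bool (P0' = ?P0) :: real"] by simp
    also have "?this \<longleftrightarrow> ((\<lambda>P0'. of_bool (P0' = ?P0)) has_sum (1::real)) (tableaux l)"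
      using P0 by (intro has_sum_cong_neutral) auto
    finally show ?thesis using False by (simp add: G_def)
  qed
  have inner: "((\<lambda>mu. F (P0', mu)) has_sum G P0') (B P0')" if P0': "P0' \<in> tableaux l" for P0'
  proof -
    have part': "is_partition (sh P0')" using sh_partition P0' by blast
    show ?thesis
    proof (cases "k \<le> l")
      case True
      show ?thesis
      proof (cases "q_insert q l k ?P0 P0' = 0")
        case zero: True
        have "F (P0', mu) = 0" if "mu \<in> B P0'" for mu
          using q_insert_Suc_zero[OF Suc.prems(1) ext(1)[OF P0' that] Suc.prems(2) True] ext[OF P0' that] zero
          by (simp add: F_def)
        then have "((\<lambda>mu. F (P0', mu)) has_sum 0) (B P0')" by (rule has_sum_0)
        then show ?thesis using True zero by (simp add: G_def)
      next
        case False
        then obtain s where s: "1 \<le> s" "plus_e (sh ?P0) s (sh P0')"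
          using q_insert_plus_e[OF P0 P0' Suc.prems(2) True] by blast
        have "((\<lambda>y'. q_insert q l k ?P0 P0' * (\<Sum>r=1..s. if plus_e (sh P) r y'
            then stepw q True s r (nth_part (sh ?P0)) (nth_part (sh P)) else 0)) has_sum q_insert q l k ?P0 P0' * 1) (B P0')"
          unfolding B_def
          by (intro has_sum_cmult_right stepw_has_sum[where b = True]) (use part part' h s in auto)
        also have "?this \<longleftrightarrow> ((\<lambda>mu. F (P0', mu)) has_sum q_insert q l k ?P0 P0' * 1) (B P0')"
        proof (rule has_sum_cong)
          fix mu assume mu: "mu \<in> B P0'"
          from q_insert_Suc[OF Suc.prems(1) ext(1)[OF P0' mu] Suc.prems(2) True, unfolded ext(2)[OF P0' mu] ext(3)[OF P0' mu], OF s(2), of q]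
          show "q_insert q l k ?P0 P0' * (\<Sum>r=1..s. if plus_e (sh P) r mu
            then stepw q True s r (nth_part (sh ?P0)) (nth_part (sh P)) else 0) = F (P0', mu)"
            by (simp add: F_def)
        qed
        finally show ?thesis using True by (simp add: G_def)
      qed
    next
      case False
      then have k: "k = Suc l" using Suc.prems by simp
      have FF: "F (P0', mu) = of_bool (P0' = ?P0) * (\<Sum>r=1..Suc l. if plus_e (sh P) r mu
            then stepw q False (Suc l) r (nth_part (sh ?P0)) (nth_part (sh P)) else 0)" if "mu \<in> B P0'" for mu
        using q_insert_top[OF Suc.prems(1) ext(1)[OF P0' that]] ext[OF P0' that] by (simp add: F_def k)
      have "((\<lambda>y'. of_bool (P0' = ?P0) * (\<Sum>r=1..Suc l. if plus_e (sh P) r y'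
            then stepw q False (Suc l) r (nth_part (sh ?P0)) (nth_part (sh P)) else 0)) has_sum of_bool (P0' = ?P0) * 1) (B P0')"
      proof (cases "P0' = ?P0")
        case True
        show ?thesis unfolding B_def
          by (intro has_sum_cmult_right stepw_has_sum[where b = False]) (use part part' h True in auto)
      next
        case False then show ?thesis by (simp add: has_sum_0)
      qed
      also have "?this \<longleftrightarrow> ((\<lambda>mu. F (P0', mu)) has_sum of_bool (P0' = ?P0) * 1) (B P0')"
        by (rule has_sum_cong) (simp add: FF)
      finally show ?thesis using k by (simp add: G_def)
    qed
  qed
  \<comment> \<open>Nonnegativity turns the iterated sums into a sum over the infinite set of
    pairs.\<close>
  have F_nonneg: "0 \<le> F p" if "p \<in> Sigma (tableaux l) B" for p
    using that ext(1) q_insert_nonneg[OF Suc.prems(1)] Suc.prems by (auto simp: F_def)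
  have "F summable_on Sigma (tableaux l) B"
    by (rule summable_on_SigmaI[OF inner]) (use G F_nonneg has_sum_imp_summable in auto)
  with inner G have "(F has_sum 1) (Sigma (tableaux l) B)" by (rule has_sum_SigmaI)
  then have "((\<lambda>P'. F (?g P')) has_sum 1) (tableaux (Suc l))"
    using has_sum_reindex_bij_betw[OF tableaux_Suc_bij[of l], of F 1] by (simp add: B_def[abs_def])
  also have "?this \<longleftrightarrow> ?case"
    by (rule has_sum_cong) (simp add: F_def ext_subtab)
  finally show ?case .
qed simp

end



subsection \<open>The intertwining relation\<close>

text \<open>For interlacing \<open>x\<close> and \<open>y\<close>, multiplying by the
  \<open>Delta\<close> of \<open>y\<close> at \<open>l + 1\<close> and dividing by that of
  \<open>x\<close> at \<open>l\<close> gives a product of q-binomial coefficients, the branching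
  coefficient of the q-Whittaker polynomials.\<close>

definition wgt :: "real \<Rightarrow> nat \<Rightarrow> (nat \<Rightarrow> nat) \<Rightarrow> (nat \<Rightarrow> nat) \<Rightarrow> real" where
  "wgt q l x y = (\<Prod>i=1..<l. qpoch q (x i - x (i + 1))) /
     ((\<Prod>i=1..l. qpoch q (x i - y (i + 1))) * (\<Prod>i=1..l. qpoch q (y i - x i)))"

text \<open>The value of \<open>L_ker\<close> for a box in row \<open>s\<close>, taken on part
  functions instead of lists, because the computations below change single parts.\<close>

definition Lval :: "real \<Rightarrow> nat \<Rightarrow> (nat \<Rightarrow> nat) \<Rightarrow> nat \<Rightarrow> real" where
  "Lval q l x s = (if s < l then 1 - q ^ (x s - x (s + 1) + 1) else 1)"

lemma kappa_Suc:
  assumes "P \<in> tableaux (Suc l)"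
  shows "kappa q (Suc l) P =
    kappa q l (subtab P l) * wgt q l (nth_part (sh (subtab P l))) (nth_part (sh P))"
proof -
  let ?n = "\<lambda>P j. \<Prod>i=1..<j. qpoch q (lev P j i - lev P j (i + 1))"
  let ?d = "\<lambda>P j. \<Prod>i=1..j. qpoch q (lev P j i - lev P (j + 1) (i + 1)) * qpoch q (lev P (j + 1) i - lev P j i)"
  have n: "(\<Prod>j=2..<Suc l. ?n P j) = (\<Prod>j=2..<l. ?n (subtab P l) j) * ?n P l"
  proof (cases "2 \<le> l")
    case True
    then show ?thesis by (simp add: prod.atLeastLessThan_Suc lev_subtab)
  next
    case False
    then have "l = 0 \<or> l = 1" by auto
    then show ?thesis by auto
  qed
  have d: "(\<Prod>j=1..<Suc l. ?d P j) = (\<Prod>j=1..<l. ?d (subtab P l) j) * ?d P l"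
  proof (cases "1 \<le> l")
    case True
    then show ?thesis by (simp add: prod.atLeastLessThan_Suc lev_subtab)
  qed (auto simp: not_le)
  have "kappa q (Suc l) P = kappa q l (subtab P l) * (?n P l / ?d P l)"
    unfolding kappa_def n d by simp
  also have "?n P l / ?d P l = wgt q l (nth_part (sh (subtab P l))) (nth_part (sh P))"
    using assms by (simp add: wgt_def prod.distrib lev_shape[of P l] lev_top_fun)
  finally show ?thesis .
qed

section \<open>Effect of a removed box on one level factor\<close>

lemma qpoch_Suc: "qpoch q (Suc n) = qpoch q n * (1 - q ^ Suc n)"
  by (simp add: qpoch_def)

lemma prod_qpoch_shift1:
  assumes "finite I" "p \<in> I" "d' p = Suc (d p)" "\<And>i. i \<in> I \<Longrightarrow> i \<noteq> p \<Longrightarrow> d' i = d i"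
  shows "(\<Prod>i\<in>I. qpoch q (d' i)) = (\<Prod>i\<in>I. qpoch q (d i)) * (1 - q ^ d' p)"
proof -
  have "(\<Prod>i\<in>I - {p}. qpoch q (d' i)) = (\<Prod>i\<in>I - {p}. qpoch q (d i))"
    using assms by (intro prod.cong) auto
  then show ?thesis
    using assms(3) by (simp add: prod.remove[OF assms(1,2)] qpoch_Suc)
qed

text \<open>Changing one part moves two exponents by one in opposite directions. Either index may
  lie outside \<open>I\<close> and then contributes 1; this absorbs the first and last rows and the
  products with a single changed exponent.\<close>

lemma prod_qpoch_shift:
  assumes "finite I" "p \<noteq> s"
    and p: "p \<in> I \<Longrightarrow> d' p = Suc (d p)" and s: "s \<in> I \<Longrightarrow> d s = Suc (d' s)"
    and eq: "\<And>i. i \<in> I \<Longrightarrow> i \<noteq> p \<Longrightarrow> i \<noteq> s \<Longrightarrow> d' i = d i"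
  shows "(\<Prod>i\<in>I. qpoch q (d' i)) * (if s \<in> I then 1 - q ^ d s else 1)
       = (\<Prod>i\<in>I. qpoch q (d i)) * (if p \<in> I then 1 - q ^ d' p else 1)"
proof -
  \<comment> \<open>Halfway from \<open>d\<close> to \<open>d'\<close>: index \<open>p\<close> has
    changed, index \<open>s\<close> has not.\<close>
  define e where "e = d(p := d' p)"
  have "(\<Prod>i\<in>I. qpoch q (e i)) = (\<Prod>i\<in>I. qpoch q (d i)) * (if p \<in> I then 1 - q ^ d' p else 1)"
  proof (cases "p \<in> I")
    case True
    then show ?thesis using prod_qpoch_shift1[OF assms(1) True, of e d] p by (simp add: e_def)
  next
    case False
    then show ?thesis by (auto simp: e_def intro!: prod.cong)
  qed
  moreover have "(\<Prod>i\<in>I. qpoch q (e i)) = (\<Prod>i\<in>I. qpoch q (d' i)) * (if s \<in> I then 1 - q ^ d s else 1)"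
  proof (cases "s \<in> I")
    case True
    then show ?thesis using prod_qpoch_shift1[OF assms(1) True, of e d'] s eq assms(2) by (simp add: e_def)
  next
    case False
    then have "e i = d' i" if "i \<in> I" for i using eq that by (metis e_def fun_upd_apply)
    then show ?thesis using False by simp
  qed
  ultimately show ?thesis by simp
qed

context
  fixes q :: real
  assumes q: "0 \<le> q" "q < 1"
begin

lemma qpoch_pos: "0 < qpoch q n"
  unfolding qpoch_def using one_minus_power_pos[OF q] by (intro prod_pos) auto

lemma kappa_pos: "0 < kappa q l P"
  unfolding kappa_def by (intro divide_pos_pos mult_pos_pos prod_pos) (auto simp: qpoch_pos intro!: mult_pos_pos prod_pos)

lemma one_minus_power_nz: "0 < n \<Longrightarrow> 1 - q ^ n \<noteq> 0"
  using one_minus_power_pos[OF q] by (metis less_irrefl)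

text \<open>In the next lemmas, \<open>lam\<close> and \<open>x\<close> are the two top levels of the tableau after the insertion, and
  \<open>lam\<close> with a box removed from row \<open>r\<close> is the top level before it; the box removed from
  \<open>x\<close>, if any, is in row \<open>s\<close>.\<close>

context
  fixes l r :: nat and x lam :: "nat \<Rightarrow> nat"
  assumes inter: "\<And>j. 1 \<le> j \<Longrightarrow> lam (Suc j) \<le> x j" "\<And>j. 1 \<le> j \<Longrightarrow> x j \<le> lam j"
    and r: "1 \<le> r" "r \<le> Suc l" and lam_gap: "lam (Suc r) < lam r"
begin

lemma lam_r_pos: "0 < lam r"
  using lam_gap by simp

lemma lam_le_above: "2 \<le> j \<Longrightarrow> lam j \<le> x (j - 1)"
  using inter(1)[of "j - 1"] by simp

text \<open>Removing the box enlarges \<open>x (r - 1) - lam r\<close>, which the success factor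
  \<open>phi\<close> compensates, and shrinks \<open>lam r - x r\<close>, which leaves the factor on
  the right; row \<open>Suc l\<close> has no such exponent. The failures in the rows after
  \<open>r\<close> are left out so that \<open>wgt_above\<close> can use the identity too.\<close>

lemma wgt_top:
  assumes "r = Suc l \<or> x r < lam r"
  shows "wgt q l x (lam(r := lam r - 1)) * phi q False (Suc l) x (lam(r := lam r - 1)) r
       = wgt q l x lam * (if r = Suc l then 1 else 1 - q ^ (lam r - x r))"
proof -
  let ?mu = "lam(r := lam r - 1)"
  \<comment> \<open>\<open>Suc l\<close> here and \<open>0\<close> in the next product are dummy
    indices outside the range: only one exponent changes.\<close>
  have 1: "(\<Prod>i=1..l. qpoch q (x i - ?mu (i + 1))) * (if Suc l \<in> {1..l} then 1 - q ^ (x (Suc l) - lam (Suc l + 1)) else 1)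
      = (\<Prod>i=1..l. qpoch q (x i - lam (i + 1))) * (if r - 1 \<in> {1..l} then 1 - q ^ (x (r - 1) - ?mu (r - 1 + 1)) else 1)"
  proof (rule prod_qpoch_shift)
    assume "r - 1 \<in> {1..l}"
    then have "2 \<le> r" by auto
    then show "x (r - 1) - ?mu (r - 1 + 1) = Suc (x (r - 1) - lam (r - 1 + 1))"
      using lam_le_above[of r] lam_r_pos by (auto simp: Suc_diff_le)
  qed (use r in auto)
  have 2: "(\<Prod>i=1..l. qpoch q (?mu i - x i)) * (if r \<in> {1..l} then 1 - q ^ (lam r - x r) else 1)
      = (\<Prod>i=1..l. qpoch q (lam i - x i)) * (if 0 \<in> {1..l} then 1 - q ^ (?mu 0 - x 0) else 1)"
  proof (rule prod_qpoch_shift)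
    assume "r \<in> {1..l}"
    then show "lam r - x r = Suc (?mu r - x r)" using assms by auto
  qed (use r in auto)
  have ph: "phi q False (Suc l) x ?mu r = (if r - 1 \<in> {1..l} then 1 - q ^ (x (r - 1) - ?mu (r - 1 + 1)) else 1)"
    using r by (auto simp: phi_def)
  have e: "(if r = Suc l then 1 else 1 - q ^ (lam r - x r)) = (if r \<in> {1..l} then 1 - q ^ (lam r - x r) else 1)"
    using r by auto
  let ?N = "\<Prod>i=1..<l. qpoch q (x i - x (i + 1))"
  let ?a = "\<Prod>i=1..l. qpoch q (x i - ?mu (i + 1))" let ?a' = "\<Prod>i=1..l. qpoch q (x i - lam (i + 1))"
  let ?b = "\<Prod>i=1..l. qpoch q (?mu i - x i)" let ?b' = "\<Prod>i=1..l. qpoch q (lam i - x i)"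
  have pos: "?a > 0" "?a' > 0" "?b > 0" "?b' > 0" by (simp_all add: prod_pos qpoch_pos)
  have E1': "?a = ?a' * phi q False (Suc l) x ?mu r" using 1 unfolding ph by simp
  have E2': "?b * (if r = Suc l then 1 else 1 - q ^ (lam r - x r)) = ?b'" using 2 unfolding e by simp
  define c where "c = (if r = Suc l then 1 else 1 - q ^ (lam r - x r))"
  have "?b * c > 0" using pos(4) E2' by (simp add: c_def)
  then have c: "c > 0" using pos(3) by (simp add: zero_less_mult_iff)
  have "?N / (?a * ?b) * phi q False (Suc l) x ?mu r = ?N / (?a' * (?b * c)) * c"
  proof -
    have "n / (a * b) * p = n / (a' * (b * c)) * c" if "a = a' * p" "a > 0" for n a b p a' :: real
      using that c by (cases "a' = 0"; cases "p = 0") (auto simp: mult_ac)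
    from this[OF E1' pos(1)] show ?thesis .
  qed
  also have "?b * c = ?b'" unfolding c_def by (rule E2')
  finally show ?thesis unfolding wgt_def c_def[symmetric] .
qed

text \<open>Both shapes lose a box in row \<open>r\<close>, so \<open>lam r - x r\<close> stays. The
  numerator of \<open>wgt\<close> changes by \<open>v / u\<close>: \<open>Lval\<close> is
  \<open>u\<close>, and the denominator of \<open>f1\<close> is \<open>v\<close>. The numerator of
  \<open>f1\<close> compensates \<open>x (r - 1) - lam r\<close>; only the exponent
  \<open>x r - lam (r + 1)\<close> leaves a trace.\<close>

lemma wgt_same:
  assumes rl: "r \<le> l" and gap: "lam (r + 1) < x r"
  defines "mu \<equiv> lam(r := lam r - 1)" and "x' \<equiv> x(r := x r - 1)"
  shows "wgt q l x' mu * Lval q l x' r * stepw q True r r x' mu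
       = wgt q l x lam * (1 - q ^ (x r - lam (r + 1)))"
proof -
  have N: "(\<Prod>i=1..<l. qpoch q (x' i - x' (i + 1))) * (if r \<in> {1..<l} then 1 - q ^ (x r - x (r + 1)) else 1)
      = (\<Prod>i=1..<l. qpoch q (x i - x (i + 1))) * (if r - 1 \<in> {1..<l} then 1 - q ^ (x' (r - 1) - x' (r - 1 + 1)) else 1)"
  proof (rule prod_qpoch_shift)
    assume "r - 1 \<in> {1..<l}"
    then have "2 \<le> r" by auto
    then show "x' (r - 1) - x' (r - 1 + 1) = Suc (x (r - 1) - x (r - 1 + 1))"
      using lam_le_above[of r] inter(2)[of r] gap by (auto simp: x'_def Suc_diff_le)
  next
    assume "r \<in> {1..<l}"
    then show "x r - x (r + 1) = Suc (x' r - x' (r + 1))"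
      using gap inter(2)[of "r + 1"] by (simp add: x'_def)
  qed (use r in \<open>auto simp: x'_def\<close>)
  have E1: "(\<Prod>i=1..l. qpoch q (x' i - mu (i + 1))) * (if r \<in> {1..l} then 1 - q ^ (x r - lam (r + 1)) else 1)
      = (\<Prod>i=1..l. qpoch q (x i - lam (i + 1))) * (if r - 1 \<in> {1..l} then 1 - q ^ (x' (r - 1) - mu (r - 1 + 1)) else 1)"
  proof (rule prod_qpoch_shift)
    assume "r - 1 \<in> {1..l}"
    then have "2 \<le> r" by auto
    then show "x' (r - 1) - mu (r - 1 + 1) = Suc (x (r - 1) - lam (r - 1 + 1))"
      using lam_le_above[of r] lam_r_pos by (auto simp: x'_def mu_def Suc_diff_le)
  next
    assume "r \<in> {1..l}"
    then show "x r - lam (r + 1) = Suc (x' r - mu (r + 1))"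
      using gap by (simp add: x'_def mu_def)
  qed (use r in \<open>auto simp: x'_def mu_def\<close>)
  have E2: "(\<Prod>i=1..l. qpoch q (mu i - x' i)) = (\<Prod>i=1..l. qpoch q (lam i - x i))"
    using gap by (intro prod.cong) (auto simp: mu_def x'_def)
  define u where "u = Lval q l x' r"
  define v where "v = (if r = 1 then 1 else 1 - q ^ (x (r - 1) - (x r - 1)))"
  define t where "t = (if r = 1 then 1 else 1 - q ^ (x (r - 1) - (lam r - 1)))"
  define c where "c = 1 - q ^ (x r - lam (r + 1))"
  have "u = (if r \<in> {1..<l} then 1 - q ^ (x r - x (r + 1)) else 1)"
    using r rl gap inter(2)[of "r + 1"] by (auto simp: u_def Lval_def x'_def Suc_diff_Suc intro!: arg_cong[where f = "\<lambda>n. q ^ n"])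
  moreover have "v = (if r - 1 \<in> {1..<l} then 1 - q ^ (x' (r - 1) - x' (r - 1 + 1)) else 1)"
    using r rl by (auto simp: v_def x'_def)
  ultimately have N': "(\<Prod>i=1..<l. qpoch q (x' i - x' (i + 1))) * u = (\<Prod>i=1..<l. qpoch q (x i - x (i + 1))) * v"
    using N by simp
  have "t = (if r - 1 \<in> {1..l} then 1 - q ^ (x' (r - 1) - mu (r - 1 + 1)) else 1)"
    using r rl by (auto simp: t_def x'_def mu_def)
  then have E1': "(\<Prod>i=1..l. qpoch q (x' i - mu (i + 1))) * c = (\<Prod>i=1..l. qpoch q (x i - lam (i + 1))) * t"
    using E1 r rl by (simp add: c_def)
  have st: "stepw q True r r x' mu = t / v"
    using r by (auto simp: stepw_def phi_def t_def v_def x'_def mu_def)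
  have v: "v > 0" unfolding v_def using one_minus_power_pos[OF q] lam_le_above[of r] inter(2)[of r] gap r by auto
  have t: "t > 0" unfolding t_def using one_minus_power_pos[OF q] lam_le_above[of r] lam_r_pos r by auto
  let ?N = "\<Prod>i=1..<l. qpoch q (x i - x (i + 1))" let ?N' = "\<Prod>i=1..<l. qpoch q (x' i - x' (i + 1))"
  let ?a' = "\<Prod>i=1..l. qpoch q (x' i - mu (i + 1))" let ?a = "\<Prod>i=1..l. qpoch q (x i - lam (i + 1))"
  let ?b = "\<Prod>i=1..l. qpoch q (lam i - x i)"
  have pos: "?a > 0" "?a' > 0" "?b > 0" by (simp_all add: prod_pos qpoch_pos)
  have "?N' / (?a' * ?b) * u * (t / v) = (?N' * u) / v * (t / ?a') / ?b" by simp
  also have "(?N' * u) / v = ?N" unfolding N' using v by simp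
  also have "t / ?a' = c / ?a"
  proof -
    have "t / a' = c / a" if "a' * c = a * t" "a > 0" "a' > 0" for a a' :: real
      using that by (simp add: field_simps)
    from this[OF E1' pos(1,2)] show ?thesis .
  qed
  also have "?N * (c / ?a) / ?b = ?N / (?a * ?b) * c" by simp
  finally show ?thesis unfolding wgt_def E2 st u_def c_def .
qed

text \<open>Taking a box from row \<open>s\<close> of \<open>x\<close> multiplies \<open>wgt\<close>
  by \<open>v * c / (u * d)\<close>. Here \<open>Lval\<close> is \<open>u\<close>, and the failure
  in row \<open>s\<close> contributes \<open>d / v\<close> besides a power of \<open>q\<close>. The
  rows strictly between fail with pure powers of \<open>q\<close>, and the box in row
  \<open>r\<close> of \<open>lam\<close> is the business of \<open>wgt_top\<close>.\<close>

lemma wgt_above: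
  assumes rs: "r < s" and sl: "s \<le> l" and cover: "x r < lam r" and gap: "lam (s + 1) < x s"
  defines "mu \<equiv> lam(r := lam r - 1)" and "x' \<equiv> x(s := x s - 1)"
  shows "wgt q l x' mu * Lval q l x' s * stepw q True s r x' mu
       = wgt q l x lam * ((1 - q ^ (lam r - x r)) * (\<Prod>t=r+1..s. q ^ (x (t - 1) - lam t)) *
           (1 - q ^ (x s - lam (s + 1))))"
proof -
  have N: "(\<Prod>i=1..<l. qpoch q (x' i - x' (i + 1))) * (if s \<in> {1..<l} then 1 - q ^ (x s - x (s + 1)) else 1)
      = (\<Prod>i=1..<l. qpoch q (x i - x (i + 1))) * (if s - 1 \<in> {1..<l} then 1 - q ^ (x' (s - 1) - x' (s - 1 + 1)) else 1)"
  proof (rule prod_qpoch_shift)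
    assume "s - 1 \<in> {1..<l}"
    then have "2 \<le> s" by auto
    then show "x' (s - 1) - x' (s - 1 + 1) = Suc (x (s - 1) - x (s - 1 + 1))"
      using lam_le_above[of s] inter(2)[of s] gap by (auto simp: x'_def Suc_diff_le)
  next
    assume "s \<in> {1..<l}"
    then show "x s - x (s + 1) = Suc (x' s - x' (s + 1))"
      using gap inter(2)[of "s + 1"] by (simp add: x'_def)
  qed (use rs in \<open>auto simp: x'_def\<close>)
  have E1: "(\<Prod>i=1..l. qpoch q (x' i - mu (i + 1))) * (if s \<in> {1..l} then 1 - q ^ (x s - mu (s + 1)) else 1)
      = (\<Prod>i=1..l. qpoch q (x i - mu (i + 1))) * (if 0 \<in> {1..l} then 1 - q ^ (x' 0 - mu (0 + 1)) else 1)"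
  proof (rule prod_qpoch_shift)
    assume "s \<in> {1..l}"
    then show "x s - mu (s + 1) = Suc (x' s - mu (s + 1))"
      using gap rs by (simp add: x'_def mu_def)
  qed (use rs in \<open>auto simp: x'_def\<close>)
  have E2: "(\<Prod>i=1..l. qpoch q (mu i - x' i)) * (if 0 \<in> {1..l} then 1 - q ^ (mu 0 - x 0) else 1)
      = (\<Prod>i=1..l. qpoch q (mu i - x i)) * (if s \<in> {1..l} then 1 - q ^ (mu s - x' s) else 1)"
  proof (rule prod_qpoch_shift)
    assume "s \<in> {1..l}"
    then show "mu s - x' s = Suc (mu s - x s)"
      using gap rs inter(2)[of s] by (simp add: x'_def mu_def)
  qed (use rs in \<open>auto simp: x'_def\<close>)
  define u where "u = Lval q l x' s"
  define v where "v = 1 - q ^ (x (s - 1) - (x s - 1))"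
  define c where "c = 1 - q ^ (x s - lam (s + 1))"
  define d where "d = 1 - q ^ (lam s - (x s - 1))"
  have "u = (if s \<in> {1..<l} then 1 - q ^ (x s - x (s + 1)) else 1)"
    using rs sl gap inter(2)[of "s + 1"] by (auto simp: u_def Lval_def x'_def Suc_diff_Suc intro!: arg_cong[where f = "\<lambda>n. q ^ n"])
  moreover have "v = (if s - 1 \<in> {1..<l} then 1 - q ^ (x' (s - 1) - x' (s - 1 + 1)) else 1)"
    using r rs sl by (auto simp: v_def x'_def)
  ultimately have N': "(\<Prod>i=1..<l. qpoch q (x' i - x' (i + 1))) * u = (\<Prod>i=1..<l. qpoch q (x i - x (i + 1))) * v"
    using N by simp
  have E1': "(\<Prod>i=1..l. qpoch q (x' i - mu (i + 1))) * c = (\<Prod>i=1..l. qpoch q (x i - mu (i + 1)))"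
    using E1 rs sl by (simp add: c_def mu_def)
  have E2': "(\<Prod>i=1..l. qpoch q (mu i - x' i)) = (\<Prod>i=1..l. qpoch q (mu i - x i)) * d"
    using E2 rs sl by (simp add: d_def mu_def x'_def)
  have v: "v > 0" unfolding v_def using lam_le_above[of s] inter(2)[of s] gap r rs by (intro one_minus_power_pos q) simp
  have d: "d > 0" unfolding d_def using inter(2)[of s] gap r rs by (intro one_minus_power_pos q) simp
  have c: "c > 0" unfolding c_def using gap by (intro one_minus_power_pos q) simp
  \<comment> \<open>With exponents \<open>m = x (s - 1) - lam s\<close> and
    \<open>n = lam s - (x s - 1)\<close> this is \<open>1 - (1 - q^m) / (1 - q^(m+n)) = q^m * (1 -
    q^n) / (1 - q^(m+n))\<close>.\<close>
  have fs: "1 - phi q True s x' mu s = q ^ (x (s - 1) - lam s) * d / v"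
  proof -
    have "x (s - 1) - (x s - 1) = (x (s - 1) - lam s) + (lam s - (x s - 1))"
      using lam_le_above[of s] inter(2)[of s] gap r rs by simp
    then have "v = 1 - q ^ (x (s - 1) - lam s) * q ^ (lam s - (x s - 1))"
      unfolding v_def by (metis power_add)
    moreover have "phi q True s x' mu s = (1 - q ^ (x (s - 1) - lam s)) / v"
      using r rs by (simp add: phi_def v_def x'_def mu_def)
    ultimately show ?thesis using v by (simp add: d_def field_simps)
  qed
  have ft: "1 - phi q True s x' mu t = q ^ (x (t - 1) - lam t)" if "t \<in> {r+1..<s}" for t
    using r that by (auto simp: phi_def x'_def mu_def)
  have fr: "phi q True s x' mu r = phi q False (Suc l) x mu r"
    using r rs by (auto simp: phi_def x'_def mu_def)
  have split: "{r+1..s} = insert s {r+1..<s}" using rs by auto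
  have "(\<Prod>t=r+1..s. 1 - phi q True s x' mu t)
      = (1 - phi q True s x' mu s) * (\<Prod>t=r+1..<s. q ^ (x (t - 1) - lam t))"
    unfolding split using ft by simp
  also have "\<dots> = (\<Prod>t=r+1..s. q ^ (x (t - 1) - lam t)) * (d / v)"
    unfolding split fs by simp
  finally have st: "stepw q True s r x' mu
      = phi q False (Suc l) x mu r * ((\<Prod>t=r+1..s. q ^ (x (t - 1) - lam t)) * (d / v))"
    by (simp add: stepw_def fr)
  let ?N = "\<Prod>i=1..<l. qpoch q (x i - x (i + 1))" let ?N' = "\<Prod>i=1..<l. qpoch q (x' i - x' (i + 1))"
  let ?a' = "\<Prod>i=1..l. qpoch q (x' i - mu (i + 1))"
  let ?b = "\<Prod>i=1..l. qpoch q (mu i - x i)"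
  have pos: "?a' > 0" "?b > 0" by (simp_all add: prod_pos qpoch_pos)
  have "wgt q l x' mu * u * (d / v) = (?N' * u) / v / (?a' * ?b)"
    unfolding wgt_def E2' using d by (simp add: field_simps)
  also have "\<dots> = ?N / (?a' * ?b)" unfolding N' using v by simp
  also have "\<dots> = wgt q l x mu * c"
    unfolding wgt_def E1'[symmetric] using c by simp
  finally have w: "wgt q l x' mu * u * (d / v) = wgt q l x mu * c" .
  have "wgt q l x' mu * u * stepw q True s r x' mu
      = (wgt q l x' mu * u * (d / v)) * phi q False (Suc l) x mu r * (\<Prod>t=r+1..s. q ^ (x (t - 1) - lam t))"
    unfolding st by (simp only: mult_ac)
  also have "\<dots> = (wgt q l x mu * phi q False (Suc l) x mu r) * (\<Prod>t=r+1..s. q ^ (x (t - 1) - lam t)) * c"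
    unfolding w by (simp only: mult_ac)
  also have "wgt q l x mu * phi q False (Suc l) x mu r = wgt q l x lam * (1 - q ^ (lam r - x r))"
    using wgt_top rs sl cover by (simp add: mu_def)
  finally show ?thesis by (simp add: u_def c_def mult_ac)
qed

lemma sum_telescope_weights:
  fixes A :: "nat \<Rightarrow> real"
  assumes "r \<le> m"
  shows "(\<Sum>s=r+1..m. (\<Prod>t=r+1..s. A t) * (1 - A (s + 1))) + (\<Prod>t=r+1..Suc m. A t) = A (r + 1)"
  using assms by (induction m rule: dec_induct) (simp_all add: algebra_simps)

lemma sum_levels:
  assumes rl: "r \<le> l"
  defines "A \<equiv> \<lambda>t. q ^ (x (t - 1) - lam t)" and "B \<equiv> q ^ (lam r - x r)"
  shows "(\<Sum>s=r..l. if s = r then 1 - A (r + 1) else (1 - B) * (\<Prod>t=r+1..s. A t) * (1 - A (s + 1)))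
      + (1 - B) * (\<Prod>t=r+1..Suc l. A t) = Lval q (Suc l) (lam(r := lam r - 1)) r"
proof -
  have "{r..l} = insert r {r+1..l}" using rl by auto
  then have "(\<Sum>s=r..l. if s = r then 1 - A (r + 1) else (1 - B) * (\<Prod>t=r+1..s. A t) * (1 - A (s + 1)))
      = 1 - A (r + 1) + (\<Sum>s=r+1..l. (1 - B) * ((\<Prod>t=r+1..s. A t) * (1 - A (s + 1))))"
    by (simp add: mult.assoc)
  also have "\<dots> + (1 - B) * (\<Prod>t=r+1..Suc l. A t) = 1 - A (r + 1) + (1 - B) * A (r + 1)"
    unfolding sum_telescope_weights[OF rl, of A, symmetric] by (simp only: sum_distrib_left[symmetric] distrib_left add.assoc)
  also have "\<dots> = 1 - A (r + 1) * B" by (simp add: algebra_simps)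
  also have "A (r + 1) * B = q ^ (lam r - lam (r + 1))"
  proof -
    have "lam r - lam (r + 1) = (x r - lam (r + 1)) + (lam r - x r)"
      using inter(1)[of r] inter(2)[of r] r by simp
    then show ?thesis unfolding A_def B_def by (metis add_diff_cancel_right' power_add)
  qed
  \<comment> \<open>\<open>L_ker\<close> is taken at the shape before the insertion, whose row
    \<open>r\<close> has length \<open>lam r - 1\<close>.\<close>
  also have "lam r - lam (r + 1) = lam r - 1 - lam (r + 1) + 1"
    using lam_gap by simp
  finally show ?thesis using rl by (simp add: Lval_def)
qed

end

text \<open>The counterpart of \<open>q_insert_Suc\<close> for a known target row \<open>r\<close>:
  now the row \<open>s\<close> of the level below is the unknown. The intertwining proof sorts all
  letters and all tableaux by this \<open>s\<close>.\<close>

lemma q_insert_Suc_sum: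
  assumes P: "P \<in> tableaux (Suc l)" "P' \<in> tableaux (Suc l)" "1 \<le> k" "k \<le> l"
    and r: "plus_e (sh P) r (sh P')" "1 \<le> r"
  shows "q_insert q (Suc l) k P P' = (\<Sum>s=r..l. if plus_e (sh (subtab P l)) s (sh (subtab P' l))
     then q_insert q l k (subtab P l) (subtab P' l) *
       stepw q True s r (nth_part (sh (subtab P l))) (nth_part (sh P)) else 0)"
proof -
  have T: "subtab P l \<in> tableaux l" "subtab P' l \<in> tableaux l" using P subtab_tableaux by auto
  show ?thesis
  proof (cases "q_insert q l k (subtab P l) (subtab P' l) = 0")
    case True
    then show ?thesis using q_insert_Suc_zero[OF P] by (simp add: sum.neutral)
  next
    case False
    then obtain s where s: "1 \<le> s" "s \<le> k" "plus_e (sh (subtab P l)) s (sh (subtab P' l))"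
      using q_insert_plus_e[OF T P(3,4)] by blast
    let ?w = "\<lambda>s r. stepw q True s r (nth_part (sh (subtab P l))) (nth_part (sh P))"
    have "(\<Sum>r'=1..s. if plus_e (sh P) r' (sh P') then ?w s r' else 0)
        = (\<Sum>r'\<in>{1..s}. if r' = r then ?w s r else 0)"
      using r plus_e_unique by (intro sum.cong) auto
    also have "\<dots> = (if r \<le> s then ?w s r else 0)" using r by simp
    finally have 1: "q_insert q (Suc l) k P P' = q_insert q l k (subtab P l) (subtab P' l) * (if r \<le> s then ?w s r else 0)"
      using q_insert_Suc[OF P s(3)] by simp
    have "(\<Sum>s'=r..l. if plus_e (sh (subtab P l)) s' (sh (subtab P' l))
          then q_insert q l k (subtab P l) (subtab P' l) * ?w s' r else 0)
        = (\<Sum>s'\<in>{r..l}. if s' = s then q_insert q l k (subtab P l) (subtab P' l) * ?w s r else 0)"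
      using s plus_e_unique by (intro sum.cong) auto
    also have "\<dots> = q_insert q l k (subtab P l) (subtab P' l) * (if r \<le> s then ?w s r else 0)"
      using s P(4) by simp
    finally show ?thesis using 1 by simp
  qed
qed

lemma tableaux_shape_bij:
  assumes mu: "is_partition mu"
  shows "bij_betw (\<lambda>P. subtab P l) {P. P \<in> tableaux (Suc l) \<and> sh P = mu}
     {P. P \<in> tableaux l \<and> hstrip (sh P) mu}"
  by (rule bij_betw_byWitness[where f' = "\<lambda>P. ext l P mu"])
     (use mu in \<open>auto simp: ext_subtab ext_tableaux sh_ext intro: subtab_tableaux subtab_hstrip\<close>)

lemma sum_tableaux_shape:
  assumes mu: "is_partition mu"
  shows "(\<Sum>P | P \<in> tableaux (Suc l) \<and> sh P = mu. f P) = (\<Sum>P | P \<in> tableaux l \<and> hstrip (sh P) mu. f (ext l P mu))"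
proof -
  have "(\<Sum>P | P \<in> tableaux (Suc l) \<and> sh P = mu. f P)
      = (\<Sum>P | P \<in> tableaux (Suc l) \<and> sh P = mu. f (ext l (subtab P l) mu))"
    by (rule sum.cong) (auto simp: ext_subtab)
  also have "\<dots> = (\<Sum>P | P \<in> tableaux l \<and> hstrip (sh P) mu. f (ext l P mu))"
    by (rule sum.reindex_bij_betw[OF tableaux_shape_bij[OF mu], of "\<lambda>P. f (ext l P mu)"])
  finally show ?thesis .
qed

theorem kappa_intertwining:
  assumes "P' \<in> tableaux l" "is_partition mu" "1 \<le> r" "r \<le> l" "plus_e mu r (sh P')"
  shows "(\<Sum>k=1..l. \<Sum>P | P \<in> tableaux l \<and> sh P = mu. kappa q l P * q_insert q l k P P')
    = Lval q l (nth_part mu) r * kappa q l P'"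
  using assms
proof (induction l arbitrary: P' mu r)
  case (Suc l)
  define P0 where "P0 = subtab P' l"
  define x where "x = nth_part (sh P0)"
  define lam where "lam = nth_part (sh P')"
  define F where "F = {P. P \<in> tableaux l \<and> hstrip (sh P) mu}"
  note mu = Suc.prems(2) and r = Suc.prems(3,4) and pe = Suc.prems(5)
  have P0: "P0 \<in> tableaux l" using Suc.prems subtab_tableaux by (auto simp: P0_def)
  have partP: "is_partition (sh P')" "is_partition (sh P0)" using sh_partition Suc.prems P0 by blast+
  have inter: "lam (Suc j) \<le> x j" "x j \<le> lam j" if "1 \<le> j" for j
    using subtab_hstrip[OF Suc.prems(1)] that by (auto simp: hstrip_def x_def lam_def P0_def)
  have mulam: "nth_part mu j = (lam(r := lam r - 1)) j" if "1 \<le> j" for j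
    using pe that by (auto simp: plus_e_def lam_def)
  have lam_r: "lam r = Suc (nth_part mu r)" using pe r by (simp add: plus_e_def lam_def)
  have lam_gap: "lam (Suc r) < lam r"
    using is_partition_antimono[OF mu r(1), of "Suc r"] mulam[of "Suc r"] lam_r by simp
  have finF: "finite F"
    using bij_betw_finite[OF tableaux_shape_bij[OF mu, of l]] finite_tableaux_shape[of "Suc l" mu] by (simp add: F_def)
  have ext: "ext l P mu \<in> tableaux (Suc l)" "subtab (ext l P mu) l = P" "sh (ext l P mu) = mu" if "P \<in> F" for P
    using that mu ext_tableaux[of P l mu] sh_ext[of P mu l] by (auto simp: F_def)
  have wgt_mu: "wgt q l y (nth_part mu) = wgt q l y (lam(r := lam r - 1))" for y
    unfolding wgt_def using mulam by simp
  have stepw_mu: "stepw q b s r y (nth_part mu) = stepw q b s r y (lam(r := lam r - 1))" for b s y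
  proof -
    have "phi q b s y (nth_part mu) t = phi q b s y (lam(r := lam r - 1)) t" if "1 \<le> t" for t
      unfolding phi_def mulam[OF that] ..
    then show ?thesis
      unfolding stepw_def using r by (intro arg_cong2[where f = "(*)"] prod.cong) auto
  qed
  have wgt_cong: "wgt q l y z = wgt q l y' z" if "\<And>j. 1 \<le> j \<Longrightarrow> y j = y' j" for y y' z
    unfolding wgt_def using that by simp
  have phi_cong: "phi q b s y z t = phi q b s y' z t" if "\<And>j. 1 \<le> j \<Longrightarrow> y j = y' j" "1 \<le> t" for b s y y' z t
    unfolding phi_def using that by (cases "t = 1") auto
  have stepw_cong: "stepw q b s r y z = stepw q b s r y' z" if "\<And>j. 1 \<le> j \<Longrightarrow> y j = y' j" for b s y y' z
    unfolding stepw_def using phi_cong[of y y', OF that] r by (intro arg_cong2[where f = "(*)"] prod.cong) auto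
  define A where "A t = q ^ (x (t - 1) - lam t)" for t
  define B where "B = q ^ (lam r - x r)"
  define C where "C = kappa q l P0 * wgt q l x lam"
  \<comment> \<open>\<open>G s\<close> and \<open>H\<close> are the shares of
    \<open>kappa P'\<close> that come from a box in row \<open>s\<close> of the level below and from
    the largest letter.\<close>
  define G where "G s = (if s = r then 1 - A (r + 1) else (1 - B) * (\<Prod>t=r+1..s. A t) * (1 - A (s + 1)))" for s
  define H where "H = (if r = Suc l then 1 else (1 - B) * (\<Prod>t=r+1..Suc l. A t))"
  let ?S = "\<lambda>k. \<Sum>P | P \<in> tableaux (Suc l) \<and> sh P = mu. kappa q (Suc l) P * q_insert q (Suc l) k P P'"
  have S: "?S k = (\<Sum>P\<in>F. kappa q l P * wgt q l (nth_part (sh P)) (nth_part mu) * q_insert q (Suc l) k (ext l P mu) P')" for k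
    unfolding sum_tableaux_shape[OF mu] F_def[symmetric]
    by (rule sum.cong) (simp_all add: kappa_Suc ext)

  have top: "?S (Suc l) = C * H"
  proof -
    let ?w = "stepw q False (Suc l) r x (nth_part mu)"
    have "q_insert q (Suc l) (Suc l) (ext l P mu) P' = (if P = P0 then ?w else 0)" if "P \<in> F" for P
    proof -
      have "(\<Sum>r'=1..Suc l. if plus_e mu r' (sh P') then stepw q False (Suc l) r' (nth_part (sh P)) (nth_part mu) else 0)
          = (\<Sum>r'\<in>{1..Suc l}. if r' = r then stepw q False (Suc l) r (nth_part (sh P)) (nth_part mu) else 0)"
        using pe r plus_e_unique by (intro sum.cong) auto
      then show ?thesis
        using q_insert_top[OF ext(1)[OF that] Suc.prems(1), of q, unfolded ext(2)[OF that] ext(3)[OF that]] r by (auto simp: P0_def x_def simp del: sum.cl_ivl_Suc)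
    qed
    then have "?S (Suc l) = (\<Sum>P\<in>F. if P = P0 then kappa q l P0 * wgt q l x (nth_part mu) * ?w else 0)"
      unfolding S by (intro sum.cong) (auto simp: x_def)
    also have "\<dots> = (if P0 \<in> F then kappa q l P0 * wgt q l x (nth_part mu) * ?w else 0)"
      using finF by simp
    also have "\<dots> = C * H"
    proof (cases "r = Suc l \<or> x r < lam r")
      case True
      have xr: "x r = 0" if "r = Suc l" using length_sh[OF P0] that by (simp add: x_def nth_part_eq_0)
      have P0F: "P0 \<in> F"
        unfolding F_def hstrip_def
      proof (intro CollectI conjI P0 allI impI)
        fix j :: nat assume j: "1 \<le> j"
        show "nth_part mu (Suc j) \<le> nth_part (sh P0) j" using inter(1)[OF j] mulam[of "Suc j"] by (auto simp: x_def)
        show "nth_part (sh P0) j \<le> nth_part mu j"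
          using inter(2)[OF j] mulam[OF j] True xr by (cases "j = r") (auto simp: x_def)
      qed
      have e: "(\<Prod>t=r+1..Suc l. 1 - phi q False (Suc l) x (lam(r := lam r - 1)) t) = (\<Prod>t=r+1..Suc l. A t)"
        using r by (intro prod.cong) (auto simp: phi_def A_def)
      have "wgt q l x (nth_part mu) * ?w = (wgt q l x (lam(r := lam r - 1)) * phi q False (Suc l) x (lam(r := lam r - 1)) r)
          * (\<Prod>t=r+1..Suc l. A t)"
        unfolding wgt_mu stepw_mu unfolding stepw_def e by (simp only: mult.assoc)
      also have "wgt q l x (lam(r := lam r - 1)) * phi q False (Suc l) x (lam(r := lam r - 1)) r
          = wgt q l x lam * (if r = Suc l then 1 else 1 - B)"
        unfolding B_def by (rule wgt_top) (use inter r lam_gap True in auto)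
      finally have "wgt q l x (nth_part mu) * ?w = wgt q l x lam * (if r = Suc l then 1 else 1 - B) * (\<Prod>t=r+1..Suc l. A t)" .
      then show ?thesis using P0F by (simp add: C_def H_def mult_ac)
    next
      case False
      \<comment> \<open>Row \<open>r\<close> of \<open>lam\<close> cannot shrink without dropping
        below \<open>x\<close>: no tableau contributes, and the factor \<open>1 - B\<close> of
        \<open>H\<close> vanishes.\<close>
      then have "B = 1" using inter(2)[OF r(1)] by (simp add: B_def)
      moreover have "P0 \<notin> F"
      proof
        assume "P0 \<in> F"
        then have "x r \<le> nth_part mu r" using r by (simp add: F_def hstrip_def x_def)
        then show False using False lam_r by simp
      qed
      ultimately show ?thesis using False by (simp add: H_def)
    qed
    finally show ?thesis .
  qed

  let ?f = "\<lambda>s k P. if plus_e (sh P) s (sh P0) then kappa q l P * wgt q l (nth_part (sh P)) (nth_part mu) *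
      (q_insert q l k P P0 * stepw q True s r (nth_part (sh P)) (nth_part mu)) else 0"
  \<comment> \<open>Fixing \<open>s\<close> fixes the shape \<open>nu\<close> of every contributing
    \<open>P\<close>. The new level factors therefore leave the sum, and the induction hypothesis
    for \<open>nu\<close> evaluates the rest.\<close>
  have level: "(\<Sum>k=1..l. \<Sum>P\<in>F. ?f s k P) = C * G s" if s: "r \<le> s" "s \<le> l" for s
  proof (cases "\<exists>nu. is_partition nu \<and> hstrip nu mu \<and> plus_e nu s (sh P0)")
    case True
    then obtain nu where nu: "is_partition nu" "hstrip nu mu" "plus_e nu s (sh P0)" by blast
    have s1: "1 \<le> s" using r s by simp
    define x' where "x' = x(s := x s - 1)"
    have xnu: "nth_part nu j = x' j" if "1 \<le> j" for j using nu(3) that by (auto simp: plus_e_def x'_def x_def)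
    have xs: "x s = Suc (nth_part nu s)" using nu(3) s1 by (simp add: plus_e_def x_def)
    have nx: "nth_part mu (Suc j) \<le> nth_part nu j" "nth_part nu j \<le> nth_part mu j" if "1 \<le> j" for j
      using nu(2) that by (auto simp: hstrip_def)
    have gap: "lam (s + 1) < x s" using nx(1)[OF s1] mulam[of "Suc s"] xs s by auto
    let ?c = "wgt q l (nth_part nu) (nth_part mu) * stepw q True s r (nth_part nu) (nth_part mu)"
    have "(\<Sum>P\<in>F. ?f s k P) = ?c * (\<Sum>P | P \<in> tableaux l \<and> sh P = nu. kappa q l P * q_insert q l k P P0)" for k
    proof -
      have "(\<Sum>P | P \<in> tableaux l \<and> sh P = nu. ?f s k P) = (\<Sum>P\<in>F. ?f s k P)"
      proof (rule sum.mono_neutral_left[OF finF])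
        show "{P. P \<in> tableaux l \<and> sh P = nu} \<subseteq> F" using nu by (auto simp: F_def)
        show "\<forall>P\<in>F - {P. P \<in> tableaux l \<and> sh P = nu}. ?f s k P = 0"
          using plus_e_unique_left nu sh_partition by (auto simp: F_def)
      qed
      moreover have "(\<Sum>P | P \<in> tableaux l \<and> sh P = nu. ?f s k P)
          = (\<Sum>P | P \<in> tableaux l \<and> sh P = nu. ?c * (kappa q l P * q_insert q l k P P0))"
        using nu(3) by (intro sum.cong) auto
      ultimately show ?thesis by (simp add: sum_distrib_left)
    qed
    then have "(\<Sum>k=1..l. \<Sum>P\<in>F. ?f s k P)
        = ?c * (\<Sum>k=1..l. \<Sum>P | P \<in> tableaux l \<and> sh P = nu. kappa q l P * q_insert q l k P P0)"
      by (simp add: sum_distrib_left)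
    also have "\<dots> = ?c * (Lval q l (nth_part nu) s * kappa q l P0)"
      using Suc.IH[OF P0 nu(1) s1 s(2) nu(3)] by simp
    also have "Lval q l (nth_part nu) s = Lval q l x' s" using xnu s1 by (simp add: Lval_def)
    also have "?c * (Lval q l x' s * kappa q l P0)
        = kappa q l P0 * (wgt q l x' (lam(r := lam r - 1)) * Lval q l x' s * stepw q True s r x' (lam(r := lam r - 1)))"
    proof -
      have "wgt q l (nth_part nu) z = wgt q l x' z" for z by (rule wgt_cong) (rule xnu)
      moreover have "stepw q True s r (nth_part nu) z = stepw q True s r x' z" for z
        by (rule stepw_cong) (rule xnu)
      ultimately show ?thesis unfolding wgt_mu stepw_mu by (simp only: mult_ac)
    qed
    also have "wgt q l x' (lam(r := lam r - 1)) * Lval q l x' s * stepw q True s r x' (lam(r := lam r - 1)) = wgt q l x lam * G s"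
    proof (cases "s = r")
      case True
      show ?thesis
        using wgt_same[where x = x and lam = lam and l = l, OF inter r lam_gap] gap s unfolding True G_def A_def x'_def by simp
    next
      case False
      then have "r < s" using s by simp
      moreover have "x r < lam r" using nx(2)[OF r(1)] lam_r xnu[OF r(1)] False by (simp add: x'_def)
      ultimately show ?thesis
        using wgt_above[where x = x and lam = lam and l = l, OF inter r lam_gap] gap s unfolding G_def A_def B_def x'_def by simp
    qed
    finally show ?thesis by (simp add: C_def mult.assoc)
  next
    case False
    have "\<not> plus_e (sh P) s (sh P0)" if "P \<in> F" for P
      using False that sh_partition by (auto simp: F_def)
    then have "(\<Sum>k=1..l. \<Sum>P\<in>F. ?f s k P) = 0" by simp
    \<comment> \<open>By contraposition: if \<open>G s\<close> is nonzero, its factors say that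
      removing the boxes keeps the shapes interlacing, and the required \<open>nu\<close>
      exists.\<close>
    moreover have "G s = 0"
    proof (rule ccontr)
      assume G: "G s \<noteq> 0"
      have s1: "1 \<le> s" using r s by simp
      have A1: "A (s + 1) \<noteq> 1" using G by (auto simp: G_def split: if_splits)
      have gap: "lam (Suc s) < x s"
      proof (rule ccontr)
        assume "\<not> ?thesis"
        then show False using A1 by (simp add: A_def)
      qed
      have cover: "x r < lam r" if "s \<noteq> r"
      proof (rule ccontr)
        assume "\<not> ?thesis"
        then have "B = 1" by (simp add: B_def)
        then show False using G that by (simp add: G_def)
      qed
      define f where "f = x(s := x s - 1)"
      have "f (Suc j) \<le> f j" if "1 \<le> j" for j
        using is_partition_antimono[OF partP(2) that, of "Suc j"] gap inter(2)[of "Suc s"] by (auto simp: f_def x_def)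
      moreover have "f (Suc l) = 0" using length_sh[OF P0] s by (simp add: f_def x_def nth_part_eq_0)
      ultimately obtain nu where nu: "is_partition nu" "\<And>j. 1 \<le> j \<Longrightarrow> nth_part nu j = f j"
        using ex_partition by blast
      have "plus_e nu s (sh P0)" using nu(2) gap by (auto simp: plus_e_def f_def x_def)
      moreover have "hstrip nu mu"
        unfolding hstrip_def
      proof (intro allI impI conjI)
        fix j :: nat assume j: "1 \<le> j"
        have "(lam(r := lam r - 1)) (Suc j) \<le> f j" using inter(1)[OF j] gap by (auto simp: f_def)
        then show "nth_part mu (Suc j) \<le> nth_part nu j" using nu(2)[OF j] mulam[of "Suc j"] by simp
        have "f j \<le> (lam(r := lam r - 1)) j" using inter(2)[OF j] cover by (auto simp: f_def)
        then show "nth_part nu j \<le> nth_part mu j" using nu(2)[OF j] mulam[OF j] by simp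
      qed
      ultimately show False using False nu(1) by blast
    qed
    ultimately show ?thesis by simp
  qed

  have low: "?S k = (\<Sum>s=r..l. \<Sum>P\<in>F. ?f s k P)" if k: "k \<in> {1..l}" for k
  proof -
    have "?S k = (\<Sum>P\<in>F. \<Sum>s=r..l. ?f s k P)"
      unfolding S
    proof (rule sum.cong)
      fix P assume P: "P \<in> F"
      have "plus_e (sh (ext l P mu)) r (sh P')" using pe ext[OF P] by simp
      from q_insert_Suc_sum[OF ext(1)[OF P] Suc.prems(1) _ _ this r(1), of k, unfolded ext(2)[OF P] ext(3)[OF P] P0_def[symmetric]]
      have "q_insert q (Suc l) k (ext l P mu) P' = (\<Sum>s=r..l. if plus_e (sh P) s (sh P0)
         then q_insert q l k P P0 * stepw q True s r (nth_part (sh P)) (nth_part mu) else 0)"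
        using k by simp
      then show "kappa q l P * wgt q l (nth_part (sh P)) (nth_part mu) * q_insert q (Suc l) k (ext l P mu) P'
          = (\<Sum>s=r..l. ?f s k P)"
        by (simp add: sum_distrib_left if_distrib cong: if_cong)
    qed simp
    also have "\<dots> = (\<Sum>s=r..l. \<Sum>P\<in>F. ?f s k P)" by (rule sum.swap)
    finally show ?thesis .
  qed
  have "(\<Sum>k=1..Suc l. ?S k) = (\<Sum>k=1..l. ?S k) + ?S (Suc l)" by simp
  also have "(\<Sum>k=1..l. ?S k) = (\<Sum>k=1..l. \<Sum>s=r..l. \<Sum>P\<in>F. ?f s k P)"
    using low by (rule sum.cong[OF refl])
  also have "\<dots> = (\<Sum>s=r..l. \<Sum>k=1..l. \<Sum>P\<in>F. ?f s k P)" by (rule sum.swap)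
  also have "\<dots> = (\<Sum>s=r..l. C * G s)"
    using level by (intro sum.cong) auto
  also have "\<dots> + ?S (Suc l) = C * ((\<Sum>s=r..l. G s) + H)"
    unfolding top by (simp add: sum_distrib_left distrib_left)
  also have "(\<Sum>s=r..l. G s) + H = Lval q (Suc l) (lam(r := lam r - 1)) r"
  proof (cases "r = Suc l")
    case True then show ?thesis by (simp add: H_def Lval_def)
  next
    case False
    then have "r \<le> l" using r by simp
    have "H = (1 - B) * (\<Prod>t=r+1..Suc l. A t)" using False by (simp only: H_def if_False)
    then show ?thesis
      unfolding G_def A_def B_def
      by (simp only:) (rule sum_levels, use inter r lam_gap \<open>r \<le> l\<close> in auto)
  qed
  also have "\<dots> = Lval q (Suc l) (nth_part mu) r" using mulam r by (simp add: Lval_def)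
  also have "C = kappa q (Suc l) P'" unfolding C_def using kappa_Suc[OF Suc.prems(1)] by (simp add: P0_def x_def lam_def)
  finally show ?case by (simp only: mult.commute)
qed simp

end



subsection \<open>Transition kernels\<close>

lemma L_ker_Lval:
  assumes "plus_e mu r nu" "1 \<le> r" "r \<le> l"
  shows "L_ker q l mu nu = Lval q l (nth_part mu) r"
proof -
  have "L_ker q l mu nu = (\<Sum>i\<in>{1..l}. if i = r then Lval q l (nth_part mu) r else 0)"
    unfolding L_ker_def using assms plus_e_unique by (intro sum.cong) (auto simp: Lval_def)
  then show ?thesis using assms by simp
qed

lemma L_ker_eq_0: "\<not> (\<exists>r\<in>{1..l}. plus_e mu r nu) \<Longrightarrow> L_ker q l mu nu = 0"
  unfolding L_ker_def by (intro sum.neutral) auto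

lemma L_ker_adds_box: "L_ker q l mu nu \<noteq> 0 \<Longrightarrow> adds_box mu nu"
  using L_ker_eq_0 by (fastforce simp: adds_box_def)

lemma weight_Suc:
  assumes "1 \<le> k" "k \<le> l"
  shows "weight l a (mu(k := mu k + 1)) = a k * weight l a mu"
proof -
  have k: "k \<in> {1..l}" using assms by simp
  have "(\<Prod>i\<in>{1..l} - {k}. a i ^ (mu(k := mu k + 1)) i) = (\<Prod>i\<in>{1..l} - {k}. a i ^ mu i)"
    by (rule prod.cong) auto
  then show ?thesis unfolding weight_def prod.remove[OF finite_atLeastAtMost k] by simp
qed

lemma q_insert_weight:
  assumes "1 \<le> k" "k \<le> l"
  shows "a k * weight l a (ty P) * q_insert q l k P P' = weight l a (ty P') * q_insert q l k P P'"
proof (cases "q_insert q l k P P' = 0")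
  case False
  then have "ty P' = (ty P)(k := ty P k + 1)" by (auto simp: q_insert_def split: if_splits)
  then show ?thesis using weight_Suc[OF assms, of a "ty P"] by simp
qed simp

context
  fixes q :: real
  assumes q: "0 \<le> q" "q < 1"
begin

lemma L_ker_nonneg: "0 \<le> L_ker q l mu nu"
  unfolding L_ker_def using power_le_one[of q] q by (intro sum_nonneg) (auto simp del: power_Suc)

text \<open>Along an insertion \<open>a k\<close> times the weight of \<open>P\<close> is the weight
  of \<open>P'\<close>, which leaves the sum; the letters then enter
  \<open>kappa_intertwining\<close> unweighted. If \<open>sh P'\<close> is not \<open>mu\<close>
  plus a box in one of the rows up to \<open>l\<close>, both sides are 0.\<close>

lemma K_intertwining:
  assumes P': "P' \<in> tableaux l" and mu: "is_partition mu"
  shows "(\<Sum>P | P \<in> tableaux l \<and> sh P = mu. weight l a (ty P) * kappa q l P * trans_M q l a P P')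
    = L_ker q l mu (sh P') * (weight l a (ty P') * kappa q l P')"
proof -
  have "weight l a (ty P) * kappa q l P * trans_M q l a P P'
      = (\<Sum>k=1..l. weight l a (ty P') * (kappa q l P * q_insert q l k P P'))" for P
  proof -
    have "weight l a (ty P) * kappa q l P * trans_M q l a P P'
        = (\<Sum>k=1..l. kappa q l P * (a k * weight l a (ty P) * q_insert q l k P P'))"
      unfolding trans_M_def sum_distrib_left by (rule sum.cong) (simp_all only: mult_ac)
    also have "\<dots> = (\<Sum>k=1..l. kappa q l P * (weight l a (ty P') * q_insert q l k P P'))"
      by (rule sum.cong) (simp_all only: q_insert_weight atLeastAtMost_iff)
    finally show ?thesis by (simp only: mult_ac)
  qed
  then have "(\<Sum>P | P \<in> tableaux l \<and> sh P = mu. weight l a (ty P) * kappa q l P * trans_M q l a P P')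
      = (\<Sum>P | P \<in> tableaux l \<and> sh P = mu. \<Sum>k=1..l. weight l a (ty P') * (kappa q l P * q_insert q l k P P'))"
    by simp
  also have "\<dots> = (\<Sum>k=1..l. \<Sum>P | P \<in> tableaux l \<and> sh P = mu. weight l a (ty P') * (kappa q l P * q_insert q l k P P'))"
    by (rule sum.swap)
  also have "\<dots> = weight l a (ty P') * (\<Sum>k=1..l. \<Sum>P | P \<in> tableaux l \<and> sh P = mu. kappa q l P * q_insert q l k P P')"
    by (simp only: sum_distrib_left)
  also have "(\<Sum>k=1..l. \<Sum>P | P \<in> tableaux l \<and> sh P = mu. kappa q l P * q_insert q l k P P')
      = L_ker q l mu (sh P') * kappa q l P'"
  proof (cases "\<exists>r\<in>{1..l}. plus_e mu r (sh P')")
    case True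
    then obtain r where r: "1 \<le> r" "r \<le> l" "plus_e mu r (sh P')" by auto
    show ?thesis unfolding kappa_intertwining[OF q P' mu r] L_ker_Lval[OF r(3,1,2)] ..
  next
    case False
    have "q_insert q l k P P' = 0" if "k \<in> {1..l}" "P \<in> tableaux l" "sh P = mu" for k P
      using q_insert_plus_e[OF that(2) P', of k q] that False by force
    then show ?thesis using L_ker_eq_0[OF False] by simp
  qed
  finally show ?thesis by (simp only: mult_ac)
qed

context
  fixes l :: nat and a :: "nat \<Rightarrow> real"
  assumes a: "\<And>i. i \<in> {1..l} \<Longrightarrow> 0 \<le> a i" "(\<Sum>i=1..l. a i) = 1"
begin

lemma trans_M_nonneg: "P \<in> tableaux l \<Longrightarrow> P' \<in> tableaux l \<Longrightarrow> 0 \<le> trans_M q l a P P'"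
  unfolding trans_M_def using a q_insert_nonneg[OF q] by (intro sum_nonneg mult_nonneg_nonneg) auto

lemma trans_M_has_sum:
  assumes "P \<in> tableaux l" shows "(trans_M q l a P has_sum 1) (tableaux l)"
proof -
  have "((\<lambda>P'. \<Sum>k\<in>{1..l}. a k * q_insert q l k P P') has_sum (\<Sum>k\<in>{1..l}. a k * 1)) (tableaux l)"
    using q_insert_has_sum[OF q assms] by (intro has_sum_sum has_sum_cmult_right) auto
  then show ?thesis using a(2) by (simp add: trans_M_def[abs_def])
qed

lemma trans_M_stochastic: "stochastic_on (tableaux l) (trans_M q l a)"
  unfolding stochastic_on_def using trans_M_nonneg trans_M_has_sum by blast

lemma weight_nonneg: "0 \<le> weight l a mu"
  unfolding weight_def using a by (intro prod_nonneg) auto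

lemma Psi_nonneg: "0 \<le> Psi q l a lam"
  unfolding Psi_def using weight_nonneg kappa_pos[OF q] by (intro sum_nonneg mult_nonneg_nonneg) (auto intro: less_imp_le)

text \<open>The intertwining relation summed over all \<open>P'\<close>: on the left
  \<open>trans_M\<close> has mass 1, on the right grouping by shape produces \<open>Psi\<close>.
  Thus \<open>Psi\<close> is harmonic for \<open>L_ker\<close>.\<close>

lemma Psi_has_sum:
  assumes mu: "mu \<in> Omega l"
  shows "((\<lambda>lam. L_ker q l mu lam * Psi q l a lam) has_sum Psi q l a mu) (Omega l)"
proof -
  let ?w = "\<lambda>P. weight l a (ty P) * kappa q l P"
  have part: "is_partition mu" using mu by (simp add: Omega_def)
  have "((\<lambda>P'. \<Sum>P | P \<in> tableaux l \<and> sh P = mu. ?w P * trans_M q l a P P') has_sum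
      (\<Sum>P | P \<in> tableaux l \<and> sh P = mu. ?w P * 1)) (tableaux l)"
    using trans_M_has_sum by (intro has_sum_sum has_sum_cmult_right) auto
  also have "?this \<longleftrightarrow> ((\<lambda>P'. L_ker q l mu (sh P') * ?w P') has_sum Psi q l a mu) (tableaux l)"
    unfolding Psi_def mult_1_right by (rule has_sum_cong) (simp add: K_intertwining part)
  finally have "((\<lambda>P'. L_ker q l mu (sh P') * ?w P') has_sum Psi q l a mu) (tableaux l)" .
  also have "?this \<longleftrightarrow> ((\<lambda>(lam, P'). L_ker q l mu lam * ?w P') has_sum Psi q l a mu)
      (SIGMA lam:Omega l. {P. P \<in> tableaux l \<and> sh P = lam})"
    by (rule has_sum_reindex_bij_witness[where j = "\<lambda>P. (sh P, P)" and i = snd]) (auto simp: sh_Omega)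
  finally show ?thesis
    by (rule has_sum_SigmaD) (auto simp: Psi_def sum_distrib_left intro!: has_sum_finiteI finite_tableaux_shape)
qed

text \<open>\<open>trans_p\<close> is the Doob transform of \<open>L_ker\<close> by its harmonic
  function \<open>Psi\<close>. Letters of probability 0 can make \<open>Psi\<close> vanish, hence
  the restricted state space.\<close>

lemma trans_p_stochastic: "stochastic_on {mu \<in> Omega l. Psi q l a mu \<noteq> 0} (trans_p q l a)"
  unfolding stochastic_on_def
proof (intro ballI conjI)
  let ?S = "{mu \<in> Omega l. Psi q l a mu \<noteq> 0}"
  fix mu assume mu: "mu \<in> ?S"
  show "0 \<le> trans_p q l a mu lam" for lam
    unfolding trans_p_def using Psi_nonneg L_ker_nonneg by (intro mult_nonneg_nonneg divide_nonneg_nonneg) auto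
  have "((\<lambda>lam. inverse (Psi q l a mu) * (L_ker q l mu lam * Psi q l a lam)) has_sum
      inverse (Psi q l a mu) * Psi q l a mu) (Omega l)"
    using mu by (intro has_sum_cmult_right Psi_has_sum) simp
  \<comment> \<open>Shapes outside the restricted space have \<open>Psi\<close> equal to 0 and
    contribute nothing.\<close>
  also have "?this \<longleftrightarrow> (trans_p q l a mu has_sum inverse (Psi q l a mu) * Psi q l a mu) ?S"
    by (rule has_sum_cong_neutral) (use L_ker_adds_box in \<open>auto simp: trans_p_def divide_inverse\<close>)
  finally show "(trans_p q l a mu has_sum 1) ?S" using mu by simp
qed

end

end

subsection \<open>Standard tableaux\<close>

lemma concat_subtab: "concat (subtab Q n) = filter (\<lambda>x. x \<le> n) (concat Q)"
  unfolding subtab_def by (induction Q) auto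

lemma standard_tableaux_subset: "standard_tableaux n \<subseteq> tableaux n"
proof
  fix Q assume Q: "Q \<in> standard_tableaux n"
  then have "set (concat Q) = {1..n}"
    by (metis (mono_tags, lifting) finite_atLeastAtMost finite_set_mset_mset_set mem_Collect_eq set_mset_mset standard_tableaux_def)
  then show "Q \<in> tableaux n" using Q by (auto simp: standard_tableaux_def tableaux_def)
qed

lemma standard_tableaux_0: "standard_tableaux 0 = {[]}"
  using standard_tableaux_subset[of 0] by (auto simp: tableaux_0 standard_tableaux_def semistandard_def is_partition_def)

lemma size_standard_tableau: "Q \<in> standard_tableaux n \<Longrightarrow> sum_list (sh Q) = n"
  by (simp add: standard_tableaux_def sh_def length_concat[symmetric] size_mset[symmetric] del: size_mset length_concat)

lemma standard_tableaux_subtab: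
  assumes Q: "Q \<in> standard_tableaux (Suc n)" shows "subtab Q n \<in> standard_tableaux n"
proof -
  have "semistandard (subtab Q n)"
    using subtab_tableaux[of Q "Suc n" n] standard_tableaux_subset[of "Suc n"] Q by (auto simp: tableaux_def)
  moreover have "mset (concat (subtab Q n)) = mset_set {x \<in> {1..Suc n}. x \<le> n}"
    using Q by (simp add: concat_subtab standard_tableaux_def filter_mset_mset_set del: mset_concat)
  moreover have "{x \<in> {1..Suc n}. x \<le> n} = {1..n}" by auto
  ultimately show ?thesis by (simp add: standard_tableaux_def)
qed

text \<open>Besides \<open>1..n\<close> there is room for a single entry, and it can only be
  \<open>Suc n\<close>.\<close>

lemma standard_tableaux_Suc_I:
  assumes Q: "Q \<in> tableaux (Suc n)" and Q0: "subtab Q n \<in> standard_tableaux n"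
    and sz: "sum_list (sh Q) = Suc n"
  shows "Q \<in> standard_tableaux (Suc n)"
proof -
  let ?M = "mset (concat Q)"
  have low: "filter_mset (\<lambda>x. x \<le> n) ?M = mset_set {1..n}"
    using Q0 by (simp add: standard_tableaux_def concat_subtab del: mset_concat)
  have M: "?M = filter_mset (\<lambda>x. x \<le> n) ?M + filter_mset (\<lambda>x. \<not> x \<le> n) ?M"
    by (rule multiset_partition)
  have "size ?M = Suc n" using sz by (simp add: sh_def length_concat del: mset_concat)
  then have "size (filter_mset (\<lambda>x. \<not> x \<le> n) ?M) = 1"
    using arg_cong[OF M, of size] low by (simp del: mset_concat)
  then obtain x where x: "filter_mset (\<lambda>x. \<not> x \<le> n) ?M = {#x#}"
    using size_1_singleton_mset by blast
  then have "x \<in># filter_mset (\<lambda>x. \<not> x \<le> n) ?M" by simp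
  then have "x \<in> set (concat Q)" "n < x" by (auto simp del: mset_concat)
  moreover have "set (concat Q) \<subseteq> {1..Suc n}" using Q by (auto simp: tableaux_def)
  ultimately have "x = Suc n" by force
  then have "?M = mset_set {1..n} + {#Suc n#}" using M low x by simp
  also have "\<dots> = mset_set {1..Suc n}" by (simp add: atLeastAtMostSuc_conv)
  finally show ?thesis using Q by (simp add: standard_tableaux_def tableaux_def)
qed

lemma standard_tableaux_bij:
  assumes lam: "is_partition lam" "sum_list lam = Suc n"
  shows "bij_betw (\<lambda>Q. subtab Q n) {Q. Q \<in> standard_tableaux (Suc n) \<and> sh Q = lam}
     {Q. Q \<in> standard_tableaux n \<and> hstrip (sh Q) lam}"
proof (rule bij_betw_byWitness[where f' = "\<lambda>Q. ext n Q lam"])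
  show "\<forall>Q\<in>{Q. Q \<in> standard_tableaux (Suc n) \<and> sh Q = lam}. ext n (subtab Q n) lam = Q"
    using standard_tableaux_subset ext_subtab by blast
  show "\<forall>Q\<in>{Q. Q \<in> standard_tableaux n \<and> hstrip (sh Q) lam}. subtab (ext n Q lam) n = Q"
    using standard_tableaux_subset ext_tableaux lam by blast
  show "(\<lambda>Q. subtab Q n) ` {Q. Q \<in> standard_tableaux (Suc n) \<and> sh Q = lam}
      \<subseteq> {Q. Q \<in> standard_tableaux n \<and> hstrip (sh Q) lam}"
    using standard_tableaux_subset subtab_hstrip standard_tableaux_subtab by blast
  show "(\<lambda>Q. ext n Q lam) ` {Q. Q \<in> standard_tableaux n \<and> hstrip (sh Q) lam}
      \<subseteq> {Q. Q \<in> standard_tableaux (Suc n) \<and> sh Q = lam}"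
  proof safe
    fix Q assume Q: "Q \<in> standard_tableaux n" and h: "hstrip (sh Q) lam"
    show sh: "sh (ext n Q lam) = lam" by (rule sh_ext[OF h])
    have "Q \<in> tableaux n" using Q standard_tableaux_subset by blast
    from ext_tableaux[OF this lam(1) h] show "ext n Q lam \<in> standard_tableaux (Suc n)"
      using Q sh lam(2) by (intro standard_tableaux_Suc_I) auto
  qed
qed

text \<open>The differences of the parts are natural numbers with sum 1.\<close>

lemma hstrip_adds_box:
  assumes h: "hstrip mu lam" and sz: "sum_list lam = Suc (sum_list mu)"
  shows "adds_box mu lam"
proof -
  define N where "N = max (length mu) (length lam)"
  have le: "nth_part mu j \<le> nth_part lam j" if "1 \<le> j" for j using h that by (simp add: hstrip_def)
  have "(\<Sum>j=1..N. nth_part lam j - nth_part mu j) = (\<Sum>j=1..N. nth_part lam j) - (\<Sum>j=1..N. nth_part mu j)"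
    using le by (intro sum_subtractf_nat) auto
  also have "\<dots> = 1" using sz sum_list_nth_part[of lam N] sum_list_nth_part[of mu N] by (simp add: N_def)
  finally have "\<exists>i\<in>{1..N}. nth_part lam i - nth_part mu i = 1 \<and>
      (\<forall>j\<in>{1..N}. i \<noteq> j \<longrightarrow> nth_part lam j - nth_part mu j = 0)"
    by (simp only: sum_eq_1_iff finite_atLeastAtMost)
  then obtain i where i: "1 \<le> i" "nth_part lam i - nth_part mu i = 1"
      "\<And>j. j \<in> {1..N} \<Longrightarrow> i \<noteq> j \<Longrightarrow> nth_part lam j - nth_part mu j = 0" by auto
  have "nth_part lam j = nth_part mu j + (if j = i then 1 else 0)" if "1 \<le> j" for j
  proof (cases "j \<in> {1..N}")
    case True then show ?thesis using le[OF that] i by force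
  next
    case False
    then have "length lam < j" "length mu < j" using that by (auto simp: N_def)
    then have "nth_part lam j = 0" "nth_part mu j = 0" by (auto intro: nth_part_eq_0)
    then show ?thesis using i(2) by auto
  qed
  then show ?thesis using i(1) by (auto simp: adds_box_def plus_e_def)
qed

lemma rho_Suc:
  assumes Q: "Q \<in> tableaux (Suc n)" and pe: "plus_e (sh (subtab Q n)) j (sh Q)" "1 \<le> j"
  shows "rho q (Suc n) Q = rho q n (subtab Q n) * (1 - q ^ (nth_part (sh Q) j - nth_part (sh Q) (j + 1)))"
proof -
  define S where "S n Q = {(i, j). 1 \<le> i \<and> i \<le> n \<and> 1 \<le> j \<and> lev Q i j = lev Q (i - 1) j + 1}" for n Q
  \<comment> \<open>The row index in \<open>rho\<close> is unbounded; a gained box has to lie in one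
    of the rows of \<open>Q\<close>.\<close>
  have fin: "finite (S n Q)" for n Q
  proof (rule finite_subset)
    show "finite ({1..n} \<times> {1..length Q})" by simp
    show "S n Q \<subseteq> {1..n} \<times> {1..length Q}"
    proof safe
      fix i j assume "(i, j) \<in> S n Q"
      then have "1 \<le> i" "i \<le> n" "1 \<le> j" "0 < lev Q i j" by (auto simp: S_def)
      moreover have "length (sh (subtab Q i)) \<le> length Q"
        unfolding sh_def subtab_def by (metis length_filter_le length_map)
      ultimately show "i \<in> {1..n}" "j \<in> {1..length Q}"
        by (auto simp: lev_def nth_part_def split: if_splits)
    qed
  qed
  have lev: "lev (subtab Q n) i = lev Q i" if "i \<le> n" for i using that by (rule lev_subtab)
  have S0: "S n (subtab Q n) = S n Q" unfolding S_def using lev by auto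
  have top: "lev Q (Suc n) j' = lev Q n j' + 1 \<longleftrightarrow> j' = j" if "1 \<le> j'" for j'
    using pe(1) that by (simp add: lev_top_fun[OF Q] lev_shape[of Q n] plus_e_def)
  have S: "S (Suc n) Q = insert (Suc n, j) (S n Q)"
    using top pe(2) by (auto simp: S_def le_Suc_eq)
  have "(Suc n, j) \<notin> S n Q" by (simp add: S_def)
  then have "(\<Prod>(i, j)\<in>S (Suc n) Q. 1 - q ^ (lev Q i j - lev Q i (j + 1)))
      = (\<Prod>(i, j)\<in>S n Q. 1 - q ^ (lev Q i j - lev Q i (j + 1))) * (1 - q ^ (lev Q (Suc n) j - lev Q (Suc n) (j + 1)))"
    unfolding S by (simp add: fin)
  also have "(\<Prod>(i, j)\<in>S n Q. 1 - q ^ (lev Q i j - lev Q i (j + 1)))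
      = (\<Prod>(i, j)\<in>S n (subtab Q n). 1 - q ^ (lev (subtab Q n) i j - lev (subtab Q n) i (j + 1)))"
    unfolding S0 by (rule prod.cong) (auto simp: S_def lev)
  finally show ?thesis unfolding rho_def S_def[symmetric] by (simp add: lev_top[OF Q])
qed

lemma finite_adds_box: "finite {mu. is_partition mu \<and> adds_box mu lam}"
proof (rule finite_subset[OF _ finite_partitions[of "sum_list lam - 1"]])
  show "{mu. is_partition mu \<and> adds_box mu lam} \<subseteq> {mu. is_partition mu \<and> sum_list mu = sum_list lam - 1}"
    using plus_e_sum_list by (fastforce simp: adds_box_def)
qed

lemma L_ker_box:
  assumes pe: "plus_e mu j lam" "1 \<le> j" "j < N" and mu: "is_partition mu"
  shows "L_ker q N mu lam = 1 - q ^ (nth_part lam j - nth_part lam (j + 1))"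
proof -
  have "nth_part lam j = nth_part mu j + 1" "nth_part lam (j + 1) = nth_part mu (j + 1)"
    using pe by (auto simp: plus_e_def)
  moreover have "nth_part mu (j + 1) \<le> nth_part mu j" using is_partition_antimono[OF mu] pe(2) by simp
  ultimately show ?thesis using L_ker_Lval[OF pe(1,2), of N q] pe(3) by (simp add: Lval_def Suc_diff_le)
qed

text \<open>For \<open>N > length lam\<close> no box is added in row \<open>N\<close>, so \<open>L_ker q N\<close> has the factors of
  \<open>rho\<close>.\<close>

lemma f_lambda_Suc:
  assumes lam: "is_partition lam" "sum_list lam = Suc n" and N: "length lam < N"
  shows "f_lambda q lam = (\<Sum>mu | is_partition mu \<and> adds_box mu lam. L_ker q N mu lam * f_lambda q mu)"
proof -
  define B where "B = {Q. Q \<in> standard_tableaux n \<and> hstrip (sh Q) lam}"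
  define MU where "MU = {mu. is_partition mu \<and> adds_box mu lam}"
  have part: "is_partition (sh Q)" if "Q \<in> standard_tableaux n" for Q
    using that standard_tableaux_subset sh_partition by blast
  have "{Q. Q \<in> standard_tableaux (Suc n) \<and> sh Q = lam} \<subseteq> {Q. Q \<in> tableaux (Suc n) \<and> sh Q = lam}"
    using standard_tableaux_subset by blast
  then have "finite {Q. Q \<in> standard_tableaux (Suc n) \<and> sh Q = lam}"
    using finite_tableaux_shape finite_subset by blast
  then have finB: "finite B"
    using bij_betw_finite[OF standard_tableaux_bij[OF lam]] by (simp add: B_def)
  have B_MU: "sh Q \<in> MU" if "Q \<in> B" for Q
    using that part hstrip_adds_box size_standard_tableau lam(2) by (auto simp: B_def MU_def)
  \<comment> \<open>Adding one box is a horizontal strip, so \<open>mu \<in> MU\<close> already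
    implies the strip condition of \<open>B\<close>.\<close>
  have fib: "{Q \<in> B. sh Q = mu} = {Q. Q \<in> standard_tableaux n \<and> sh Q = mu}" if "mu \<in> MU" for mu
    using that plus_e_hstrip lam(1) by (auto simp: B_def MU_def adds_box_def)
  have "f_lambda q lam = (\<Sum>Q | Q \<in> standard_tableaux (Suc n) \<and> sh Q = lam. L_ker q N (sh (subtab Q n)) lam * rho q n (subtab Q n))"
    unfolding f_lambda_def lam(2)
  proof (rule sum.cong)
    fix Q assume Q: "Q \<in> {Q. Q \<in> standard_tableaux (Suc n) \<and> sh Q = lam}"
    then have T: "Q \<in> tableaux (Suc n)" using standard_tableaux_subset by blast
    have "subtab Q n \<in> B" using Q bij_betwE[OF standard_tableaux_bij[OF lam]] by (auto simp: B_def)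
    then have "sh (subtab Q n) \<in> MU" using B_MU by blast
    then obtain j where j: "1 \<le> j" "plus_e (sh (subtab Q n)) j lam" and mu: "is_partition (sh (subtab Q n))"
      by (auto simp: MU_def adds_box_def)
    have "0 < nth_part lam j" using j by (simp add: plus_e_def)
    then have "j < N" using N by (auto simp: nth_part_def split: if_splits)
    then show "rho q (Suc n) Q = L_ker q N (sh (subtab Q n)) lam * rho q n (subtab Q n)"
      using rho_Suc[OF T, of j q] j Q L_ker_box[OF j(2,1) _ mu, of N q] by simp
  qed simp
  also have "\<dots> = (\<Sum>Q\<in>B. L_ker q N (sh Q) lam * rho q n Q)"
    unfolding B_def by (rule sum.reindex_bij_betw[OF standard_tableaux_bij[OF lam], of "\<lambda>Q. L_ker q N (sh Q) lam * rho q n Q"])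
  also have "\<dots> = (\<Sum>mu\<in>MU. \<Sum>Q\<in>{Q \<in> B. sh Q = mu}. L_ker q N (sh Q) lam * rho q n Q)"
    using finB finite_adds_box[of lam] B_MU by (intro sum.group[symmetric]) (auto simp: MU_def)
  also have "\<dots> = (\<Sum>mu\<in>MU. L_ker q N mu lam * f_lambda q mu)"
  proof (rule sum.cong)
    fix mu assume mu: "mu \<in> MU"
    then have "sum_list mu = n" using lam(2) plus_e_sum_list by (force simp: MU_def adds_box_def)
    then show "(\<Sum>Q\<in>{Q \<in> B. sh Q = mu}. L_ker q N (sh Q) lam * rho q n Q) = L_ker q N mu lam * f_lambda q mu"
      unfolding fib[OF mu] f_lambda_def by (simp add: sum_distrib_left)
  qed simp
  finally show ?thesis by (simp add: MU_def)
qed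

lemma f_lambda_Nil: "f_lambda q [] = 1"
proof -
  have "{Q. Q \<in> standard_tableaux 0 \<and> sh Q = []} = {[]}" by (auto simp: standard_tableaux_0 sh_def)
  moreover have "rho q 0 [] = 1" by (simp add: rho_def prod.neutral)
  ultimately show ?thesis by (simp add: f_lambda_def)
qed

text \<open>For shapes with at most \<open>l\<close> parts, \<open>L_ker q (Suc l)\<close> and
  \<open>L_ker q l\<close> differ only for a box in row \<open>l\<close>. There the former is
  \<open>1 - q ^ nth_part lam l\<close> and the latter 1, which is the ratio of the two normalizing
  symbols.\<close>

lemma f_lambda_normalized_Suc:
  assumes q: "0 \<le> q" "q < 1" and l: "1 \<le> l"
    and lam: "is_partition lam" "sum_list lam = Suc n" "length lam \<le> l"
  shows "f_lambda q lam / qpoch q (nth_part lam l) =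
    (\<Sum>mu | is_partition mu \<and> adds_box mu lam. L_ker q l mu lam * (f_lambda q mu / qpoch q (nth_part mu l)))"
proof -
  have "L_ker q (Suc l) mu lam / qpoch q (nth_part lam l) = L_ker q l mu lam / qpoch q (nth_part mu l)"
    if mu: "is_partition mu" and box: "adds_box mu lam" for mu
  proof -
    obtain j where j: "1 \<le> j" "plus_e mu j lam" using box by (auto simp: adds_box_def)
    have "0 < nth_part lam j" using j by (simp add: plus_e_def)
    then have jl: "j \<le> l" using lam(3) by (auto simp: nth_part_def split: if_splits)
    have 1: "L_ker q (Suc l) mu lam = 1 - q ^ (nth_part lam j - nth_part lam (j + 1))"
      using L_ker_box[OF j(2,1) _ mu] jl by simp
    show ?thesis
    proof (cases "j = l")
      case True
      have "nth_part lam l = Suc (nth_part mu l)" "nth_part lam (l + 1) = 0"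
        using j True lam(3) by (auto simp: plus_e_def nth_part_eq_0)
      moreover have "L_ker q l mu lam = 1" using L_ker_Lval[OF j(2,1) jl] True by (simp add: Lval_def)
      moreover have "1 - q ^ Suc (nth_part mu l) \<noteq> 0" by (rule one_minus_power_nz[OF q]) simp
      ultimately show ?thesis using 1 True qpoch_pos[OF q, of "nth_part mu l"] by (simp add: qpoch_Suc)
    next
      case False
      then show ?thesis using 1 L_ker_box[OF j(2,1) _ mu, of l q] jl j(2) l by (simp add: plus_e_def)
    qed
  qed
  then have "L_ker q (Suc l) mu lam * f_lambda q mu / qpoch q (nth_part lam l)
      = L_ker q l mu lam * (f_lambda q mu / qpoch q (nth_part mu l))"
    if "is_partition mu \<and> adds_box mu lam" for mu
    using that by (simp add: divide_inverse mult_ac)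
  then show ?thesis
    using f_lambda_Suc[OF lam(1,2), of "Suc l" q] lam(3) by (simp add: sum_divide_distrib)
qed



subsection \<open>The q-insertion process\<close>

lemma (in prob_space) prob_has_sum_fibres:
  fixes X :: "'a \<Rightarrow> 'c::countable"
  assumes [measurable]: "X \<in> M \<rightarrow>\<^sub>M count_space UNIV" "Measurable.pred M A"
  shows "((\<lambda>c. \<P>(\<omega> in M. A \<omega> \<and> X \<omega> = c)) has_sum \<P>(\<omega> in M. A \<omega>)) UNIV"
proof -
  define E where "E n = {\<omega> \<in> space M. A \<omega> \<and> to_nat (X \<omega>) = n}" for n
  have "(\<lambda>n. prob (E n)) sums prob (\<Union>n. E n)"
    by (rule finite_measure_UNION) (auto simp: E_def disjoint_family_on_def)
  also have "(\<Union>n. E n) = {\<omega> \<in> space M. A \<omega>}" by (auto simp: E_def)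
  finally have "((\<lambda>n. prob (E n)) has_sum \<P>(\<omega> in M. A \<omega>)) UNIV"
    by (rule sums_nonneg_imp_has_sum) simp
  also have "?this \<longleftrightarrow> ((\<lambda>n. prob (E n)) has_sum \<P>(\<omega> in M. A \<omega>)) (range (to_nat :: 'c \<Rightarrow> nat))"
  proof (rule has_sum_cong_neutral)
    fix n assume "n \<in> UNIV - range (to_nat :: 'c \<Rightarrow> nat)"
    then have "E n = {}" by (auto simp: E_def)
    then show "prob (E n) = 0" by simp
  qed auto
  also have "\<dots> \<longleftrightarrow> ((\<lambda>c. prob (E (to_nat c))) has_sum \<P>(\<omega> in M. A \<omega>)) (UNIV :: 'c set)"
    by (subst has_sum_reindex) (auto simp: o_def)
  finally show ?thesis by (simp add: E_def)
qed

text \<open>A means to forget information: a relation valid for each value of a countable variable,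
  such as the past letters, can be summed when \<open>K\<close> does not depend on the
  value.\<close>

lemma (in prob_space) prob_eq_cmult_fibres:
  fixes X :: "'a \<Rightarrow> 'c::countable"
  assumes X: "X \<in> M \<rightarrow>\<^sub>M count_space UNIV" and A: "Measurable.pred M A" and B: "Measurable.pred M B"
    and eq: "\<And>c. \<P>(\<omega> in M. A \<omega> \<and> X \<omega> = c) = K * \<P>(\<omega> in M. B \<omega> \<and> X \<omega> = c)"
  shows "\<P>(\<omega> in M. A \<omega>) = K * \<P>(\<omega> in M. B \<omega>)"
  using has_sum_unique[OF prob_has_sum_fibres[OF X A, unfolded eq] has_sum_cmult_right[OF prob_has_sum_fibres[OF X B]]] .

lemma (in prob_space) prob_sum_fibres:
  fixes X :: "'a \<Rightarrow> 'c::countable"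
  assumes X: "X \<in> M \<rightarrow>\<^sub>M count_space UNIV" and A: "Measurable.pred M A" and F: "finite F"
    and zero: "\<And>c. c \<notin> F \<Longrightarrow> \<P>(\<omega> in M. A \<omega> \<and> X \<omega> = c) = 0"
  shows "\<P>(\<omega> in M. A \<omega>) = (\<Sum>c\<in>F. \<P>(\<omega> in M. A \<omega> \<and> X \<omega> = c))"
proof -
  have "((\<lambda>c. \<P>(\<omega> in M. A \<omega> \<and> X \<omega> = c)) has_sum (\<Sum>c\<in>F. \<P>(\<omega> in M. A \<omega> \<and> X \<omega> = c))) UNIV"
    using F zero by (intro has_sum_finite_neutralI[of F]) auto
  from has_sum_unique[OF prob_has_sum_fibres[OF X A] this] show ?thesis .
qed

lemma measurable_map_count_space:
  fixes X :: "nat \<Rightarrow> 'a \<Rightarrow> 'c::countable"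
  assumes "\<And>i. i \<in> set is \<Longrightarrow> X i \<in> M \<rightarrow>\<^sub>M count_space UNIV"
  shows "(\<lambda>\<omega>. map (\<lambda>i. X i \<omega>) is) \<in> M \<rightarrow>\<^sub>M count_space UNIV"
  using assms
proof (induction "is")
  case (Cons i js)
  have "(\<lambda>\<omega>. X i \<omega> # map (\<lambda>i. X i \<omega>) js) \<in> M \<rightarrow>\<^sub>M count_space UNIV"
  proof (rule measurable_compose_countable[where f = "\<lambda>c \<omega>. X i \<omega> # c"])
    show "(\<lambda>\<omega>. map (\<lambda>i. X i \<omega>) js) \<in> M \<rightarrow>\<^sub>M count_space UNIV" using Cons by simp
    show "(\<lambda>\<omega>. X i \<omega> # c) \<in> M \<rightarrow>\<^sub>M count_space UNIV" for c
      using Cons.prems by (intro measurable_compose[of "X i" M "count_space UNIV" "\<lambda>x. x # c"]) auto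
  qed
  then show ?case by simp
qed simp

lemma (in prob_space) prob_eq_I:
  "(\<And>\<omega>. \<omega> \<in> space M \<Longrightarrow> A \<omega> \<longleftrightarrow> B \<omega>) \<Longrightarrow> \<P>(\<omega> in M. A \<omega>) = \<P>(\<omega> in M. B \<omega>)"
  by (rule arg_cong[where f = prob]) auto

lemma (in prob_space) prob_mono_I:
  "Measurable.pred M B \<Longrightarrow> (\<And>\<omega>. \<omega> \<in> space M \<Longrightarrow> A \<omega> \<Longrightarrow> B \<omega>) \<Longrightarrow> \<P>(\<omega> in M. A \<omega>) \<le> \<P>(\<omega> in M. B \<omega>)"
  by (rule finite_measure_mono) auto

locale q_insertion = prob_space M for M :: "'w measure" +
  fixes l :: nat and q :: real and a :: "nat \<Rightarrow> real"
    and w :: "nat \<Rightarrow> 'w \<Rightarrow> nat" and PP :: "nat \<Rightarrow> 'w \<Rightarrow> tableau"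
  assumes l: "1 \<le> l" and q: "0 \<le> q" "q < 1"
    and a_nonneg: "\<And>i. i \<in> {1..l} \<Longrightarrow> 0 \<le> a i" and a_sum: "(\<Sum>i=1..l. a i) = 1"
    and w_measurable: "\<And>m. 1 \<le> m \<Longrightarrow> w m \<in> M \<rightarrow>\<^sub>M count_space UNIV"
    and w_dist: "\<And>m k. 1 \<le> m \<Longrightarrow> k \<in> {1..l} \<Longrightarrow> \<P>(\<omega> in M. w m \<omega> = k) = a k"
    and process: "q_insertion_process M q l w PP"
begin

lemma PP_measurable[measurable]: "PP m \<in> M \<rightarrow>\<^sub>M count_space UNIV"
  using process by (simp add: q_insertion_process_def)

lemma PP_0: "\<omega> \<in> space M \<Longrightarrow> PP 0 \<omega> = []"
  using process by (simp add: q_insertion_process_def)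

lemma sh_PP_measurable[measurable]: "(\<lambda>\<omega>. sh (PP m \<omega>)) \<in> M \<rightarrow>\<^sub>M count_space UNIV"
  by (rule measurable_compose[OF PP_measurable]) simp

lemma past_measurable[measurable]: "Measurable.pred M (\<lambda>\<omega>. \<forall>i<m. PP i \<omega> = h i)"
  by measurable

text \<open>The process gives independence of the past letters and tableaux jointly; the letters are
  summed out.\<close>

lemma letter_fresh:
  assumes m: "1 \<le> m"
  shows "\<P>(\<omega> in M. w m \<omega> = k \<and> (\<forall>i<m. PP i \<omega> = h i)) = \<P>(\<omega> in M. w m \<omega> = k) * \<P>(\<omega> in M. \<forall>i<m. PP i \<omega> = h i)"
proof (rule prob_eq_cmult_fibres)
  note [measurable] = w_measurable[OF m]
  show "(\<lambda>\<omega>. map (\<lambda>i. w i \<omega>) [1..<m]) \<in> M \<rightarrow>\<^sub>M count_space UNIV"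
    using w_measurable by (intro measurable_map_count_space) auto
  show "Measurable.pred M (\<lambda>\<omega>. w m \<omega> = k \<and> (\<forall>i<m. PP i \<omega> = h i))" by measurable
  show "Measurable.pred M (\<lambda>\<omega>. \<forall>i<m. PP i \<omega> = h i)" by measurable
  fix c :: "nat list"
  show "\<P>(\<omega> in M. (w m \<omega> = k \<and> (\<forall>i<m. PP i \<omega> = h i)) \<and> map (\<lambda>i. w i \<omega>) [1..<m] = c)
      = \<P>(\<omega> in M. w m \<omega> = k) * \<P>(\<omega> in M. (\<forall>i<m. PP i \<omega> = h i) \<and> map (\<lambda>i. w i \<omega>) [1..<m] = c)"
  proof (cases "length c = m - 1")
    case False
    then have "map (\<lambda>i. w i \<omega>) [1..<m] \<noteq> c" for \<omega> by (metis length_map length_upt)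
    then show ?thesis by simp
  next
    case True
    define u where "u i = c ! (i - 1)" for i
    have c: "map (\<lambda>i. w i \<omega>) [1..<m] = c \<longleftrightarrow> (\<forall>i\<in>{1..<m}. w i \<omega> = u i)" for \<omega>
    proof -
      have "map u [1..<m] = c" using True by (intro nth_equalityI) (auto simp: u_def)
      then have "map (\<lambda>i. w i \<omega>) [1..<m] = c \<longleftrightarrow> map (\<lambda>i. w i \<omega>) [1..<m] = map u [1..<m]" by simp
      then show ?thesis by auto
    qed
    have "indep_event {\<omega> \<in> space M. w m \<omega> = k}
        {\<omega> \<in> space M. (\<forall>i\<in>{1..<m}. w i \<omega> = u i) \<and> (\<forall>i<m. PP i \<omega> = h i)}"
      using process m by (simp add: q_insertion_process_def)
    then have "prob ({\<omega> \<in> space M. w m \<omega> = k} \<inter> {\<omega> \<in> space M. (\<forall>i\<in>{1..<m}. w i \<omega> = u i) \<and> (\<forall>i<m. PP i \<omega> = h i)})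
      = \<P>(\<omega> in M. w m \<omega> = k) * \<P>(\<omega> in M. (\<forall>i\<in>{1..<m}. w i \<omega> = u i) \<and> (\<forall>i<m. PP i \<omega> = h i))"
      unfolding indep_event_def indep_events_def by (auto simp: UNIV_bool Int_commute mult.commute dest!: spec[of _ UNIV])
    also have "\<P>(\<omega> in M. (\<forall>i\<in>{1..<m}. w i \<omega> = u i) \<and> (\<forall>i<m. PP i \<omega> = h i))
        = \<P>(\<omega> in M. (\<forall>i<m. PP i \<omega> = h i) \<and> map (\<lambda>i. w i \<omega>) [1..<m] = c)"
      unfolding c by (rule prob_eq_I) auto
    also have "{\<omega> \<in> space M. w m \<omega> = k} \<inter> {\<omega> \<in> space M. (\<forall>i\<in>{1..<m}. w i \<omega> = u i) \<and> (\<forall>i<m. PP i \<omega> = h i)}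
        = {\<omega> \<in> space M. (w m \<omega> = k \<and> (\<forall>i<m. PP i \<omega> = h i)) \<and> map (\<lambda>i. w i \<omega>) [1..<m] = c}"
      unfolding c by auto
    finally show ?thesis .
  qed
qed

text \<open>The kernel sees only the present letter and the last tableau, so the earlier letters can
  be summed out. The product form also covers pasts of probability 0, where no conditional law is
  prescribed.\<close>

lemma insertion_step:
  assumes m: "1 \<le> m" and P': "P' \<in> tableaux l"
  shows "\<P>(\<omega> in M. PP m \<omega> = P' \<and> w m \<omega> = k \<and> (\<forall>i<m. PP i \<omega> = h i))
    = q_insert q l k (h (m - 1)) P' * \<P>(\<omega> in M. w m \<omega> = k \<and> (\<forall>i<m. PP i \<omega> = h i))"
proof (rule prob_eq_cmult_fibres)
  note [measurable] = w_measurable[OF m]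
  show "(\<lambda>\<omega>. map (\<lambda>i. w i \<omega>) [1..<m]) \<in> M \<rightarrow>\<^sub>M count_space UNIV"
    using w_measurable by (intro measurable_map_count_space) auto
  show "Measurable.pred M (\<lambda>\<omega>. PP m \<omega> = P' \<and> w m \<omega> = k \<and> (\<forall>i<m. PP i \<omega> = h i))" by measurable
  show "Measurable.pred M (\<lambda>\<omega>. w m \<omega> = k \<and> (\<forall>i<m. PP i \<omega> = h i))" by measurable
  fix c :: "nat list"
  show "\<P>(\<omega> in M. (PP m \<omega> = P' \<and> w m \<omega> = k \<and> (\<forall>i<m. PP i \<omega> = h i)) \<and> map (\<lambda>i. w i \<omega>) [1..<m] = c)
      = q_insert q l k (h (m - 1)) P' *
        \<P>(\<omega> in M. (w m \<omega> = k \<and> (\<forall>i<m. PP i \<omega> = h i)) \<and> map (\<lambda>i. w i \<omega>) [1..<m] = c)"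
  proof (cases "length c = m - 1")
    case False
    then have "map (\<lambda>i. w i \<omega>) [1..<m] \<noteq> c" for \<omega> by (metis length_map length_upt)
    then show ?thesis by simp
  next
    case True
    define u where "u i = (if i = m then k else c ! (i - 1))" for i
    have c: "w m \<omega> = k \<and> map (\<lambda>i. w i \<omega>) [1..<m] = c \<longleftrightarrow> (\<forall>i\<in>{1..m}. w i \<omega> = u i)" for \<omega>
    proof -
      have "map u [1..<m] = c" using True by (intro nth_equalityI) (auto simp: u_def)
      then have "map (\<lambda>i. w i \<omega>) [1..<m] = c \<longleftrightarrow> map (\<lambda>i. w i \<omega>) [1..<m] = map u [1..<m]" by simp
      also have "\<dots> \<longleftrightarrow> (\<forall>i\<in>{1..<m}. w i \<omega> = u i)" by auto
      moreover have "{1..m} = insert m {1..<m}" using m by auto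
      ultimately show ?thesis by (simp add: u_def)
    qed
    let ?B = "\<lambda>\<omega>. (\<forall>i\<in>{1..m}. w i \<omega> = u i) \<and> (\<forall>i<m. PP i \<omega> = h i)"
    have 1: "\<P>(\<omega> in M. (PP m \<omega> = P' \<and> w m \<omega> = k \<and> (\<forall>i<m. PP i \<omega> = h i)) \<and> map (\<lambda>i. w i \<omega>) [1..<m] = c)
        = \<P>(\<omega> in M. PP m \<omega> = P' \<and> ?B \<omega>)"
      unfolding c[symmetric] by (rule prob_eq_I) auto
    have 2: "\<P>(\<omega> in M. (w m \<omega> = k \<and> (\<forall>i<m. PP i \<omega> = h i)) \<and> map (\<lambda>i. w i \<omega>) [1..<m] = c) = \<P>(\<omega> in M. ?B \<omega>)"
      unfolding c[symmetric] by (rule prob_eq_I) auto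
    have B: "Measurable.pred M ?B"
      using w_measurable by (intro pred_intros_logic pred_intros_finite past_measurable pred_eq_const1[where N = "count_space UNIV"]) auto
    show ?thesis
      unfolding 1 2
    proof (cases "\<P>(\<omega> in M. ?B \<omega>) > 0")
      case True
      then have "\<P>(\<omega> in M. PP m \<omega> = P' \<bar> ?B \<omega>) = q_insert q l (u m) (h (m - 1)) P'"
        using process m P' unfolding q_insertion_process_def by blast
      then show "\<P>(\<omega> in M. PP m \<omega> = P' \<and> ?B \<omega>) = q_insert q l k (h (m - 1)) P' * \<P>(\<omega> in M. ?B \<omega>)"
        using True by (simp add: cond_prob_def u_def field_simps)
    next
      case False
      then have "\<P>(\<omega> in M. ?B \<omega>) = 0" by (simp add: zero_less_measure_iff)
      moreover have "\<P>(\<omega> in M. PP m \<omega> = P' \<and> ?B \<omega>) \<le> \<P>(\<omega> in M. ?B \<omega>)"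
        using B by (rule prob_mono_I) simp
      ultimately show "\<P>(\<omega> in M. PP m \<omega> = P' \<and> ?B \<omega>) = q_insert q l k (h (m - 1)) P' * \<P>(\<omega> in M. ?B \<omega>)"
        by (simp add: measure_le_0_iff)
    qed
  qed
qed

text \<open>The values \<open>a 1, ..., a l\<close> already exhaust the total probability.\<close>

lemma letter_range:
  assumes m: "1 \<le> m" and k: "k \<notin> {1..l}"
  shows "\<P>(\<omega> in M. w m \<omega> = k) = 0"
proof -
  note [measurable] = w_measurable[OF m]
  have "((\<lambda>k. \<P>(\<omega> in M. True \<and> w m \<omega> = k)) has_sum \<P>(\<omega> in M. True)) UNIV"
    by (rule prob_has_sum_fibres) measurable
  then have "((\<lambda>k. \<P>(\<omega> in M. w m \<omega> = k)) has_sum 1) UNIV" by (simp add: prob_space)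
  then have "(\<Sum>k\<in>insert k {1..l}. \<P>(\<omega> in M. w m \<omega> = k)) \<le> 1"
    by (rule finite_sum_le_has_sum) auto
  also have "(\<Sum>k\<in>insert k {1..l}. \<P>(\<omega> in M. w m \<omega> = k)) = \<P>(\<omega> in M. w m \<omega> = k) + 1"
    using k w_dist[OF m] a_sum by simp
  finally show ?thesis by (simp add: measure_le_0_iff)
qed

lemma PP_step_history:
  assumes P': "P' \<in> tableaux l"
  shows "\<P>(\<omega> in M. PP (Suc n) \<omega> = P' \<and> (\<forall>i\<le>n. PP i \<omega> = h i))
    = trans_M q l a (h n) P' * \<P>(\<omega> in M. \<forall>i\<le>n. PP i \<omega> = h i)"
proof -
  let ?m = "Suc n"
  have m: "1 \<le> ?m" by simp
  note [measurable] = w_measurable[OF m]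
  let ?A = "\<lambda>\<omega>. PP ?m \<omega> = P' \<and> (\<forall>i<?m. PP i \<omega> = h i)"
  have fib: "\<P>(\<omega> in M. ?A \<omega> \<and> w ?m \<omega> = k)
      = q_insert q l k (h n) P' * (\<P>(\<omega> in M. w ?m \<omega> = k) * \<P>(\<omega> in M. \<forall>i<?m. PP i \<omega> = h i))" for k
  proof -
    have "\<P>(\<omega> in M. ?A \<omega> \<and> w ?m \<omega> = k) = \<P>(\<omega> in M. PP ?m \<omega> = P' \<and> w ?m \<omega> = k \<and> (\<forall>i<?m. PP i \<omega> = h i))"
      by (rule prob_eq_I) auto
    then show ?thesis using insertion_step[OF m P', of k h] letter_fresh[OF m, of k h] by simp
  qed
  have "\<P>(\<omega> in M. ?A \<omega>) = (\<Sum>k\<in>{1..l}. \<P>(\<omega> in M. ?A \<omega> \<and> w ?m \<omega> = k))"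
  proof (rule prob_sum_fibres)
    show "w ?m \<in> M \<rightarrow>\<^sub>M count_space UNIV" by measurable
    show "Measurable.pred M ?A" by measurable
    fix k assume "k \<notin> {1..l}"
    from letter_range[OF m this] show "\<P>(\<omega> in M. ?A \<omega> \<and> w ?m \<omega> = k) = 0"
      unfolding fib by simp
  qed simp
  also have "\<dots> = trans_M q l a (h n) P' * \<P>(\<omega> in M. \<forall>i<?m. PP i \<omega> = h i)"
    unfolding trans_M_def sum_distrib_right fib by (rule sum.cong) (simp_all add: w_dist)
  finally show ?thesis by (simp add: less_Suc_eq_le)
qed

abbreviation hist :: "nat \<Rightarrow> 'w \<Rightarrow> tableau list" where
  "hist n \<omega> \<equiv> map (\<lambda>i. PP i \<omega>) [0..<Suc n]"

lemma hist_measurable[measurable]: "hist n \<in> M \<rightarrow>\<^sub>M count_space UNIV"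
  by (rule measurable_map_count_space) simp

lemma hist_pred[measurable]: "Measurable.pred M (\<lambda>\<omega>. \<phi> (hist n \<omega>))"
  by (rule measurable_compose[OF hist_measurable]) simp

lemma hist_eq_iff: "length c = Suc n \<Longrightarrow> hist n \<omega> = c \<longleftrightarrow> (\<forall>i\<le>n. PP i \<omega> = c ! i)"
  by (auto simp: list_eq_iff_nth_eq less_Suc_eq_le simp del: upt_Suc)

text \<open>The Markov property with an arbitrary event \<open>\<phi>\<close> of the past; it is
  applied with \<open>\<phi>\<close> prescribing only the past shapes.\<close>

lemma PP_step:
  assumes P': "P' \<in> tableaux l"
  shows "\<P>(\<omega> in M. PP (Suc n) \<omega> = P' \<and> PP n \<omega> = P \<and> \<phi> (hist n \<omega>))
    = trans_M q l a P P' * \<P>(\<omega> in M. PP n \<omega> = P \<and> \<phi> (hist n \<omega>))"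
proof (rule prob_eq_cmult_fibres[OF hist_measurable[of n]])
  fix c :: "tableau list"
  show "\<P>(\<omega> in M. (PP (Suc n) \<omega> = P' \<and> PP n \<omega> = P \<and> \<phi> (hist n \<omega>)) \<and> hist n \<omega> = c)
      = trans_M q l a P P' * \<P>(\<omega> in M. (PP n \<omega> = P \<and> \<phi> (hist n \<omega>)) \<and> hist n \<omega> = c)"
  proof (cases "length c = Suc n \<and> c ! n = P \<and> \<phi> c")
    case True
    then have c: "hist n \<omega> = c \<longleftrightarrow> (\<forall>i\<le>n. PP i \<omega> = c ! i)" for \<omega> by (simp only: hist_eq_iff)
    have "\<P>(\<omega> in M. (PP (Suc n) \<omega> = P' \<and> PP n \<omega> = P \<and> \<phi> (hist n \<omega>)) \<and> hist n \<omega> = c)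
        = \<P>(\<omega> in M. PP (Suc n) \<omega> = P' \<and> (\<forall>i\<le>n. PP i \<omega> = c ! i))"
      using True by (intro prob_eq_I) (metis c order_refl)
    moreover have "\<P>(\<omega> in M. (PP n \<omega> = P \<and> \<phi> (hist n \<omega>)) \<and> hist n \<omega> = c) = \<P>(\<omega> in M. \<forall>i\<le>n. PP i \<omega> = c ! i)"
      using True by (intro prob_eq_I) (metis c order_refl)
    ultimately show ?thesis using PP_step_history[OF P', of n "\<lambda>i. c ! i"] True by simp
  next
    case False
    have "\<not> (PP n \<omega> = P \<and> \<phi> (hist n \<omega>) \<and> hist n \<omega> = c)" for \<omega>
    proof
      assume *: "PP n \<omega> = P \<and> \<phi> (hist n \<omega>) \<and> hist n \<omega> = c"
      then have len: "length c = Suc n" by auto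
      then have "c ! n = PP n \<omega>" using hist_eq_iff[OF len, of \<omega>] * by (simp del: upt_Suc)
      then show False using False * len by auto
    qed
    then have "\<not> ((PP n \<omega> = P \<and> \<phi> (hist n \<omega>)) \<and> hist n \<omega> = c)"
      "\<not> ((PP (Suc n) \<omega> = P' \<and> PP n \<omega> = P \<and> \<phi> (hist n \<omega>)) \<and> hist n \<omega> = c)" for \<omega> by blast+
    then show ?thesis by (simp only: simp_thms) simp
  qed
qed measurable

lemma tableau_Nil: "[] \<in> tableaux l"
  by (simp add: tableaux_def semistandard_def is_partition_def)

text \<open>The process prescribes conditional probabilities only for values in
  \<open>tableaux l\<close>. Since the kernel has mass 1 there, nothing is left for other
  values.\<close>

lemma prob_outside_tableaux: "\<P>(\<omega> in M. PP n \<omega> = c) = 0" if "c \<notin> tableaux l" for c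
  using that
proof (induction n arbitrary: c)
  case 0
  have "PP 0 \<omega> \<noteq> c" if "\<omega> \<in> space M" for \<omega> using 0 PP_0[OF that] tableau_Nil by auto
  then have "{\<omega> \<in> space M. PP 0 \<omega> = c} = {}" by auto
  then show ?case by (simp only: measure_empty)
next
  case (Suc n)
  have null: "\<P>(\<omega> in M. PP (Suc n) \<omega> \<notin> tableaux l \<and> PP n \<omega> = P) = 0" for P
  proof (cases "P \<in> tableaux l")
    case False
    have "\<P>(\<omega> in M. PP (Suc n) \<omega> \<notin> tableaux l \<and> PP n \<omega> = P) \<le> \<P>(\<omega> in M. PP n \<omega> = P)"
      by (rule prob_mono_I) auto
    then show ?thesis using Suc.IH[OF False] by (simp add: measure_le_0_iff)
  next
    case True
    have "((\<lambda>c. \<P>(\<omega> in M. (PP (Suc n) \<omega> \<in> tableaux l \<and> PP n \<omega> = P) \<and> PP (Suc n) \<omega> = c)) has_sum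
        \<P>(\<omega> in M. PP (Suc n) \<omega> \<in> tableaux l \<and> PP n \<omega> = P)) UNIV"
      by (rule prob_has_sum_fibres) measurable
    also have "?this \<longleftrightarrow> ((\<lambda>c. trans_M q l a P c * \<P>(\<omega> in M. PP n \<omega> = P)) has_sum
        \<P>(\<omega> in M. PP (Suc n) \<omega> \<in> tableaux l \<and> PP n \<omega> = P)) (tableaux l)"
    proof (rule has_sum_cong_neutral)
      fix c assume "c \<in> UNIV - tableaux l"
      then have "\<not> ((PP (Suc n) \<omega> \<in> tableaux l \<and> PP n \<omega> = P) \<and> PP (Suc n) \<omega> = c)" for \<omega> by auto
      then show "\<P>(\<omega> in M. (PP (Suc n) \<omega> \<in> tableaux l \<and> PP n \<omega> = P) \<and> PP (Suc n) \<omega> = c) = 0"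
        by (simp only: simp_thms) simp
    next
      fix c assume c: "c \<in> UNIV \<inter> tableaux l"
      have "\<P>(\<omega> in M. (PP (Suc n) \<omega> \<in> tableaux l \<and> PP n \<omega> = P) \<and> PP (Suc n) \<omega> = c)
          = \<P>(\<omega> in M. PP (Suc n) \<omega> = c \<and> PP n \<omega> = P \<and> True)"
        using c by (intro prob_eq_I) auto
      then show "\<P>(\<omega> in M. (PP (Suc n) \<omega> \<in> tableaux l \<and> PP n \<omega> = P) \<and> PP (Suc n) \<omega> = c)
          = trans_M q l a P c * \<P>(\<omega> in M. PP n \<omega> = P)"
        using PP_step[of c n P "\<lambda>_. True"] c by simp
    qed simp
    finally have "\<P>(\<omega> in M. PP (Suc n) \<omega> \<in> tableaux l \<and> PP n \<omega> = P) = 1 * \<P>(\<omega> in M. PP n \<omega> = P)"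
      using has_sum_unique has_sum_cmult_left[OF trans_M_has_sum[OF q a_nonneg a_sum True]] by blast
    moreover have "\<P>(\<omega> in M. PP n \<omega> = P) = \<P>(\<omega> in M. PP (Suc n) \<omega> \<in> tableaux l \<and> PP n \<omega> = P)
        + \<P>(\<omega> in M. PP (Suc n) \<omega> \<notin> tableaux l \<and> PP n \<omega> = P)"
      by (subst finite_measure_Union[symmetric]) (auto intro!: arg_cong[where f = prob])
    ultimately show ?thesis by simp
  qed
  have "\<P>(\<omega> in M. PP (Suc n) \<omega> \<notin> tableaux l) = (\<Sum>P\<in>{}. \<P>(\<omega> in M. PP (Suc n) \<omega> \<notin> tableaux l \<and> PP n \<omega> = P))"
  proof (rule prob_sum_fibres[OF PP_measurable])
    show "Measurable.pred M (\<lambda>\<omega>. PP (Suc n) \<omega> \<notin> tableaux l)" by measurable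
  qed (simp_all add: null)
  moreover have "\<P>(\<omega> in M. PP (Suc n) \<omega> = c) \<le> \<P>(\<omega> in M. PP (Suc n) \<omega> \<notin> tableaux l)"
    using Suc.prems by (intro prob_mono_I) auto
  ultimately show ?case by (simp add: measure_le_0_iff)
qed

lemma PP_not_tableaux: "\<P>(\<omega> in M. PP n \<omega> \<notin> tableaux l) = 0"
proof -
  have "\<P>(\<omega> in M. PP n \<omega> \<notin> tableaux l) = (\<Sum>c\<in>{}. \<P>(\<omega> in M. PP n \<omega> \<notin> tableaux l \<and> PP n \<omega> = c))"
  proof (rule prob_sum_fibres)
    fix c
    have "\<P>(\<omega> in M. PP n \<omega> \<notin> tableaux l \<and> PP n \<omega> = c) \<le> (if c \<in> tableaux l then 0 else \<P>(\<omega> in M. PP n \<omega> = c))"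
    proof (cases "c \<in> tableaux l")
      case True
      then have "\<not> (PP n \<omega> \<notin> tableaux l \<and> PP n \<omega> = c)" for \<omega> by auto
      then show ?thesis using True by (simp only: simp_thms) simp
    next
      case False
      then show ?thesis by (auto intro: prob_mono_I)
    qed
    then show "\<P>(\<omega> in M. PP n \<omega> \<notin> tableaux l \<and> PP n \<omega> = c) = 0"
      using prob_outside_tableaux[of c n] by (auto simp: measure_le_0_iff split: if_splits)
  qed measurable
  then show ?thesis by simp
qed

lemma AE_PP: "AE \<omega> in M. PP n \<omega> \<in> tableaux l"
  using PP_not_tableaux[of n] by (simp add: prob_eq_0)

theorem PP_markov_chain: "markov_chain M (tableaux l) PP (trans_M q l a)"
  unfolding markov_chain_def
proof (intro conjI allI impI)
  fix n h y assume "y \<in> tableaux l" "\<P>(\<omega> in M. \<forall>i\<le>n. PP i \<omega> = h i) > 0"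
  then show "\<P>(\<omega> in M. PP (Suc n) \<omega> = y \<bar> \<forall>i\<le>n. PP i \<omega> = h i) = trans_M q l a (h n) y"
    by (simp add: cond_prob_def PP_step_history)
qed (use AE_PP in auto)

lemma prob_PP_split:
  assumes A: "Measurable.pred M A" and F: "finite {P \<in> tableaux l. S P}"
    and S: "\<And>\<omega>. \<omega> \<in> space M \<Longrightarrow> A \<omega> \<Longrightarrow> S (PP n \<omega>)"
  shows "\<P>(\<omega> in M. A \<omega>) = (\<Sum>P | P \<in> tableaux l \<and> S P. \<P>(\<omega> in M. A \<omega> \<and> PP n \<omega> = P))"
proof (rule prob_sum_fibres[OF PP_measurable A F])
  fix P assume P: "P \<notin> {P \<in> tableaux l. S P}"
  show "\<P>(\<omega> in M. A \<omega> \<and> PP n \<omega> = P) = 0"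
  proof (cases "S P")
    case True
    then have "P \<notin> tableaux l" using P by simp
    then have "\<P>(\<omega> in M. PP n \<omega> = P) = 0" by (rule prob_outside_tableaux)
    moreover have "\<P>(\<omega> in M. A \<omega> \<and> PP n \<omega> = P) \<le> \<P>(\<omega> in M. PP n \<omega> = P)"
      by (rule prob_mono_I) auto
    ultimately show ?thesis by (simp add: measure_le_0_iff)
  next
    case False
    then have "{\<omega> \<in> space M. A \<omega> \<and> PP n \<omega> = P} = {}" using S by auto
    then show ?thesis by (simp only: measure_empty)
  qed
qed

section \<open>Joint law of the tableau and the past shapes\<close>

abbreviation shapes :: "nat \<Rightarrow> (nat \<Rightarrow> nat list) \<Rightarrow> 'w \<Rightarrow> bool" where
  "shapes n h \<omega> \<equiv> \<forall>i\<in>{1..n}. sh (PP i \<omega>) = h i"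

lemma shapes_hist: "shapes n h \<omega> \<longleftrightarrow> (\<forall>i\<in>{1..n}. sh (hist n \<omega> ! i) = h i)"
  by (auto simp: less_Suc_eq_le simp del: upt_Suc)

lemma shapes_measurable[measurable]: "Measurable.pred M (shapes n h)"
  unfolding shapes_hist by (rule hist_pred)

lemma kappa_Nil: "kappa q l [] = 1"
  by (simp add: kappa_def lev_def subtab_def sh_def nth_part_def qpoch_def)

lemma weight_Nil: "weight l a (ty []) = 1"
  by (simp add: weight_def ty_def)

lemma PP_0_prob: "\<P>(\<omega> in M. PP 0 \<omega> = P) = of_bool (P = [])"
proof -
  have "{\<omega> \<in> space M. PP 0 \<omega> = P} = (if P = [] then space M else {})" using PP_0 by auto
  then show ?thesis by (simp add: prob_space)
qed

definition path_L :: "nat \<Rightarrow> (nat \<Rightarrow> nat list) \<Rightarrow> real" where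
  "path_L n h = (\<Prod>i<n. L_ker q l (h i) (h (Suc i)))"

text \<open>Summing out the tableau at time \<open>n\<close> over the shape \<open>h n\<close> turns
  one transition \<open>trans_M\<close> into one factor \<open>L_ker\<close>, by
  \<open>K_intertwining\<close>.\<close>

lemma prob_PP_shapes:
  assumes "h 0 = []" "\<And>i. i < n \<Longrightarrow> is_partition (h i)" "P \<in> tableaux l"
  shows "\<P>(\<omega> in M. PP n \<omega> = P \<and> shapes n h \<omega>) = path_L n h * K_weight q l a (h n) P"
  using assms(2,3)
proof (induction n arbitrary: P)
  case 0
  have "sh P = [] \<longleftrightarrow> P = []" by (simp add: sh_def)
  then show ?case
    using assms(1) by (auto simp: PP_0_prob path_L_def K_weight_def kappa_Nil weight_Nil)
next
  case (Suc n)
  note P' = Suc.prems(2)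
  show ?case
  proof (cases "sh P = h (Suc n)")
    case False
    then have "{\<omega> \<in> space M. PP (Suc n) \<omega> = P \<and> shapes (Suc n) h \<omega>} = {}" by auto
    then have "\<P>(\<omega> in M. PP (Suc n) \<omega> = P \<and> shapes (Suc n) h \<omega>) = 0" by (simp only: measure_empty)
    then show ?thesis using False by (simp add: K_weight_def)
  next
    case True
    let ?F = "{P. P \<in> tableaux l \<and> sh P = h n}"
    have "\<P>(\<omega> in M. PP (Suc n) \<omega> = P \<and> shapes (Suc n) h \<omega>) = \<P>(\<omega> in M. PP (Suc n) \<omega> = P \<and> shapes n h \<omega>)"
      using True by (intro prob_eq_I) (auto simp: le_Suc_eq)
    also have "\<dots> = (\<Sum>Q\<in>?F. \<P>(\<omega> in M. (PP (Suc n) \<omega> = P \<and> shapes n h \<omega>) \<and> PP n \<omega> = Q))"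
    proof (rule prob_PP_split)
      show "finite {P \<in> tableaux l. sh P = h n}" by (rule finite_tableaux_shape)
      fix \<omega> assume \<omega>: "\<omega> \<in> space M" and sh: "PP (Suc n) \<omega> = P \<and> shapes n h \<omega>"
      \<comment> \<open>\<open>shapes\<close> starts at time 1; time 0 is settled by the initial
        value.\<close>
      show "sh (PP n \<omega>) = h n"
      proof (cases n)
        case 0
        then show ?thesis using PP_0[OF \<omega>] assms(1) by (simp add: sh_def)
      next
        case (Suc m)
        then show ?thesis using sh by auto
      qed
    qed measurable
    also have "\<dots> = (\<Sum>Q\<in>?F. path_L n h * (weight l a (ty Q) * kappa q l Q * trans_M q l a Q P))"
    proof (rule sum.cong)
      fix Q assume Q: "Q \<in> ?F"
      have "\<P>(\<omega> in M. (PP (Suc n) \<omega> = P \<and> shapes n h \<omega>) \<and> PP n \<omega> = Q)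
          = \<P>(\<omega> in M. PP (Suc n) \<omega> = P \<and> PP n \<omega> = Q \<and> shapes n h \<omega>)"
        by (rule prob_eq_I) auto
      also have "\<dots> = trans_M q l a Q P * \<P>(\<omega> in M. PP n \<omega> = Q \<and> shapes n h \<omega>)"
        unfolding shapes_hist by (rule PP_step[OF P'])
      also have "\<P>(\<omega> in M. PP n \<omega> = Q \<and> shapes n h \<omega>) = path_L n h * K_weight q l a (h n) Q"
        using Suc.IH Suc.prems(1) Q by simp
      finally show "\<P>(\<omega> in M. (PP (Suc n) \<omega> = P \<and> shapes n h \<omega>) \<and> PP n \<omega> = Q)
          = path_L n h * (weight l a (ty Q) * kappa q l Q * trans_M q l a Q P)"
        using Q by (simp add: K_weight_def mult_ac)
    qed simp
    also have "\<dots> = path_L n h * (L_ker q l (h n) (sh P) * (weight l a (ty P) * kappa q l P))"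
      using K_intertwining[OF q P' Suc.prems(1)[of n], of a] by (simp add: sum_distrib_left[symmetric])
    finally show ?thesis using True by (simp add: path_L_def K_weight_def mult.assoc)
  qed
qed

lemma prob_shapes_pred:
  assumes h: "h 0 = []" "\<And>i. i < n \<Longrightarrow> is_partition (h i)"
  shows "\<P>(\<omega> in M. S (PP n \<omega>) \<and> shapes n h \<omega>)
    = path_L n h * (\<Sum>P | P \<in> tableaux l \<and> sh P = h n \<and> S P. weight l a (ty P) * kappa q l P)"
proof -
  let ?F = "{P. P \<in> tableaux l \<and> sh P = h n \<and> S P}"
  have [measurable]: "Measurable.pred M (\<lambda>\<omega>. S (PP n \<omega>))"
    by (rule measurable_compose[OF PP_measurable]) simp
  have "\<P>(\<omega> in M. S (PP n \<omega>) \<and> shapes n h \<omega>)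
      = (\<Sum>P\<in>?F. \<P>(\<omega> in M. (S (PP n \<omega>) \<and> shapes n h \<omega>) \<and> PP n \<omega> = P))"
  proof (rule prob_PP_split)
    show "finite {P \<in> tableaux l. sh P = h n \<and> S P}"
      by (rule finite_subset[OF _ finite_tableaux_shape[of l "h n"]]) auto
    fix \<omega> assume \<omega>: "\<omega> \<in> space M" and sh: "S (PP n \<omega>) \<and> shapes n h \<omega>"
    show "sh (PP n \<omega>) = h n \<and> S (PP n \<omega>)"
    proof (cases n)
      case 0
      then show ?thesis using PP_0[OF \<omega>] h(1) sh by (simp add: sh_def)
    next
      case (Suc m)
      then show ?thesis using sh by auto
    qed
  qed measurable
  also have "\<dots> = (\<Sum>P\<in>?F. path_L n h * (weight l a (ty P) * kappa q l P))"
  proof (rule sum.cong)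
    fix P assume P: "P \<in> ?F"
    have "\<P>(\<omega> in M. (S (PP n \<omega>) \<and> shapes n h \<omega>) \<and> PP n \<omega> = P) = \<P>(\<omega> in M. PP n \<omega> = P \<and> shapes n h \<omega>)"
      using P by (intro prob_eq_I) auto
    then show "\<P>(\<omega> in M. (S (PP n \<omega>) \<and> shapes n h \<omega>) \<and> PP n \<omega> = P) = path_L n h * (weight l a (ty P) * kappa q l P)"
      using prob_PP_shapes[of h n P] h P by (simp add: K_weight_def)
  qed simp
  finally show ?thesis by (simp add: sum_distrib_left)
qed

lemma prob_shapes:
  assumes "h 0 = []" "\<And>i. i < n \<Longrightarrow> is_partition (h i)"
  shows "\<P>(\<omega> in M. shapes n h \<omega>) = path_L n h * Psi q l a (h n)"
  using prob_shapes_pred[where h = h and n = n and S = "\<lambda>_. True", OF assms] by (simp add: Psi_def)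

lemma shapes_Omega:
  assumes pos: "\<P>(\<omega> in M. shapes n h \<omega>) > 0" and i: "i \<in> {1..n}"
  shows "h i \<in> Omega l"
proof (rule ccontr)
  assume "h i \<notin> Omega l"
  then have no: "\<not> shapes n h \<omega>" if "PP i \<omega> \<in> tableaux l" for \<omega>
    using sh_Omega[OF that] i by (auto intro!: bexI[of _ i])
  have "\<P>(\<omega> in M. shapes n h \<omega>) \<le> \<P>(\<omega> in M. PP i \<omega> \<notin> tableaux l)"
    by (rule prob_mono_I) (measurable, use no in blast)
  then show False using pos PP_not_tableaux[of i] by linarith
qed

text \<open>Conditioning on the shapes at times \<open>1..n\<close> does not mention \<open>h 0\<close>; the value of
  the process at time \<open>0\<close> is \<open>[]\<close>.\<close>

lemma shapes_history:
  assumes pos: "\<P>(\<omega> in M. shapes n h \<omega>) > 0"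
  defines "h' \<equiv> h(0 := [])"
  shows "h' 0 = []" "\<And>i. i \<le> n \<Longrightarrow> h' i \<in> Omega l" "\<And>i. i \<le> n \<Longrightarrow> is_partition (h' i)"
    "\<And>\<omega>. shapes n h \<omega> \<longleftrightarrow> shapes n h' \<omega>" "path_L n h' * Psi q l a (h' n) > 0"
proof -
  show h0: "h' 0 = []" by (simp add: h'_def)
  have "[] \<in> Omega l" by (simp add: Omega_def is_partition_def)
  then show om: "h' i \<in> Omega l" if "i \<le> n" for i
    using shapes_Omega[OF pos, of i] that by (cases "i = 0") (auto simp: h'_def)
  then show part: "is_partition (h' i)" if "i \<le> n" for i using that by (auto simp: Omega_def)
  show eq: "shapes n h \<omega> \<longleftrightarrow> shapes n h' \<omega>" for \<omega> by (auto simp: h'_def)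
  show "path_L n h' * Psi q l a (h' n) > 0"
    using pos prob_shapes[of h' n, OF h0 part] unfolding eq by (simp only: less_imp_le)
qed

theorem shape_markov_chain: "markov_chain M (Omega l) (\<lambda>n \<omega>. sh (PP n \<omega>)) (trans_p q l a)"
  unfolding markov_chain_def
proof (intro conjI allI impI)
  show "AE \<omega> in M. sh (PP n \<omega>) \<in> Omega l" for n
    using AE_PP[of n] by (rule AE_mp) (simp add: sh_Omega)
  fix n h y assume y: "y \<in> Omega l" and pos: "\<P>(\<omega> in M. \<forall>i\<le>n. sh (PP i \<omega>) = h i) > 0"
  have h0: "h 0 = []"
  proof (rule ccontr)
    assume "h 0 \<noteq> []"
    then have "{\<omega> \<in> space M. \<forall>i\<le>n. sh (PP i \<omega>) = h i} = {}" using PP_0 by (auto simp: sh_def)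
    then show False using pos by (simp only: measure_empty less_irrefl)
  qed
  have all: "(\<forall>i\<le>n. sh (PP i \<omega>) = h i) \<longleftrightarrow> shapes n h \<omega>" if "\<omega> \<in> space M" for \<omega>
  proof -
    have "(\<forall>i\<le>n. Q i) \<longleftrightarrow> Q 0 \<and> (\<forall>i\<in>{1..n}. Q i)" for Q :: "nat \<Rightarrow> bool"
      by (metis One_nat_def Suc_leI atLeastAtMost_iff gr0I zero_le)
    from this[of "\<lambda>i. sh (PP i \<omega>) = h i"] show ?thesis using PP_0[OF that] h0 by (simp add: sh_def)
  qed
  have p: "\<P>(\<omega> in M. \<forall>i\<le>n. sh (PP i \<omega>) = h i) = \<P>(\<omega> in M. shapes n h \<omega>)"
    by (rule prob_eq_I) (rule all)
  have h: "h(0 := []) = h" using h0 by auto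
  note H = shapes_history[OF pos[unfolded p], unfolded h]
  \<comment> \<open>The history prolonged by \<open>y\<close>: numerator and denominator then share
    \<open>path_L n h\<close>, and the quotient depends on \<open>h\<close> only through
    \<open>h n\<close>.\<close>
  define g where "g = h(Suc n := y)"
  have "\<P>(\<omega> in M. sh (PP (Suc n) \<omega>) = y \<and> (\<forall>i\<le>n. sh (PP i \<omega>) = h i)) = \<P>(\<omega> in M. shapes (Suc n) g \<omega>)"
  proof (rule prob_eq_I)
    fix \<omega> assume \<omega>: "\<omega> \<in> space M"
    have "{1..Suc n} = insert (Suc n) {1..n}" by auto
    then show "sh (PP (Suc n) \<omega>) = y \<and> (\<forall>i\<le>n. sh (PP i \<omega>) = h i) \<longleftrightarrow> shapes (Suc n) g \<omega>"
      unfolding all[OF \<omega>] by (auto simp: g_def)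
  qed
  also have "\<dots> = path_L (Suc n) g * Psi q l a (g (Suc n))"
    using h0 H(3) by (intro prob_shapes) (auto simp: g_def)
  also have "path_L (Suc n) g = path_L n h * L_ker q l (h n) y"
    by (simp add: path_L_def g_def)
  finally have num: "\<P>(\<omega> in M. sh (PP (Suc n) \<omega>) = y \<and> (\<forall>i\<le>n. sh (PP i \<omega>) = h i))
      = path_L n h * L_ker q l (h n) y * Psi q l a y" by (simp add: g_def)
  have den: "\<P>(\<omega> in M. \<forall>i\<le>n. sh (PP i \<omega>) = h i) = path_L n h * Psi q l a (h n)"
    unfolding p using prob_shapes[of h n] h0 H(3) by simp
  have nz: "path_L n h \<noteq> 0" using H(5) by auto
  have "\<P>(\<omega> in M. sh (PP (Suc n) \<omega>) = y \<bar> \<forall>i\<le>n. sh (PP i \<omega>) = h i)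
      = L_ker q l (h n) y * Psi q l a y / Psi q l a (h n)"
    unfolding cond_prob_def num den using nz by (simp add: mult.assoc)
  also have "\<dots> = trans_p q l a (h n) y"
    using L_ker_adds_box[of q l "h n" y] by (auto simp: trans_p_def)
  finally show "\<P>(\<omega> in M. sh (PP (Suc n) \<omega>) = y \<bar> \<forall>i\<le>n. sh (PP i \<omega>) = h i) = trans_p q l a (h n) y" .
qed measurable

text \<open>The history enters numerator and denominator only through the common factor
  \<open>path_L\<close>, which cancels. The predicate \<open>S\<close> serves both for the tableau
  and for its type.\<close>

theorem conditional_law:
  assumes pos: "\<P>(\<omega> in M. shapes n h \<omega> \<and> sh (PP n \<omega>) = lam) > 0"
  shows "\<P>(\<omega> in M. S (PP n \<omega>) \<bar> shapes n h \<omega> \<and> sh (PP n \<omega>) = lam)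
    = (\<Sum>P | P \<in> tableaux l \<and> sh P = lam \<and> S P. weight l a (ty P) * kappa q l P) / Psi q l a lam"
proof -
  define h' where "h' = h(0 := [])"
  have "\<exists>\<omega>\<in>space M. shapes n h \<omega> \<and> sh (PP n \<omega>) = lam"
  proof (rule ccontr)
    assume "\<not> ?thesis"
    then have "{\<omega> \<in> space M. shapes n h \<omega> \<and> sh (PP n \<omega>) = lam} = {}" by auto
    then show False using pos by (simp only: measure_empty less_irrefl)
  qed
  then have lam: "lam = h' n" by (cases "n = 0") (auto simp: h'_def PP_0 sh_def)
  have eq: "shapes n h \<omega> \<and> sh (PP n \<omega>) = lam \<longleftrightarrow> shapes n h \<omega>" if "\<omega> \<in> space M" for \<omega>
    using lam PP_0[OF that] by (cases "n = 0") (auto simp: h'_def sh_def)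
  have den: "\<P>(\<omega> in M. shapes n h \<omega> \<and> sh (PP n \<omega>) = lam) = \<P>(\<omega> in M. shapes n h \<omega>)"
    by (rule prob_eq_I) (rule eq)
  note H = shapes_history[OF pos[unfolded den], folded h'_def]
  have num: "\<P>(\<omega> in M. S (PP n \<omega>) \<and> shapes n h \<omega> \<and> sh (PP n \<omega>) = lam) = \<P>(\<omega> in M. S (PP n \<omega>) \<and> shapes n h' \<omega>)"
    by (rule prob_eq_I) (use eq H(4) in blast)
  have part: "is_partition (h' i)" if "i < n" for i using H(3) that by simp
  have num': "\<P>(\<omega> in M. S (PP n \<omega>) \<and> shapes n h' \<omega>)
      = path_L n h' * (\<Sum>P | P \<in> tableaux l \<and> sh P = h' n \<and> S P. weight l a (ty P) * kappa q l P)"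
    by (rule prob_shapes_pred) (use H(1) part in auto)
  have den': "\<P>(\<omega> in M. shapes n h' \<omega>) = path_L n h' * Psi q l a (h' n)"
    by (rule prob_shapes) (use H(1) part in auto)
  have "path_L n h' \<noteq> 0" using H(5) by auto
  then show ?thesis
    unfolding cond_prob_def num den unfolding H(4) unfolding num' den' lam by simp
qed

text \<open>For at most \<open>l\<close> parts this is the total of \<open>path_L\<close> over all
  growth sequences from \<open>[]\<close> to \<open>lam\<close>. Only its recursion is used, so the
  sum over sequences never has to be formed.\<close>

definition F_norm :: "nat list \<Rightarrow> real" where
  "F_norm lam = f_lambda q lam / qpoch q (nth_part lam l)"

lemma trans_M_adds_box:
  assumes "P \<in> tableaux l" "P' \<in> tableaux l" "trans_M q l a P P' \<noteq> 0"
  shows "adds_box (sh P) (sh P')"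
proof -
  obtain k where "k \<in> {1..l}" "q_insert q l k P P' \<noteq> 0"
    using assms(3) unfolding trans_M_def by (metis (no_types, lifting) mult_zero_right sum.neutral)
  then show ?thesis using q_insert_plus_e[OF assms(1,2)] by (metis adds_box_def atLeastAtMost_iff)
qed

text \<open>Every insertion adds one box, so the size tells the time. In the induction step the
  preceding tableaux are grouped by shape: within a shape \<open>K_intertwining\<close> applies,
  across the shapes the recursion of \<open>F_norm\<close>.\<close>

lemma prob_PP:
  assumes "P \<in> tableaux l" "sum_list (sh P) = n"
  shows "\<P>(\<omega> in M. PP n \<omega> = P) = F_norm (sh P) * (weight l a (ty P) * kappa q l P)"
  using assms
proof (induction n arbitrary: P)
  case 0
  then have "P = []" using sh_partition[OF 0(1)] by (cases P) (auto simp: sh_def is_partition_def)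
  then show ?case
    by (simp add: PP_0_prob kappa_Nil weight_Nil F_norm_def sh_def f_lambda_Nil nth_part_def qpoch_def)
next
  case (Suc n)
  let ?w = "\<lambda>P. weight l a (ty P) * kappa q l P"
  define MU where "MU = {mu. is_partition mu \<and> adds_box mu (sh P)}"
  define G where "G = {Q. Q \<in> tableaux l \<and> adds_box (sh Q) (sh P)}"
  have finMU: "finite MU" unfolding MU_def by (rule finite_adds_box)
  have G: "G = (\<Union>mu\<in>MU. {Q. Q \<in> tableaux l \<and> sh Q = mu})"
    using sh_partition by (auto simp: G_def MU_def)
  have finG: "finite G" unfolding G using finMU finite_tableaux_shape by blast
  have step: "\<P>(\<omega> in M. PP (Suc n) \<omega> = P \<and> PP n \<omega> = Q) = trans_M q l a Q P * \<P>(\<omega> in M. PP n \<omega> = Q)" for Q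
    using PP_step[OF Suc.prems(1), of n Q "\<lambda>_. True"] by simp
  have "\<P>(\<omega> in M. PP (Suc n) \<omega> = P) = (\<Sum>Q\<in>G. \<P>(\<omega> in M. PP (Suc n) \<omega> = P \<and> PP n \<omega> = Q))"
  proof (rule prob_sum_fibres[OF PP_measurable _ finG])
    fix Q assume "Q \<notin> G"
    then show "\<P>(\<omega> in M. PP (Suc n) \<omega> = P \<and> PP n \<omega> = Q) = 0"
      unfolding step using trans_M_adds_box[OF _ Suc.prems(1), of Q] prob_outside_tableaux[of Q n] by (auto simp: G_def)
  qed measurable
  also have "\<dots> = (\<Sum>Q\<in>G. F_norm (sh Q) * (?w Q * trans_M q l a Q P))"
  proof (rule sum.cong)
    fix Q assume Q: "Q \<in> G"
    then have "sum_list (sh Q) = n" using Suc.prems(2) plus_e_sum_list by (force simp: G_def adds_box_def)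
    then show "\<P>(\<omega> in M. PP (Suc n) \<omega> = P \<and> PP n \<omega> = Q) = F_norm (sh Q) * (?w Q * trans_M q l a Q P)"
      unfolding step using Suc.IH[of Q] Q by (simp add: G_def)
  qed simp
  also have "\<dots> = (\<Sum>mu\<in>MU. \<Sum>Q | Q \<in> tableaux l \<and> sh Q = mu. F_norm (sh Q) * (?w Q * trans_M q l a Q P))"
    unfolding G by (rule sum.UNION_disjoint) (use finMU finite_tableaux_shape in auto)
  also have "\<dots> = (\<Sum>mu\<in>MU. F_norm mu * (L_ker q l mu (sh P) * ?w P))"
  proof (rule sum.cong)
    fix mu assume mu: "mu \<in> MU"
    have "(\<Sum>Q | Q \<in> tableaux l \<and> sh Q = mu. F_norm (sh Q) * (?w Q * trans_M q l a Q P))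
        = F_norm mu * (\<Sum>Q | Q \<in> tableaux l \<and> sh Q = mu. ?w Q * trans_M q l a Q P)"
      by (simp add: sum_distrib_left)
    then show "(\<Sum>Q | Q \<in> tableaux l \<and> sh Q = mu. F_norm (sh Q) * (?w Q * trans_M q l a Q P))
        = F_norm mu * (L_ker q l mu (sh P) * ?w P)"
      using K_intertwining[OF q Suc.prems(1), of mu a] mu by (simp add: MU_def)
  qed simp
  also have "\<dots> = (\<Sum>mu\<in>MU. L_ker q l mu (sh P) * F_norm mu) * ?w P"
    unfolding sum_distrib_right by (rule sum.cong) (simp_all only: mult_ac)
  also have "(\<Sum>mu\<in>MU. L_ker q l mu (sh P) * F_norm mu) = F_norm (sh P)"
    unfolding F_norm_def MU_def
    using f_lambda_normalized_Suc[OF q l sh_partition[OF Suc.prems(1)] Suc.prems(2) length_sh[OF Suc.prems(1)]] by simp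
  finally show ?case .
qed

theorem prob_shape:
  "\<P>(\<omega> in M. sh (PP (sum_list lam) \<omega>) = lam)
    = inverse (qpoch q (nth_part lam l)) * Psi q l a lam * f_lambda q lam"
proof -
  let ?n = "sum_list lam" and ?F = "{P. P \<in> tableaux l \<and> sh P = lam}"
  have "\<P>(\<omega> in M. sh (PP ?n \<omega>) = lam) = (\<Sum>P\<in>?F. \<P>(\<omega> in M. sh (PP ?n \<omega>) = lam \<and> PP ?n \<omega> = P))"
  proof (rule prob_PP_split)
    show "Measurable.pred M (\<lambda>\<omega>. sh (PP ?n \<omega>) = lam)" by measurable
    show "finite {P \<in> tableaux l. sh P = lam}" by (rule finite_tableaux_shape)
  qed
  also have "\<dots> = (\<Sum>P\<in>?F. F_norm lam * (weight l a (ty P) * kappa q l P))"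
  proof (rule sum.cong)
    fix P assume P: "P \<in> ?F"
    have "\<P>(\<omega> in M. sh (PP ?n \<omega>) = lam \<and> PP ?n \<omega> = P) = \<P>(\<omega> in M. PP ?n \<omega> = P)"
      using P by (intro prob_eq_I) auto
    then show "\<P>(\<omega> in M. sh (PP ?n \<omega>) = lam \<and> PP ?n \<omega> = P) = F_norm lam * (weight l a (ty P) * kappa q l P)"
      using prob_PP[of P ?n] P by simp
  qed simp
  also have "\<dots> = F_norm lam * Psi q l a lam" by (simp add: Psi_def sum_distrib_left)
  finally show ?thesis by (simp add: F_norm_def divide_inverse mult_ac)
qed

end

theorem theorem5:
  fixes M :: "'w measure" and l :: nat and q :: real and a :: "nat \<Rightarrow> real"
    and w :: "nat \<Rightarrow> 'w \<Rightarrow> nat" and PP :: "nat \<Rightarrow> 'w \<Rightarrow> tableau"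
    and LL :: "nat \<Rightarrow> 'w \<Rightarrow> nat list"
  assumes "l \<ge> 1" and "0 \<le> q" and "q < 1"
    and a_nonneg: "\<And>i. i \<in> {1..l} \<Longrightarrow> a i \<ge> 0" and a_sum: "(\<Sum>i=1..l. a i) = 1"
    and "prob_space M"
    and letters_indep: "prob_space.indep_vars M (\<lambda>_. count_space UNIV) w {1..}"
    and letters_dist: "\<And>m k. m \<ge> 1 \<Longrightarrow> k \<in> {1..l} \<Longrightarrow> \<P>(\<omega> in M. w m \<omega> = k) = a k"
    and process: "q_insertion_process M q l w PP"
    and LL_eq: "\<And>m \<omega>. LL m \<omega> = sh (PP m \<omega>)"
  shows
    "(stochastic_on (tableaux l) (trans_M q l a) \<and>
     markov_chain M (tableaux l) PP (trans_M q l a)) \<and>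
     (stochastic_on {mu \<in> Omega l. Psi q l a mu \<noteq> 0} (trans_p q l a) \<and>
     markov_chain M (Omega l) LL (trans_p q l a)) \<and>
     (\<forall>n. \<forall>lam\<in>Omega l. \<forall>h. \<forall>P\<in>tableaux l.
       \<P>(\<omega> in M. (\<forall>i\<in>{1..n}. LL i \<omega> = h i) \<and> LL n \<omega> = lam) > 0 \<longrightarrow>
       \<P>(\<omega> in M. PP n \<omega> = P \<bar> (\<forall>i\<in>{1..n}. LL i \<omega> = h i) \<and> LL n \<omega> = lam)
         = K_weight q l a lam P / Psi q l a lam) \<and>
     (\<forall>n. \<forall>lam\<in>Omega l. \<forall>h. \<forall>mu.
       \<P>(\<omega> in M. (\<forall>i\<in>{1..n}. LL i \<omega> = h i) \<and> LL n \<omega> = lam) > 0 \<longrightarrow>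
       \<P>(\<omega> in M. ty (PP n \<omega>) = mu \<bar> (\<forall>i\<in>{1..n}. LL i \<omega> = h i) \<and> LL n \<omega> = lam)
         = weight l a mu * k_coeff q l lam mu / (Delta q l lam * Psi q l a lam)) \<and>
     (\<forall>n lam. is_partition lam \<longrightarrow> sum_list lam = n \<longrightarrow>
       \<P>(\<omega> in M. LL n \<omega> = lam)
         = inverse (qpoch q (nth_part lam l)) * Psi q l a lam * f_lambda q lam)"
proof -
  interpret prob_space M by fact
  interpret q_insertion M l q a w PP
  proof
    show "w m \<in> M \<rightarrow>\<^sub>M count_space UNIV" if "1 \<le> m" for m
      using letters_indep that by (simp add: indep_vars_def2)
  qed (use assms in auto)
  have LL: "LL = (\<lambda>n \<omega>. sh (PP n \<omega>))" using LL_eq by (simp add: fun_eq_iff)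
  have 3: "\<P>(\<omega> in M. PP n \<omega> = P \<bar> (\<forall>i\<in>{1..n}. LL i \<omega> = h i) \<and> LL n \<omega> = lam) = K_weight q l a lam P / Psi q l a lam"
    if P: "P \<in> tableaux l" and pos: "\<P>(\<omega> in M. (\<forall>i\<in>{1..n}. LL i \<omega> = h i) \<and> LL n \<omega> = lam) > 0" for n lam h P
  proof -
    \<comment> \<open>With the tableau prescribed, at most one summand remains, and the indicator in
      \<open>K_weight\<close> tells whether it does.\<close>
    have "{P'. P' \<in> tableaux l \<and> sh P' = lam \<and> P' = P} = (if sh P = lam then {P} else {})" using P by auto
    then show ?thesis
      using conditional_law[OF pos[unfolded LL], of "\<lambda>P'. P' = P"] by (simp add: LL K_weight_def)
  qed
  have 4: "\<P>(\<omega> in M. ty (PP n \<omega>) = mu \<bar> (\<forall>i\<in>{1..n}. LL i \<omega> = h i) \<and> LL n \<omega> = lam)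
      = weight l a mu * k_coeff q l lam mu / (Delta q l lam * Psi q l a lam)"
    if pos: "\<P>(\<omega> in M. (\<forall>i\<in>{1..n}. LL i \<omega> = h i) \<and> LL n \<omega> = lam) > 0" for n lam h mu
  proof -
    have "(\<Sum>P | P \<in> tableaux l \<and> sh P = lam \<and> ty P = mu. weight l a (ty P) * kappa q l P)
        = weight l a mu * (\<Sum>P | P \<in> tableaux l \<and> sh P = lam \<and> ty P = mu. kappa q l P)"
      by (simp add: sum_distrib_left)
    \<comment> \<open>\<open>Delta\<close> is a product of positive factors, so it cancels between
      \<open>k_coeff\<close> and the denominator.\<close>
    moreover have "Delta q l lam \<noteq> 0"
      unfolding Delta_def using qpoch_pos[OF q] by (simp add: less_imp_neq[symmetric])
    ultimately show ?thesis
      using conditional_law[OF pos[unfolded LL], of "\<lambda>P. ty P = mu"] by (simp add: LL k_coeff_def)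
  qed
  have 5: "\<P>(\<omega> in M. LL n \<omega> = lam) = inverse (qpoch q (nth_part lam l)) * Psi q l a lam * f_lambda q lam"
    if "sum_list lam = n" for n lam
    using prob_shape[of lam] that by (simp add: LL)
  show ?thesis
    using trans_M_stochastic[OF q a_nonneg a_sum] PP_markov_chain
      trans_p_stochastic[OF q a_nonneg a_sum] shape_markov_chain 3 4 5
    unfolding LL by blast
qed

end
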